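(* The monoid ${\cal M}^{\sf P}_{\sf poly} = {\cal RM}^{\sf P}/\!\equiv_{\sf poly}$ is regular if and only if the monoid ${\cal RM}^{\sf P}$ is regular.
   Context: Let $A=\{0,1\}$, and let $A^*$ be the set of all finite words over $A$ (including the empty word), $|x|$ the length of $x$. "Function" means partial function; ${\sf Dom}(f)$ is the domain of $f$. Composition is of partial functions. For words $v,w$: $v$ is a prefix of $w$ iff $w=vx$ for some $x\in A^*$; $v \parallel_{\sf pref} w$ means that one of $v,w$ is a prefix of the other. A prefix code is a set $P\subset A^*$ in which no two distinct elements are prefix-comparable. A right ideal is a set $R\subseteq A^*$ with $RA^*=R$; every right ideal $R$ equals $PA^*$ for a unique prefix code $P$. A function $f:A^*\to A^*$ is polynomially balanced iff there is a polynomial $p$ such that $|f(x)|\le p(|x|)$ and $|x|\le p(|f(x)|)$ for all $x\in{\sf Dom}(f)$. ${\sf fP}$ is the monoid of all polynomially balanced partial functions $A^*\to A^*$ computable by deterministic Turing machines in polynomial time. A right-ideal morphism is a partial function $h:A^*\to A^*$ such that ${\sf Dom}(h)$ is a right ideal and $h(xw)=h(x)\,w$ for all $x\in{\sf Dom}(h)$, $w\in A^*$. ${\sf domC}(h)$ is the prefix code that generates ${\sf Dom}(h)$ as a right ideal. ${\cal RM}^{\sf P}$ is the monoid (under composition) of all $f\in{\sf fP}$ that are right-ideal morphisms. For $L_1,L_2\subseteq A^*$: $L_1\equiv_{\sf end}L_2$ iff $L_1A^*$ and $L_2A^*$ intersect (i.e., meet in a nonempty set) the same right ideals of $A^*$.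 For prefix codes $P_1,P_2$: $P_1\equiv_{\sf poly}P_2$ iff $P_1\equiv_{\sf end}P_2$ and there is a polynomial $\tau$ with non-negative integer coefficients such that for all $x_1\in P_1$, $x_2\in P_2$ with $x_1\parallel_{\sf pref}x_2$: $|x_1|\le\tau(|x_2|)$ and $|x_2|\le\tau(|x_1|)$. For right-ideal morphisms: $f\equiv_{\sf poly}g$ iff ${\sf domC}(f)\equiv_{\sf poly}{\sf domC}(g)$ and $f(x)=g(x)$ for all $x\in{\sf Dom}(f)\cap{\sf Dom}(g)$. The relation $\equiv_{\sf poly}$ is a congruence on ${\cal RM}^{\sf P}$, and ${\cal M}^{\sf P}_{\sf poly}$ denotes the quotient monoid. An element $s$ of a monoid $M$ is regular iff there is $s'\in M$ (called an inverse of $s$) with $ss's=s$; $M$ is regular iff all its elements are regular. *)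

theory Defs
  imports "HOL-Algebra.Group" "HOL-Computational_Algebra.Polynomial" "HOL-Library.Sublist"
begin

type_synonym word = "bool list"

type_synonym pfun = "word \<rightharpoonup> word"


section \<open>Polynomial-time computable partial functions\<close>

text \<open>
  Deterministic Turing machines with a fixed number of two-way infinite tapes.
  States and tape symbols are natural numbers.  Symbol 0 is the blank, and the
  letters 0 and 1 of the input/output alphabet are the symbols 1 and 2.
\<close>

datatype move = MLeft | MStay | MRight

record tm =
  tm_tapes :: nat
  tm_states :: "nat set"
  tm_symbols :: "nat set"
  tm_start :: nat
  tm_accept :: nat
  tm_reject :: nat
  tm_delta :: "nat \<Rightarrow> nat list \<Rightarrow> nat \<times> (nat \<times> move) list"

definition turing_machine :: "tm \<Rightarrow> bool" where
  "turing_machine M \<longleftrightarrow>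
     tm_tapes M \<ge> 1 \<and>
     finite (tm_states M) \<and> {tm_start M, tm_accept M, tm_reject M} \<subseteq> tm_states M \<and>
     tm_accept M \<noteq> tm_reject M \<and>
     finite (tm_symbols M) \<and> {0, 1, 2} \<subseteq> tm_symbols M \<and>
     (\<forall>q \<in> tm_states M - {tm_accept M, tm_reject M}. \<forall>as.
        length as = tm_tapes M \<and> set as \<subseteq> tm_symbols M \<longrightarrow>
        fst (tm_delta M q as) \<in> tm_states M \<and>
        length (snd (tm_delta M q as)) = tm_tapes M \<and>
        fst ` set (snd (tm_delta M q as)) \<subseteq> tm_symbols M)"

text \<open>A tape is its contents together with the head position.\<close>

type_synonym tape = "(int \<Rightarrow> nat) \<times> int"

type_synonym config = "nat \<times> tape list"

fun shift :: "move \<Rightarrow> int \<Rightarrow> int" where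
  "shift MLeft i = i - 1"
| "shift MStay i = i"
| "shift MRight i = i + 1"

fun read :: "tape \<Rightarrow> nat" where
  "read (t, i) = t i"

fun act :: "nat \<times> move \<Rightarrow> tape \<Rightarrow> tape" where
  "act (b, d) (t, i) = (t(i := b), shift d i)"

text \<open>The halting configurations are fixed points of \<open>step\<close>.\<close>

fun step :: "tm \<Rightarrow> config \<Rightarrow> config" where
  "step M (q, ts) =
     (if q = tm_accept M \<or> q = tm_reject M then (q, ts)
      else let (q', as) = tm_delta M q (map read ts) in (q', map2 act as ts))"

definition contents :: "word \<Rightarrow> int \<Rightarrow> nat" where
  "contents x i =
     (if 0 \<le> i \<and> i < int (length x) then (if x ! nat i then 2 else 1) else 0)"

definition init :: "tm \<Rightarrow> word \<Rightarrow> config" where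
  "init M x = (tm_start M, (contents x, 0) # replicate (tm_tapes M - 1) (contents [], 0))"

text \<open>
  The input is on the first tape; on acceptance the last tape contains exactly the
  output, its first letter in cell 0.  The machine halts within
  the time bound on all inputs, and rejects the inputs outside of the domain.
\<close>

definition polytime_computable :: "pfun \<Rightarrow> bool" where
  "polytime_computable f \<longleftrightarrow>
     (\<exists>M. \<exists>p :: nat poly. turing_machine M \<and>
        (\<forall>x. case (step M ^^ poly p (length x)) (init M x) of (q, ts) \<Rightarrow>
           (case f x of
              None \<Rightarrow> q = tm_reject M
            | Some y \<Rightarrow> q = tm_accept M \<and> fst (last ts) = contents y)))"

definition poly_balanced :: "pfun \<Rightarrow> bool" where
  "poly_balanced f \<longleftrightarrow>
     (\<exists>p :: nat poly. \<forall>x y. f x = Some y \<longrightarrow>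
        length y \<le> poly p (length x) \<and> length x \<le> poly p (length y))"

definition fP :: "pfun set" where
  "fP = {f. poly_balanced f \<and> polytime_computable f}"


section \<open>Right ideals and right-ideal morphisms\<close>

definition gen_ideal :: "word set \<Rightarrow> word set" where
  "gen_ideal L = {x @ w | x w. x \<in> L}"

definition right_ideal :: "word set \<Rightarrow> bool" where
  "right_ideal R \<longleftrightarrow> gen_ideal R = R"

definition pref_comparable :: "word \<Rightarrow> word \<Rightarrow> bool" where
  "pref_comparable v w \<longleftrightarrow> prefix v w \<or> prefix w v"

definition prefix_code :: "word set \<Rightarrow> bool" where
  "prefix_code P \<longleftrightarrow> (\<forall>v \<in> P. \<forall>w \<in> P. v \<noteq> w \<longrightarrow> \<not> pref_comparable v w)"

definition right_ideal_morphism :: "pfun \<Rightarrow> bool" where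
  "right_ideal_morphism h \<longleftrightarrow>
     right_ideal (dom h) \<and>
     (\<forall>x \<in> dom h. \<forall>w. h (x @ w) = map_option (\<lambda>y. y @ w) (h x))"

definition domC :: "pfun \<Rightarrow> word set" where
  "domC h = (THE P. prefix_code P \<and> gen_ideal P = dom h)"

definition RM :: "pfun set" where
  "RM = {f \<in> fP. right_ideal_morphism f}"

definition RM_P :: "pfun monoid" where
  "RM_P = \<lparr>carrier = RM, monoid.mult = (\<lambda>f g. f \<circ>\<^sub>m g), one = Some\<rparr>"


section \<open>The congruence and the quotient monoid\<close>

definition end_equiv :: "word set \<Rightarrow> word set \<Rightarrow> bool" where
  "end_equiv L1 L2 \<longleftrightarrow>
     (\<forall>R. right_ideal R \<longrightarrow> (gen_ideal L1 \<inter> R \<noteq> {} \<longleftrightarrow> gen_ideal L2 \<inter> R \<noteq> {}))"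

definition poly_equiv_code :: "word set \<Rightarrow> word set \<Rightarrow> bool" where
  "poly_equiv_code P1 P2 \<longleftrightarrow>
     end_equiv P1 P2 \<and>
     (\<exists>\<tau> :: nat poly. \<forall>x1 \<in> P1. \<forall>x2 \<in> P2. pref_comparable x1 x2 \<longrightarrow>
        length x1 \<le> poly \<tau> (length x2) \<and> length x2 \<le> poly \<tau> (length x1))"

definition poly_equiv :: "pfun \<Rightarrow> pfun \<Rightarrow> bool" where
  "poly_equiv f g \<longleftrightarrow>
     poly_equiv_code (domC f) (domC g) \<and> (\<forall>x \<in> dom f \<inter> dom g. f x = g x)"

definition poly_rel :: "(pfun \<times> pfun) set" where
  "poly_rel = {(f, g). f \<in> RM \<and> g \<in> RM \<and> poly_equiv f g}"

text \<open>
  The product of two classes is written as the union of the classes of the products of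
  all representatives; as the relation is a congruence, these classes coincide.
\<close>

definition M_P_poly :: "pfun set monoid" where
  "M_P_poly =
     \<lparr>carrier = RM // poly_rel,
      monoid.mult = (\<lambda>X Y. \<Union>f \<in> X. \<Union>g \<in> Y. poly_rel `` {f \<circ>\<^sub>m g}),
      one = poly_rel `` {Some}\<rparr>"


section \<open>Regularity\<close>

definition regular_element :: "('a, 'b) monoid_scheme \<Rightarrow> 'a \<Rightarrow> bool" where
  "regular_element M s \<longleftrightarrow> (\<exists>s' \<in> carrier M. s \<otimes>\<^bsub>M\<^esub> s' \<otimes>\<^bsub>M\<^esub> s = s)"

definition regular_monoid :: "('a, 'b) monoid_scheme \<Rightarrow> bool" where
  "regular_monoid M \<longleftrightarrow> (\<forall>s \<in> carrier M. regular_element M s)"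

end

theory Submission
  imports Defs
begin

text \<open>
  The quotient map onto the classes of \<open>poly_equiv\<close> is a homomorphism, because \<open>poly_equiv\<close>
  is a congruence and the right-ideal morphisms in \<open>RM\<close> are closed under composition. Hence
  an inverse of \<open>f\<close> in \<open>RM_P\<close> yields an inverse of its class, and regularity of the quotient
  says exactly that every \<open>f\<close> has some \<open>g\<close> in \<open>RM\<close> for which \<open>f g f\<close> and \<open>f\<close> are equivalent
  (\<open>regular_M_P_poly_iff\<close>).

  Such a \<open>g\<close> need not be close to an inverse of \<open>f\<close>. If \<open>y = f x\<close>, equivalence only controls
  \<open>g\<close> on long extensions \<open>y w\<close>, and there \<open>g\<close> may return a preimage of \<open>y w\<close> that extends no
  preimage of \<open>y\<close>. The remedy is to apply regularity of the quotient not to \<open>f\<close> but to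
  \<open>encoded f\<close>, which maps \<open>encode x @ w\<close> to \<open>encode (f x) @ w\<close> for a self-delimiting code.
  An inverse of its class sends \<open>encode y\<close>, followed by polynomially many zeros, to a word
  that starts with \<open>encode u\<close>, where \<open>f u = y\<close> (\<open>encoded_inverse\<close>). The number of zeros is
  obtained from the length of \<open>y\<close> by the polynomials of the equivalence and of the balance
  of \<open>f\<close>. Decoding and then checking \<open>f u = y\<close> gives a polynomial-time function \<open>k\<close> that
  selects a preimage of every \<open>y\<close> in the image of \<open>f\<close> and is undefined elsewhere.

  The function \<open>k\<close> need not be a morphism. But the image of \<open>f\<close> is a right ideal, so
  one may cut \<open>y\<close> at its shortest prefix \<open>v\<close> in the image, \<open>y = v w\<close>, and send \<open>y\<close> to
  \<open>k v @ w\<close>. This is the morphism \<open>shortest k\<close>; it lies in \<open>RM\<close> and satisfies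
  \<open>f (shortest k) f = f\<close> (\<open>regular_lift\<close>).

  All functions that occur in this argument must be shown to be computable by Turing
  machines in polynomial time: compositions, \<open>encoded f\<close>, padding with a polynomial number
  of zeros, decoding, checking and \<open>shortest k\<close>. For this purpose small programs are written
  in a language of stack registers. A tape with its head on the top letter represents a
  stack, so that push and pop take constant time. Two theorems connect the language with
  Turing machines: a program that runs in polynomial time can be turned into a Turing
  machine (\<open>polytime_computableI\<close>), and every polynomial-time function is available as a
  subprogram (\<open>polytime_callable\<close>).
\<close>

section \<open>Right ideals and their prefix codes\<close>

lemma right_ideal_append: "right_ideal R \<Longrightarrow> x \<in> R \<Longrightarrow> x @ w \<in> R"
  unfolding right_ideal_def gen_ideal_def by blast

lemma right_ideal_gen: "right_ideal (gen_ideal L)"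
proof -
  have "gen_ideal (gen_ideal L) \<subseteq> gen_ideal L"
    unfolding gen_ideal_def by auto (metis append_assoc)
  moreover have "gen_ideal L \<subseteq> gen_ideal (gen_ideal L)"
    unfolding gen_ideal_def by auto
  ultimately show ?thesis unfolding right_ideal_def by blast
qed

lemma gen_ideal_iff: "z \<in> gen_ideal P \<longleftrightarrow> (\<exists>x\<in>P. prefix x z)"
  unfolding gen_ideal_def prefix_def by blast

definition minimal_words :: "word set \<Rightarrow> word set" where
  "minimal_words R = {x \<in> R. \<forall>y \<in> R. prefix y x \<longrightarrow> y = x}"

lemma minimal_words_prefix:
  assumes "z \<in> R"
  shows "\<exists>x \<in> minimal_words R. prefix x z"
  using assms
proof (induction "length z" arbitrary: z rule: less_induct)
  case less
  show ?case
  proof (cases "z \<in> minimal_words R")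
    case True
    then show ?thesis by blast
  next
    case False
    then obtain y where y: "y \<in> R" "prefix y z" "y \<noteq> z" using less.prems unfolding minimal_words_def by blast
    then have "length y < length z"
      by (metis le_neq_implies_less not_equal_is_parallel parallelE prefix_length_le)
    then show ?thesis using less.hyps[of y] y prefix_order.trans by blast
  qed
qed

lemma prefix_code_minimal: "prefix_code (minimal_words R)"
  unfolding prefix_code_def minimal_words_def pref_comparable_def by blast

lemma gen_ideal_minimal:
  assumes "right_ideal R" shows "gen_ideal (minimal_words R) = R"
proof (intro equalityI subsetI)
  fix z assume "z \<in> gen_ideal (minimal_words R)"
  then obtain x w where "z = x @ w" "x \<in> R" unfolding gen_ideal_def minimal_words_def by blast
  then show "z \<in> R" using right_ideal_append[OF assms] by blast
qed (simp add: gen_ideal_iff minimal_words_prefix)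

text \<open>
  This uniqueness turns the definite description in \<open>domC\<close> into the concrete set of the
  minimal words of the domain, which is the form that all later arguments use.
\<close>

lemma prefix_code_unique:
  assumes "prefix_code P" "gen_ideal P = R" shows "P = minimal_words R"
proof (intro equalityI subsetI)
  fix x assume x: "x \<in> P"
  then have "x \<in> R" using assms(2) gen_ideal_iff[of x P] by blast
  moreover have "y = x" if y: "y \<in> R" "prefix y x" for y
  proof -
    obtain p where p: "p \<in> P" "prefix p y" using y(1) assms(2) gen_ideal_iff[of y P] by blast
    then have "prefix p x" using y(2) prefix_order.trans by blast
    then have "p = x" using assms(1) p(1) x unfolding prefix_code_def pref_comparable_def by blast
    then show ?thesis using p(2) y(2) prefix_order.antisym by blast
  qed
  ultimately show "x \<in> minimal_words R" unfolding minimal_words_def by blast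
next
  fix x assume x: "x \<in> minimal_words R"
  then have "x \<in> gen_ideal P" using assms(2) unfolding minimal_words_def by blast
  then obtain p where p: "p \<in> P" "prefix p x" using gen_ideal_iff[of x P] by blast
  then have "p \<in> R" using assms(2) gen_ideal_iff[of p P] by blast
  then have "p = x" using x p(2) unfolding minimal_words_def by blast
  then show "x \<in> P" using p(1) by simp
qed

lemma domC_minimal:
  assumes "right_ideal_morphism h"
  shows "domC h = minimal_words (dom h)"
proof -
  have R: "right_ideal (dom h)" using assms unfolding right_ideal_morphism_def by blast
  show ?thesis unfolding domC_def
  proof (rule the_equality)
    show "prefix_code (minimal_words (dom h)) \<and> gen_ideal (minimal_words (dom h)) = dom h"
      using prefix_code_minimal gen_ideal_minimal[OF R] by blast
  qed (use prefix_code_unique in blast)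
qed

lemma gen_ideal_domC: "right_ideal_morphism h \<Longrightarrow> gen_ideal (domC h) = dom h"
  by (simp add: domC_minimal gen_ideal_minimal right_ideal_morphism_def)

lemma morphism_append: "right_ideal_morphism h \<Longrightarrow> h x = Some y \<Longrightarrow> h (x @ w) = Some (y @ w)"
  unfolding right_ideal_morphism_def by (metis domI option.simps(9))

lemma domC_prefix: "right_ideal_morphism h \<Longrightarrow> h x = Some y \<Longrightarrow> \<exists>c \<in> domC h. prefix c x"
  by (simp add: domC_minimal minimal_words_prefix domI)

lemma domC_dom: "right_ideal_morphism h \<Longrightarrow> c \<in> domC h \<Longrightarrow> \<exists>y. h c = Some y"
  by (auto simp: domC_minimal minimal_words_def)

lemma domC_least: "right_ideal_morphism h \<Longrightarrow> c \<in> domC h \<Longrightarrow> h d = Some y \<Longrightarrow> prefix d c \<Longrightarrow> d = c"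
  by (auto simp: domC_minimal minimal_words_def)

lemma right_ideal_morphismI:
  assumes "\<And>x y w. h x = Some y \<Longrightarrow> h (x @ w) = Some (y @ w)"
  shows "right_ideal_morphism h"
proof -
  have "gen_ideal (dom h) \<subseteq> dom h" unfolding gen_ideal_def using assms by blast
  moreover have "dom h \<subseteq> gen_ideal (dom h)" unfolding gen_ideal_def by auto
  ultimately show ?thesis unfolding right_ideal_morphism_def right_ideal_def using assms by force
qed

lemma morphism_comp:
  assumes "right_ideal_morphism f" "right_ideal_morphism g"
  shows "right_ideal_morphism (f \<circ>\<^sub>m g)"
proof (rule right_ideal_morphismI)
  fix x y w assume "(f \<circ>\<^sub>m g) x = Some y"
  then obtain z where "g x = Some z" "f z = Some y" by (auto simp: map_comp_Some_iff)
  then show "(f \<circ>\<^sub>m g) (x @ w) = Some (y @ w)"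
    using morphism_append[OF assms(1)] morphism_append[OF assms(2)] by simp
qed

section \<open>The congruence\<close>

text \<open>
  For domains of morphisms, meeting the same right ideals amounts to mutual extendability,
  since \<open>x\<close> can be tested with the right ideal generated by \<open>x\<close> alone.
\<close>

definition extends_into :: "pfun \<Rightarrow> pfun \<Rightarrow> bool" where
  "extends_into f g \<longleftrightarrow> (\<forall>x \<in> dom f. \<exists>w. x @ w \<in> dom g)"

lemma end_equiv_iff:
  assumes "right_ideal_morphism f" "right_ideal_morphism g"
  shows "end_equiv (domC f) (domC g) \<longleftrightarrow> extends_into f g \<and> extends_into g f"
proof -
  have fg: "extends_into f g" if "end_equiv (domC f) (domC g)"
      "right_ideal_morphism f" "right_ideal_morphism g" for f g
    unfolding extends_into_def
  proof
    fix x assume "x \<in> dom f"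
    moreover have "x \<in> gen_ideal {x}" by (simp add: gen_ideal_iff)
    ultimately have "dom g \<inter> gen_ideal {x} \<noteq> {}"
      using that right_ideal_gen[of "{x}"] unfolding end_equiv_def gen_ideal_domC[OF that(2)]
        gen_ideal_domC[OF that(3)] by blast
    then show "\<exists>w. x @ w \<in> dom g" unfolding gen_ideal_def by blast
  qed
  have meet: "dom g \<inter> R \<noteq> {}" if m: "extends_into f g" "right_ideal R" "dom f \<inter> R \<noteq> {}" for f g R
  proof -
    obtain x where x: "x \<in> dom f" "x \<in> R" using m(3) by blast
    then obtain w where "x @ w \<in> dom g" using m(1) unfolding extends_into_def by blast
    then show ?thesis using right_ideal_append[OF m(2) x(2)] by blast
  qed
  have sym: "end_equiv (domC g) (domC f)" if "end_equiv (domC f) (domC g)"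
    using that unfolding end_equiv_def by blast
  show ?thesis
  proof
    assume "end_equiv (domC f) (domC g)"
    then show "extends_into f g \<and> extends_into g f" using fg assms sym by blast
  next
    assume "extends_into f g \<and> extends_into g f"
    then show "end_equiv (domC f) (domC g)"
      unfolding end_equiv_def gen_ideal_domC[OF assms(1)] gen_ideal_domC[OF assms(2)]
      using meet by blast
  qed
qed

lemma poly_mono_nat: "m \<le> n \<Longrightarrow> poly (p :: nat poly) m \<le> poly p n"
  by (induction p) (auto intro!: add_mono mult_mono)

text \<open>
  Only pairs in which the word of \<open>f\<close> is the longer one matter: in the other case the bound
  is trivial. The symmetric condition of \<open>poly_equiv_code\<close> therefore splits into two
  instances of this one.
\<close>

definition length_control :: "nat poly \<Rightarrow> pfun \<Rightarrow> pfun \<Rightarrow> bool" where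
  "length_control \<tau> f g \<longleftrightarrow> (\<forall>x \<in> domC f. \<forall>y \<in> domC g. prefix y x \<longrightarrow> length x \<le> poly \<tau> (length y))"

lemma poly_equiv_iff:
  assumes "right_ideal_morphism f" "right_ideal_morphism g"
  shows "poly_equiv f g \<longleftrightarrow> extends_into f g \<and> extends_into g f \<and>
    (\<exists>\<tau>. length_control \<tau> f g) \<and> (\<exists>\<tau>. length_control \<tau> g f) \<and> (\<forall>x y z. f x = Some y \<longrightarrow> g x = Some z \<longrightarrow> y = z)"
proof -
  have "(\<exists>\<tau> :: nat poly. \<forall>x1 \<in> domC f. \<forall>x2 \<in> domC g. pref_comparable x1 x2 \<longrightarrow>
        length x1 \<le> poly \<tau> (length x2) \<and> length x2 \<le> poly \<tau> (length x1)) \<longleftrightarrow>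
      (\<exists>\<tau>. length_control \<tau> f g) \<and> (\<exists>\<tau>. length_control \<tau> g f)" (is "?L \<longleftrightarrow> ?R")
  proof
    assume ?L
    then show ?R unfolding length_control_def pref_comparable_def by blast
  next
    assume ?R
    then obtain \<tau>1 \<tau>2 where \<tau>: "length_control \<tau>1 f g" "length_control \<tau>2 g f" by blast
    have "length x1 \<le> poly (\<tau>1 + \<tau>2 + [:0, 1:]) (length x2) \<and>
        length x2 \<le> poly (\<tau>1 + \<tau>2 + [:0, 1:]) (length x1)"
      if x: "x1 \<in> domC f" "x2 \<in> domC g" "pref_comparable x1 x2" for x1 x2
    proof (cases "prefix x1 x2")
      case True
      then have "length x2 \<le> poly \<tau>2 (length x1)" using \<tau>(2) x unfolding length_control_def by blast
      then show ?thesis using prefix_length_le[OF True] by simp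
    next
      case False
      then have p: "prefix x2 x1" using x(3) unfolding pref_comparable_def by blast
      then have "length x1 \<le> poly \<tau>1 (length x2)" using \<tau>(1) x unfolding length_control_def by blast
      then show ?thesis using prefix_length_le[OF p] by simp
    qed
    then show ?L by blast
  qed
  moreover have "(\<forall>x \<in> dom f \<inter> dom g. f x = g x) \<longleftrightarrow>
      (\<forall>x y z. f x = Some y \<longrightarrow> g x = Some z \<longrightarrow> y = z)" by force
  ultimately show ?thesis
    unfolding poly_equiv_def poly_equiv_code_def end_equiv_iff[OF assms] by blast
qed

lemma poly_equiv_refl: "right_ideal_morphism f \<Longrightarrow> poly_equiv f f"
proof -
  assume f: "right_ideal_morphism f"
  have "length_control [:0, 1:] f f" unfolding length_control_def
  proof (intro ballI impI)
    fix x y assume x: "x \<in> domC f" and y: "y \<in> domC f" "prefix y x"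
    obtain v where "f y = Some v" using domC_dom[OF f y(1)] by blast
    then have "y = x" by (rule domC_least[OF f x _ y(2)])
    then show "length x \<le> poly [:0, 1:] (length y)" by simp
  qed
  moreover have "extends_into f f" unfolding extends_into_def by (metis append_Nil2)
  ultimately show ?thesis unfolding poly_equiv_iff[OF f f] by auto
qed

lemma poly_equiv_sym:
  assumes "right_ideal_morphism f" "right_ideal_morphism g" "poly_equiv f g"
  shows "poly_equiv g f"
  using assms(3) unfolding poly_equiv_iff[OF assms(1,2)] poly_equiv_iff[OF assms(2,1)] by blast

lemma extends_into_trans:
  assumes "right_ideal_morphism h" "extends_into f g" "extends_into g h"
  shows "extends_into f h"
  unfolding extends_into_def
proof
  fix x assume "x \<in> dom f"
  then obtain w where "x @ w \<in> dom g" using assms(2) unfolding extends_into_def by blast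
  then obtain v where "(x @ w) @ v \<in> dom h" using assms(3) unfolding extends_into_def by blast
  then show "\<exists>w. x @ w \<in> dom h" by (metis append_assoc)
qed

text \<open>
  Some extension of \<open>x\<close> lies in the domain of \<open>g\<close> and has a generator as a prefix. Whether
  this generator ends inside \<open>x\<close> or only in the extension is not determined.
\<close>

lemma domC_comparable:
  assumes g: "right_ideal_morphism g" and "extends_into f g" "x \<in> dom f"
  shows "\<exists>c \<in> domC g. prefix c x \<or> prefix x c"
proof -
  obtain w where "x @ w \<in> dom g" using assms(2,3) unfolding extends_into_def by blast
  then obtain c where "c \<in> domC g" "prefix c (x @ w)" using domC_prefix[OF g] by blast
  then show ?thesis by (metis prefix_append prefix_def)
qed

text \<open>
  A generator \<open>c\<close> of \<open>g\<close> that is comparable with the longer word \<open>x\<close> is also comparable with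
  \<open>z\<close>, so it links the two bounds. According to the position of \<open>c\<close> relative to \<open>x\<close> and \<open>z\<close>
  either both bounds or only one of them is used, which is why the three polynomials are
  added.
\<close>

lemma length_control_trans:
  assumes mor: "right_ideal_morphism f" "right_ideal_morphism g" "right_ideal_morphism h"
    and fg: "extends_into f g" "length_control \<tau>1 f g" and gh: "length_control \<tau>2 g h"
  shows "length_control (pcompose \<tau>1 \<tau>2 + \<tau>1 + \<tau>2) f h"
  unfolding length_control_def
proof (intro ballI impI)
  fix x z assume x: "x \<in> domC f" and z: "z \<in> domC h" and zx: "prefix z x"
  have "x \<in> dom f" using domC_dom[OF mor(1) x] by blast
  from domC_comparable[OF mor(2) fg(1) this]
  obtain c where c: "c \<in> domC g" "prefix c x \<or> prefix x c" by blast
  show "length x \<le> poly (pcompose \<tau>1 \<tau>2 + \<tau>1 + \<tau>2) (length z)"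
  proof (cases "prefix c x")
    case True
    then have xc: "length x \<le> poly \<tau>1 (length c)" using fg(2) x c(1) unfolding length_control_def by blast
    show ?thesis
    proof (cases "prefix z c")
      case True
      then have "length c \<le> poly \<tau>2 (length z)" using gh c(1) z unfolding length_control_def by blast
      then have "length x \<le> poly \<tau>1 (poly \<tau>2 (length z))" using xc poly_mono_nat le_trans by blast
      then show ?thesis by (simp add: poly_pcompose)
    next
      case False
      then have "prefix c z" using zx \<open>prefix c x\<close> prefix_same_cases by blast
      then have "length x \<le> poly \<tau>1 (length z)"
        using xc poly_mono_nat[OF prefix_length_le] le_trans by blast
      then show ?thesis by simp
    qed
  next
    case False
    then have xc: "prefix x c" using c(2) by blast
    then have "prefix z c" using zx prefix_order.trans by blast
    then have "length c \<le> poly \<tau>2 (length z)" using gh c(1) z unfolding length_control_def by blast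
    then show ?thesis using prefix_length_le[OF xc] by simp
  qed
qed

text \<open>
  Agreement of \<open>f\<close> and \<open>h\<close> is not immediate, as \<open>g\<close> may be undefined where both are defined.
  It is transported from an extension on which \<open>g\<close> is defined and then the extending suffix
  is cancelled.
\<close>

lemma poly_equiv_trans:
  assumes mor: "right_ideal_morphism f" "right_ideal_morphism g" "right_ideal_morphism h"
    and "poly_equiv f g" "poly_equiv g h"
  shows "poly_equiv f h"
proof -
  note fg = assms(4)[unfolded poly_equiv_iff[OF mor(1,2)]]
  note gh = assms(5)[unfolded poly_equiv_iff[OF mor(2,3)]]
  have "\<exists>\<tau>. length_control \<tau> f h" using length_control_trans[OF mor] fg gh by blast
  moreover have "\<exists>\<tau>. length_control \<tau> h f" using length_control_trans[OF mor(3,2,1)] fg gh by blast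
  moreover have "extends_into f h" "extends_into h f" using extends_into_trans mor fg gh by blast+
  moreover have "y = z" if yz: "f x = Some y" "h x = Some z" for x y z
  proof -
    obtain w where "x @ w \<in> dom g" using fg yz(1) unfolding extends_into_def by blast
    then obtain u where u: "g (x @ w) = Some u" by blast
    have "y @ w = u" using fg morphism_append[OF mor(1) yz(1), of w] u by blast
    moreover have "u = z @ w" using gh morphism_append[OF mor(3) yz(2), of w] u by blast
    ultimately show ?thesis by simp
  qed
  ultimately show ?thesis unfolding poly_equiv_iff[OF mor(1,3)] by blast
qed

definition balanced_by :: "nat poly \<Rightarrow> pfun \<Rightarrow> bool" where
  "balanced_by p f \<longleftrightarrow> (\<forall>x y. f x = Some y \<longrightarrow>
     length y \<le> poly p (length x) \<and> length x \<le> poly p (length y))"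

lemma poly_balanced_iff: "poly_balanced f \<longleftrightarrow> (\<exists>p. balanced_by p f)"
  by (simp add: poly_balanced_def balanced_by_def)

lemma balanced_comp:
  assumes "balanced_by p f" "balanced_by q g"
  shows "balanced_by (pcompose p q + pcompose q p) (f \<circ>\<^sub>m g)"
  unfolding balanced_by_def
proof (intro allI impI)
  fix x y assume "(f \<circ>\<^sub>m g) x = Some y"
  then obtain z where z: "g x = Some z" "f z = Some y" by (auto simp: map_comp_Some_iff)
  have "length y \<le> poly p (length z)" "length z \<le> poly p (length y)"
    using assms(1) z unfolding balanced_by_def by blast+
  moreover have "length z \<le> poly q (length x)" "length x \<le> poly q (length z)"
    using assms(2) z unfolding balanced_by_def by blast+
  ultimately have "length y \<le> poly p (poly q (length x))" "length x \<le> poly q (poly p (length y))"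
    using poly_mono_nat le_trans by blast+
  then show "length y \<le> poly (pcompose p q + pcompose q p) (length x) \<and>
      length x \<le> poly (pcompose p q + pcompose q p) (length y)"
    by (simp add: poly_pcompose)
qed

text \<open>
  A word is minimal in the domain of a composition for one of two reasons: no proper prefix
  of it lies in the domain of \<open>g\<close>, or no proper prefix of its image lies in the domain of
  \<open>f\<close>.
\<close>

lemma domC_comp:
  assumes mor: "right_ideal_morphism f" "right_ideal_morphism g" and x: "x \<in> domC (f \<circ>\<^sub>m g)"
  shows "x \<in> domC g \<or> (\<exists>z. g x = Some z \<and> z \<in> domC f)"
proof -
  note fg = morphism_comp[OF mor]
  obtain y where "(f \<circ>\<^sub>m g) x = Some y" using domC_dom[OF fg x] by blast
  then obtain z where z: "g x = Some z" "f z = Some y" by (auto simp: map_comp_Some_iff)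
  obtain a where a: "a \<in> domC g" "prefix a x" using domC_prefix[OF mor(2) z(1)] by blast
  then obtain u where u: "x = a @ u" by (auto simp: prefix_def)
  obtain a' where a': "g a = Some a'" using domC_dom[OF mor(2) a(1)] by blast
  have zu: "z = a' @ u" using morphism_append[OF mor(2) a', of u] z(1) u by simp
  obtain b where b: "b \<in> domC f" "prefix b z" using domC_prefix[OF mor(1) z(2)] by blast
  obtain b' where b': "f b = Some b'" using domC_dom[OF mor(1) b(1)] by blast
  have "prefix b a' \<or> prefix a' b" using b(2) zu prefix_same_cases[of b z a'] by auto
  then show ?thesis
  proof
    assume "prefix b a'"
    then obtain v where "a' = b @ v" by (auto simp: prefix_def)
    then have "(f \<circ>\<^sub>m g) a = Some (b' @ v)" using morphism_append[OF mor(1) b'] a' by simp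
    then have "a = x" by (rule domC_least[OF fg x _ a(2)])
    then show ?thesis using a(1) by simp
  next
    assume "prefix a' b"
    then obtain v where v: "b = a' @ v" by (auto simp: prefix_def)
    then have "prefix v u" using b(2) zu by simp
    then have pre: "prefix (a @ v) x" using u by simp
    have "g (a @ v) = Some b" using morphism_append[OF mor(2) a'] v by simp
    then have "(f \<circ>\<^sub>m g) (a @ v) = Some b'" using b' by simp
    then have "a @ v = x" by (rule domC_least[OF fg x _ pre])
    then show ?thesis using b(1) \<open>g (a @ v) = Some b\<close> by auto
  qed
qed

lemma extends_into_comp:
  assumes mor: "right_ideal_morphism f" "right_ideal_morphism f'" "right_ideal_morphism g" "right_ideal_morphism g'"
    and f: "extends_into f f'" and g: "poly_equiv g g'"
  shows "extends_into (f \<circ>\<^sub>m g) (f' \<circ>\<^sub>m g')"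
  unfolding extends_into_def
proof
  note g' = g[unfolded poly_equiv_iff[OF mor(3,4)]]
  fix x assume "x \<in> dom (f \<circ>\<^sub>m g)"
  then obtain z y where z: "g x = Some z" "f z = Some y" by (auto simp: map_comp_Some_iff)
  obtain w u where u: "g' (x @ w) = Some u" using g' z(1) unfolding extends_into_def by blast
  have "u = z @ w" using g' morphism_append[OF mor(3) z(1), of w] u by blast
  then have "f u = Some (y @ w)" using morphism_append[OF mor(1) z(2)] by simp
  then obtain v y' where "f' (u @ v) = Some y'" using f unfolding extends_into_def by blast
  then have "(f' \<circ>\<^sub>m g') (x @ (w @ v)) = Some y'"
    using morphism_append[OF mor(4) u, of v] by simp
  then show "\<exists>w. x @ w \<in> dom (f' \<circ>\<^sub>m g')" by blast
qed

text \<open>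
  Following the case distinction of \<open>domC_comp\<close>, the length of \<open>x\<close> is controlled by the
  bound for \<open>g\<close>, or the length of its image by the bound for \<open>f\<close>. In the second case balance
  of \<open>g\<close> and \<open>g'\<close> is what carries the estimate from images back to arguments.
\<close>

lemma length_control_comp:
  assumes mor: "right_ideal_morphism f" "right_ideal_morphism f'" "right_ideal_morphism g" "right_ideal_morphism g'"
    and f: "length_control \<tau>1 f f'" and g: "length_control \<tau>2 g g'"
    and eq: "\<forall>x y z. g x = Some y \<longrightarrow> g' x = Some z \<longrightarrow> y = z"
    and bal: "balanced_by p g" "balanced_by p' g'"
  shows "length_control (\<tau>2 + pcompose p (pcompose \<tau>1 p')) (f \<circ>\<^sub>m g) (f' \<circ>\<^sub>m g')"
  unfolding length_control_def
proof (intro ballI impI)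
  fix x x' assume x: "x \<in> domC (f \<circ>\<^sub>m g)" and x': "x' \<in> domC (f' \<circ>\<^sub>m g')" and pre: "prefix x' x"
  obtain y' where "(f' \<circ>\<^sub>m g') x' = Some y'" using domC_dom[OF morphism_comp[OF mor(2,4)] x'] by blast
  then obtain z' where z': "g' x' = Some z'" "f' z' = Some y'" by (auto simp: map_comp_Some_iff)
  show "length x \<le> poly (\<tau>2 + pcompose p (pcompose \<tau>1 p')) (length x')"
  proof (cases "x \<in> domC g")
    case True
    obtain a where a: "a \<in> domC g'" "prefix a x'" using domC_prefix[OF mor(4) z'(1)] by blast
    then have "length x \<le> poly \<tau>2 (length a)"
      using g True pre prefix_order.trans unfolding length_control_def by blast
    then have "length x \<le> poly \<tau>2 (length x')"
      using poly_mono_nat[OF prefix_length_le[OF a(2)]] le_trans by blast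
    then show ?thesis by simp
  next
    case False
    then obtain z where z: "g x = Some z" "z \<in> domC f" using domC_comp[OF mor(1,3) x] by blast
    obtain w where w: "x = x' @ w" using pre by (auto simp: prefix_def)
    have "z = z' @ w" using eq z(1) morphism_append[OF mor(4) z'(1), of w] w by blast
    then have "prefix z' z" by simp
    moreover obtain b where b: "b \<in> domC f'" "prefix b z'" using domC_prefix[OF mor(2) z'(2)] by blast
    ultimately have "prefix b z" using prefix_order.trans by blast
    then have "length z \<le> poly \<tau>1 (length b)" using f z(2) b(1) unfolding length_control_def by blast
    also have "\<dots> \<le> poly \<tau>1 (length z')" by (rule poly_mono_nat[OF prefix_length_le[OF b(2)]])
    also have "\<dots> \<le> poly \<tau>1 (poly p' (length x'))"
      using bal(2) z'(1) unfolding balanced_by_def by (intro poly_mono_nat) blast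
    finally have "poly p (length z) \<le> poly p (poly \<tau>1 (poly p' (length x')))" by (rule poly_mono_nat)
    moreover have "length x \<le> poly p (length z)" using bal(1) z(1) unfolding balanced_by_def by blast
    ultimately show ?thesis by (simp add: poly_pcompose)
  qed
qed

lemma poly_equiv_comp:
  assumes mor: "right_ideal_morphism f" "right_ideal_morphism f'" "right_ideal_morphism g" "right_ideal_morphism g'"
    and bal: "poly_balanced g" "poly_balanced g'"
    and f: "poly_equiv f f'" and g: "poly_equiv g g'"
  shows "poly_equiv (f \<circ>\<^sub>m g) (f' \<circ>\<^sub>m g')"
proof -
  note f' = f[unfolded poly_equiv_iff[OF mor(1,2)]]
  note g' = g[unfolded poly_equiv_iff[OF mor(3,4)]]
  obtain p p' where p: "balanced_by p g" "balanced_by p' g'" using bal unfolding poly_balanced_iff by blast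
  obtain \<tau>1 \<tau>2 \<tau>3 \<tau>4 where \<tau>: "length_control \<tau>1 f f'" "length_control \<tau>2 g g'" "length_control \<tau>3 f' f" "length_control \<tau>4 g' g"
    using f' g' by blast
  have eq: "\<forall>x y z. g x = Some y \<longrightarrow> g' x = Some z \<longrightarrow> y = z" using g' by blast
  then have eq': "\<forall>x z y. g' x = Some z \<longrightarrow> g x = Some y \<longrightarrow> z = y" by blast
  have "\<exists>\<tau>. length_control \<tau> (f \<circ>\<^sub>m g) (f' \<circ>\<^sub>m g')" using length_control_comp[OF mor \<tau>(1,2) eq p] by blast
  moreover have "\<exists>\<tau>. length_control \<tau> (f' \<circ>\<^sub>m g') (f \<circ>\<^sub>m g)"
    using length_control_comp[OF mor(2,1,4,3) \<tau>(3,4) eq' p(2,1)] by blast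
  moreover have "extends_into (f \<circ>\<^sub>m g) (f' \<circ>\<^sub>m g')" using extends_into_comp[OF mor _ g] f' by blast
  moreover have "extends_into (f' \<circ>\<^sub>m g') (f \<circ>\<^sub>m g)"
    using extends_into_comp[OF mor(2,1,4,3) _ poly_equiv_sym[OF mor(3,4) g]] f' by blast
  moreover have "y = z" if yz: "(f \<circ>\<^sub>m g) x = Some y" "(f' \<circ>\<^sub>m g') x = Some z" for x y z
  proof -
    obtain u v where "g x = Some u" "f u = Some y" "g' x = Some v" "f' v = Some z"
      using yz by (auto simp: map_comp_Some_iff)
    then show ?thesis using f' eq by blast
  qed
  ultimately show ?thesis
    unfolding poly_equiv_iff[OF morphism_comp[OF mor(1,3)] morphism_comp[OF mor(2,4)]] by blast
qed

section \<open>Regularity in the quotient monoid\<close>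

lemma equiv_poly_rel: "equiv RM poly_rel"
proof (rule equivI)
  have m: "right_ideal_morphism f" if "f \<in> RM" for f using that by (simp add: RM_def)
  show "poly_rel \<subseteq> RM \<times> RM" by (auto simp: poly_rel_def)
  show "refl_on RM poly_rel" unfolding refl_on_def poly_rel_def using poly_equiv_refl[OF m] by auto
  show "sym poly_rel" unfolding sym_def poly_rel_def using poly_equiv_sym[OF m m] by auto
  show "trans poly_rel" unfolding trans_def poly_rel_def using poly_equiv_trans[OF m m m] by auto
qed

text \<open>
  Closure under composition is a hypothesis in this section because it rests on Turing
  machine constructions; it is discharged by \<open>RM_comp\<close>.
\<close>

lemma congruent_comp:
  assumes closed: "\<And>f g. f \<in> RM \<Longrightarrow> g \<in> RM \<Longrightarrow> f \<circ>\<^sub>m g \<in> RM"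
  shows "congruent2 poly_rel poly_rel (\<lambda>f g. poly_rel `` {f \<circ>\<^sub>m g})"
proof (rule congruent2I')
  fix f f' g g' assume "(f, f') \<in> poly_rel" "(g, g') \<in> poly_rel"
  then have "(f \<circ>\<^sub>m g, f' \<circ>\<^sub>m g') \<in> poly_rel"
    using closed poly_equiv_comp[of f f' g g'] by (auto simp: poly_rel_def RM_def fP_def)
  then show "poly_rel `` {f \<circ>\<^sub>m g} = poly_rel `` {f' \<circ>\<^sub>m g'}"
    by (rule equiv_class_eq[OF equiv_poly_rel])
qed

lemma class_mult:
  assumes closed: "\<And>f g. f \<in> RM \<Longrightarrow> g \<in> RM \<Longrightarrow> f \<circ>\<^sub>m g \<in> RM" and "f \<in> RM" "g \<in> RM"
  shows "poly_rel `` {f} \<otimes>\<^bsub>M_P_poly\<^esub> poly_rel `` {g} = poly_rel `` {f \<circ>\<^sub>m g}"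
  using UN_equiv_class2[OF equiv_poly_rel equiv_poly_rel congruent_comp[OF closed] assms(2,3)]
  by (simp add: M_P_poly_def)

lemma regular_class_iff:
  assumes closed: "\<And>f g. f \<in> RM \<Longrightarrow> g \<in> RM \<Longrightarrow> f \<circ>\<^sub>m g \<in> RM" and f: "f \<in> RM"
  shows "regular_element M_P_poly (poly_rel `` {f}) \<longleftrightarrow>
    (\<exists>g \<in> RM. poly_equiv (f \<circ>\<^sub>m g \<circ>\<^sub>m f) f)"
proof -
  have "regular_element M_P_poly (poly_rel `` {f}) \<longleftrightarrow> (\<exists>g \<in> RM.
      poly_rel `` {f} \<otimes>\<^bsub>M_P_poly\<^esub> poly_rel `` {g} \<otimes>\<^bsub>M_P_poly\<^esub> poly_rel `` {f} = poly_rel `` {f})"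
    unfolding regular_element_def by (auto simp: M_P_poly_def quotient_def)
  also have "\<dots> \<longleftrightarrow> (\<exists>g \<in> RM. poly_rel `` {f \<circ>\<^sub>m g \<circ>\<^sub>m f} = poly_rel `` {f})"
    using f closed by (intro bex_cong refl) (simp add: class_mult[OF closed])
  also have "\<dots> \<longleftrightarrow> (\<exists>g \<in> RM. (f \<circ>\<^sub>m g \<circ>\<^sub>m f, f) \<in> poly_rel)"
    using f closed by (intro bex_cong refl) (simp add: eq_equiv_class_iff[OF equiv_poly_rel])
  also have "\<dots> \<longleftrightarrow> (\<exists>g \<in> RM. poly_equiv (f \<circ>\<^sub>m g \<circ>\<^sub>m f) f)"
    using f closed by (intro bex_cong refl) (simp add: poly_rel_def)
  finally show ?thesis .
qed

lemma regular_RM_iff: "regular_monoid RM_P \<longleftrightarrow> (\<forall>f \<in> RM. \<exists>g \<in> RM. f \<circ>\<^sub>m g \<circ>\<^sub>m f = f)"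
  by (simp add: regular_monoid_def regular_element_def RM_P_def)

lemma regular_M_iff:
  assumes closed: "\<And>f g. f \<in> RM \<Longrightarrow> g \<in> RM \<Longrightarrow> f \<circ>\<^sub>m g \<in> RM"
  shows "regular_monoid M_P_poly \<longleftrightarrow> (\<forall>f \<in> RM. \<exists>g \<in> RM. poly_equiv (f \<circ>\<^sub>m g \<circ>\<^sub>m f) f)"
proof -
  have "carrier M_P_poly = (\<lambda>f. poly_rel `` {f}) ` RM" by (auto simp: M_P_poly_def quotient_def)
  then show ?thesis unfolding regular_monoid_def using regular_class_iff[OF closed] by simp
qed

section \<open>Flowchart programs on tapes\<close>

text \<open>
  A program is a list of rows. A row maps the symbols under the heads to the number of the
  next row and to one action for each tape; the number \<open>length p\<close> means termination. There
  are infinitely many tapes, so that programs can be combined without fixing the number of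
  tapes beforehand; \<open>ok\<close> records how many are really used.
\<close>

type_synonym tapes = "nat \<Rightarrow> tape"
type_synonym row = "(nat \<Rightarrow> nat) \<Rightarrow> nat \<times> (nat \<Rightarrow> nat \<times> move)"
type_synonym prog = "row list"

definition reads :: "tapes \<Rightarrow> nat \<Rightarrow> nat" where
  "reads T = (\<lambda>i. read (T i))"

definition keep :: "(nat \<Rightarrow> nat) \<Rightarrow> nat \<Rightarrow> nat \<times> move" where
  "keep as = (\<lambda>i. (as i, MStay))"

fun pstep :: "prog \<Rightarrow> nat \<times> tapes \<Rightarrow> nat \<times> tapes" where
  "pstep p (c, T) =
     (if c < length p
      then (fst ((p ! c) (reads T)), \<lambda>i. act (snd ((p ! c) (reads T)) i) (T i))
      else (c, T))"

declare pstep.simps [simp del]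

definition runs :: "prog \<Rightarrow> tapes \<Rightarrow> nat \<Rightarrow> tapes \<Rightarrow> bool" where
  "runs p T n T' \<longleftrightarrow> (\<exists>m\<le>n. (pstep p ^^ m) (0, T) = (length p, T'))"

text \<open>
  These are the properties that turn a program into a finite machine with \<open>K\<close> tapes: jumps
  stay inside the program, tapes from \<open>K\<close> on are left alone, and a written symbol is from a
  finite set or has just been read on some tape. The last condition is stated in this way so
  that it is preserved when programs with different symbol sets are combined.
\<close>

definition ok_row :: "nat \<Rightarrow> nat set \<Rightarrow> nat \<Rightarrow> row \<Rightarrow> bool" where
  "ok_row K S L r \<longleftrightarrow>
     (\<forall>as. fst (r as) \<le> L \<and> (\<forall>i\<ge>K. snd (r as) i = (as i, MStay)) \<and>
       (\<forall>i. fst (snd (r as) i) \<in> S \<union> range as))"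

definition ok :: "nat \<Rightarrow> prog \<Rightarrow> bool" where
  "ok K p \<longleftrightarrow> (\<exists>S. finite S \<and> (\<forall>r \<in> set p. ok_row K S (length p) r))"

definition relocate :: "nat \<Rightarrow> row \<Rightarrow> row" where
  "relocate n r = (\<lambda>as. (fst (r as) + n, snd (r as)))"

definition jump :: "(nat \<Rightarrow> bool) \<Rightarrow> nat \<Rightarrow> nat \<Rightarrow> nat \<Rightarrow> row" where
  "jump P i c d = (\<lambda>as. (if P (as i) then c else d, keep as))"

definition pseq :: "prog \<Rightarrow> prog \<Rightarrow> prog" (infixr ";;" 60) where
  "p ;; q = p @ map (relocate (length p)) q"

text \<open>
  The row between the two branches leads from the end of the first branch to the end of the
  program: both of its targets are that end.
\<close>

definition pif :: "nat \<Rightarrow> (nat \<Rightarrow> bool) \<Rightarrow> prog \<Rightarrow> prog \<Rightarrow> prog" where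
  "pif i P p q =
     jump P i 1 (2 + length p) # map (relocate 1) p @
     jump P i (2 + length p + length q) (2 + length p + length q) # map (relocate (2 + length p)) q"

definition pwhile :: "nat \<Rightarrow> (nat \<Rightarrow> bool) \<Rightarrow> prog \<Rightarrow> prog" where
  "pwhile i P p = jump P i 1 (2 + length p) # map (relocate 1) p @ [jump P i 0 0]"

definition pact :: "nat \<Rightarrow> (nat \<Rightarrow> nat \<times> move) \<Rightarrow> prog" where
  "pact i g = [\<lambda>as. (1, (keep as)(i := g (as i)))]"

lemma reads_apply: "reads T i = read (T i)"
  by (simp add: reads_def)

lemma act_keep [simp]: "act (keep (reads T) i) (T i) = T i"
  by (cases "T i") (simp add: keep_def reads_def)

lemma act_stay [simp]: "act (reads T i, MStay) (T i) = T i"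
  by (cases "T i") (simp add: reads_def)

lemma runs_mono: "runs p T n T' \<Longrightarrow> n \<le> n' \<Longrightarrow> runs p T n' T'"
  unfolding runs_def by (meson le_trans)

text \<open>
  A program behaves inside a larger one as it does alone. The number of steps can only
  shrink, since idle steps of the terminated inner program are dropped.
\<close>

lemma pstep_embed:
  assumes emb: "\<And>j. j < length p \<Longrightarrow> o1 + j < length q \<and> q ! (o1 + j) = relocate o1 (p ! j)"
  assumes "(pstep p ^^ n) (c, T) = (c', T')"
  shows "\<exists>m\<le>n. (pstep q ^^ m) (o1 + c, T) = (o1 + c', T')"
  using assms(2)
proof (induction n arbitrary: c T)
  case 0
  then show ?case by simp
next
  case (Suc n)
  show ?case
  proof (cases "c < length p")
    case True
    obtain c1 T1 where 1: "pstep p (c, T) = (c1, T1)" by force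
    have "(pstep p ^^ n) (c1, T1) = (c', T')"
      using Suc.prems 1 by (simp add: funpow_Suc_right del: funpow.simps)
    then obtain m where m: "m \<le> n" "(pstep q ^^ m) (o1 + c1, T1) = (o1 + c', T')"
      using Suc.IH by blast
    have "pstep q (o1 + c, T) = (o1 + c1, T1)"
      using 1 emb[OF True] True by (auto simp: pstep.simps relocate_def)
    then have "(pstep q ^^ Suc m) (o1 + c, T) = (o1 + c', T')"
      using m by (simp add: funpow_Suc_right del: funpow.simps)
    then show ?thesis using m by (meson Suc_le_mono)
  next
    case False
    then have "pstep p (c, T) = (c, T)" by (simp add: pstep.simps)
    then have "(pstep p ^^ k) (c, T) = (c, T)" for k by (induction k) auto
    then have "(c, T) = (c', T')" using Suc.prems by metis
    then show ?thesis by (intro exI[of _ 0]) simp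
  qed
qed

lemma runs_embed:
  assumes "\<And>j. j < length p \<Longrightarrow> o1 + j < length q \<and> q ! (o1 + j) = relocate o1 (p ! j)"
  assumes "runs p T n T'"
  shows "\<exists>m\<le>n. (pstep q ^^ m) (o1, T) = (o1 + length p, T')"
proof -
  obtain m where m: "m \<le> n" "(pstep p ^^ m) (0, T) = (length p, T')"
    using assms(2) by (auto simp: runs_def)
  show ?thesis using pstep_embed[of p o1 q m 0 T, OF assms(1) m(2)] m(1)
    by (metis add.right_neutral le_trans)
qed

lemma funpow_trans:
  assumes "(f ^^ m) a = b" "(f ^^ n) b = c" shows "(f ^^ (m + n)) a = c"
  using assms by (metis add.commute comp_apply funpow_add)

lemma runs_skip [simp]: "runs [] T n T"
  unfolding runs_def by (intro exI[of _ 0]) simp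

lemma runs_seq:
  assumes "runs p T m T1" "runs q T1 n T2"
  shows "runs (p ;; q) T (m + n) T2"
proof -
  obtain a where a: "a \<le> m" "(pstep (p ;; q) ^^ a) (0, T) = (0 + length p, T1)"
    using runs_embed[of p 0 "p ;; q", OF _ assms(1)]
    by (auto simp: pseq_def nth_append relocate_def)
  obtain b where b: "b \<le> n" "(pstep (p ;; q) ^^ b) (length p, T1) = (length p + length q, T2)"
    using runs_embed[of q "length p" "p ;; q", OF _ assms(2)]
    by (auto simp: pseq_def nth_append)
  show ?thesis unfolding runs_def
    using funpow_trans[OF a(2)[simplified] b(2)] a(1) b(1)
    by (intro exI[of _ "a + b"]) (auto simp: pseq_def)
qed

lemma pstep_jump:
  assumes "c < length q" "q ! c = jump P i d e"
  shows "pstep q (c, T) = (if P (read (T i)) then d else e, T)"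
  using assms by (auto simp: pstep.simps jump_def reads_apply)

lemma pif_nth:
  shows "pif i P p q ! 0 = jump P i 1 (2 + length p)"
    "j < length p \<Longrightarrow> pif i P p q ! (1 + j) = relocate 1 (p ! j)"
    "pif i P p q ! (1 + length p) =
       jump P i (2 + length p + length q) (2 + length p + length q)"
    "j < length q \<Longrightarrow> pif i P p q ! (2 + length p + j) = relocate (2 + length p) (q ! j)"
    "length (pif i P p q) = 2 + length p + length q"
  by (auto simp: pif_def nth_append)

lemma runs_if_True:
  assumes "P (read (T i))" "runs p T n T'"
  shows "runs (pif i P p q) T (n + 2) T'"
proof -
  let ?r = "pif i P p q"
  have 1: "(pstep ?r ^^ 1) (0, T) = (1, T)"
    using assms(1) pstep_jump[of 0 ?r P i] by (simp add: pif_nth)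
  have "j < length p \<Longrightarrow> 1 + j < length ?r \<and> ?r ! (1 + j) = relocate 1 (p ! j)" for j
    by (simp only: pif_nth) simp
  then obtain m where m: "m \<le> n" "(pstep ?r ^^ m) (1, T) = (1 + length p, T')"
    using runs_embed[OF _ assms(2), of 1 ?r] by blast
  have 2: "(pstep ?r ^^ 1) (1 + length p, T') = (length ?r, T')"
    using pstep_jump[of "1 + length p" ?r P i] pif_nth(3,5)[of i P p q] by simp
  show ?thesis unfolding runs_def
    using funpow_trans[OF funpow_trans[OF 1 m(2)] 2] m(1) by (intro exI[of _ "1 + m + 1"]) simp
qed

lemma runs_if_False:
  assumes "\<not> P (read (T i))" "runs q T n T'"
  shows "runs (pif i P p q) T (n + 2) T'"
proof -
  let ?r = "pif i P p q"
  have 1: "(pstep ?r ^^ 1) (0, T) = (2 + length p, T)"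
    using assms(1) pstep_jump[of 0 ?r P i] by (simp add: pif_nth)
  have "j < length q \<Longrightarrow> 2 + length p + j < length ?r \<and>
      ?r ! (2 + length p + j) = relocate (2 + length p) (q ! j)" for j
    by (simp only: pif_nth) simp
  then obtain m where m: "m \<le> n" "(pstep ?r ^^ m) (2 + length p, T) = (2 + length p + length q, T')"
    using runs_embed[OF _ assms(2), of "2 + length p" ?r] by blast
  show ?thesis unfolding runs_def
    using funpow_trans[OF 1 m(2)] m(1)
    by (intro exI[of _ "1 + m"]) (simp add: pif_nth(5))
qed

lemma pwhile_nth:
  shows "pwhile i P p ! 0 = jump P i 1 (2 + length p)"
    "j < length p \<Longrightarrow> pwhile i P p ! (1 + j) = relocate 1 (p ! j)"
    "pwhile i P p ! (1 + length p) = jump P i 0 0"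
    "length (pwhile i P p) = 2 + length p"
  by (auto simp: pwhile_def nth_append)

lemma runs_while_False:
  assumes "\<not> P (read (T i))"
  shows "runs (pwhile i P p) T 1 T"
proof -
  have "(pstep (pwhile i P p) ^^ 1) (0, T) = (length (pwhile i P p), T)"
    using assms pstep_jump[of 0 "pwhile i P p" P i] by (simp add: pwhile_nth)
  then show ?thesis unfolding runs_def by blast
qed

lemma runs_while_True:
  assumes "P (read (T i))" "runs p T m T1" "runs (pwhile i P p) T1 n T2"
  shows "runs (pwhile i P p) T (m + n + 2) T2"
proof -
  let ?r = "pwhile i P p"
  have 1: "(pstep ?r ^^ 1) (0, T) = (1, T)"
    using assms(1) pstep_jump[of 0 ?r P i] by (simp add: pwhile_nth)
  have "j < length p \<Longrightarrow> 1 + j < length ?r \<and> ?r ! (1 + j) = relocate 1 (p ! j)" for j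
    by (simp only: pwhile_nth) simp
  then obtain a where a: "a \<le> m" "(pstep ?r ^^ a) (1, T) = (1 + length p, T1)"
    using runs_embed[OF _ assms(2), of 1 ?r] by blast
  have 2: "(pstep ?r ^^ 1) (1 + length p, T1) = (0, T1)"
    using pstep_jump[of "1 + length p" ?r P i] pwhile_nth(3,4)[of i P p] by simp
  obtain b where b: "b \<le> n" "(pstep ?r ^^ b) (0, T1) = (length ?r, T2)"
    using assms(3) by (auto simp: runs_def)
  show ?thesis unfolding runs_def
    using funpow_trans[OF funpow_trans[OF funpow_trans[OF 1 a(2)] 2] b(2)] a(1) b(1)
    by (intro exI[of _ "1 + a + 1 + b"]) simp
qed

lemma runs_pact: "runs (pact i g) T 1 (T(i := act (g (read (T i))) (T i)))"
  unfolding runs_def pact_def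
  by (intro exI[of _ 1]) (auto simp: pstep.simps reads_apply)

lemma ok_row_mono:
  assumes "ok_row K S L r" "K \<le> K'" "S \<subseteq> S'" "L \<le> L'"
  shows "ok_row K' S' L' r"
  unfolding ok_row_def
proof (intro allI conjI impI)
  fix as i
  show "fst (r as) \<le> L'" using assms(1,4) unfolding ok_row_def by (meson le_trans)
  show "snd (r as) i = (as i, MStay)" if "K' \<le> i"
    using assms(1,2) that unfolding ok_row_def by (meson le_trans)
  show "fst (snd (r as) i) \<in> S' \<union> range as"
    using assms(1,3) unfolding ok_row_def by (meson Un_mono order_refl subsetD)
qed

lemma ok_row_relocate: "ok_row K S L r \<Longrightarrow> ok_row K S (n + L) (relocate n r)"
  by (simp add: ok_row_def relocate_def)

lemma ok_row_jump: "c \<le> L \<Longrightarrow> d \<le> L \<Longrightarrow> ok_row K S L (jump P i c d)"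
  by (simp add: ok_row_def jump_def keep_def)

lemma ok_mono: "ok K p \<Longrightarrow> K \<le> K' \<Longrightarrow> ok K' p"
  unfolding ok_def by (meson ok_row_mono order_refl)

lemma ok_skip [simp]: "ok K []"
  by (auto simp: ok_def)

text \<open>
  Sequence, branching and loops are all built from relocated copies of two programs and from
  at most two kinds of jumps, so one lemma covers the three constructs.
\<close>

lemma ok_rows:
  assumes "ok K p" "ok K q"
    and rows: "set s \<subseteq> {jump P i c d, jump P i c' d'} \<union> relocate m ` set p \<union> relocate n ` set q"
    and len: "c \<le> length s" "d \<le> length s" "c' \<le> length s" "d' \<le> length s"
      "m + length p \<le> length s" "n + length q \<le> length s"
  shows "ok K s"
proof -
  obtain S1 where S1: "finite S1" "\<And>r. r \<in> set p \<Longrightarrow> ok_row K S1 (length p) r"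
    using assms(1) unfolding ok_def by blast
  obtain S2 where S2: "finite S2" "\<And>r. r \<in> set q \<Longrightarrow> ok_row K S2 (length q) r"
    using assms(2) unfolding ok_def by blast
  have p: "ok_row K (S1 \<union> S2) (length s) (relocate m r)" if "r \<in> set p" for r
    using ok_row_mono[OF ok_row_relocate[OF S1(2)[OF that]]] len(5) by blast
  have q: "ok_row K (S1 \<union> S2) (length s) (relocate n r)" if "r \<in> set q" for r
    using ok_row_mono[OF ok_row_relocate[OF S2(2)[OF that]]] len(6) by blast
  have "ok_row K (S1 \<union> S2) (length s) r" if "r \<in> set s" for r
    using subsetD[OF rows that] p q ok_row_jump len(1-4) by blast
  then show ?thesis unfolding ok_def using S1(1) S2(1) by (meson finite_UnI)
qed

lemma ok_seq [simp]:
  assumes "ok K p" "ok K q" shows "ok K (p ;; q)"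
proof -
  have "relocate 0 ` set p = set p" by (simp add: relocate_def)
  then show ?thesis
    by (intro ok_rows[OF assms, of _ _ _ 0 0 0 0 0 "length p"]) (auto simp: pseq_def)
qed

lemma ok_if [simp]:
  assumes "ok K p" "ok K q" shows "ok K (pif i P p q)"
  by (rule ok_rows[OF assms, of _ P i 1 "2 + length p" "2 + length p + length q"
        "2 + length p + length q" 1 "2 + length p"]) (auto simp: pif_def)

lemma ok_while [simp]:
  assumes "ok K p" shows "ok K (pwhile i P p)"
  by (rule ok_rows[OF assms assms, of _ P i 1 "2 + length p" 0 0 1 1]) (auto simp: pwhile_def)

lemma ok_pact:
  assumes "i < K" "finite S" "\<And>s. fst (g s) \<in> S \<union> {s}"
  shows "ok K (pact i g)"
proof -
  have "ok_row K S 1 (\<lambda>as. (1, (keep as)(i := g (as i))))"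
    unfolding ok_row_def using assms(1,3) by (fastforce simp: keep_def)
  then show ?thesis unfolding ok_def pact_def using assms(2) by auto
qed

section \<open>Stack registers\<close>

definition letter :: "bool \<Rightarrow> nat" where
  "letter b = (if b then 2 else 1)"

definition top_symbol :: "word \<Rightarrow> nat" where
  "top_symbol w = (case w of [] \<Rightarrow> 0 | b # _ \<Rightarrow> letter b)"

lemma top_symbol_simps [simp]: "top_symbol [] = 0" "top_symbol (b # w) = letter b"
  by (simp_all add: top_symbol_def)

text \<open>
  A stack is a tape whose head is on the top letter. The origin \<open>a\<close> is arbitrary, as it
  drifts with every push and pop.
\<close>

definition wtape :: "int \<Rightarrow> word \<Rightarrow> tape" where
  "wtape a w = (\<lambda>p. contents w (p - a), a)"

lemma contents_Nil [simp]: "contents [] p = 0"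
  by (simp add: contents_def)

lemma contents_Cons: "contents (b # w) p = (if p = 0 then letter b else contents w (p - 1))"
  by (auto simp: contents_def letter_def nth_Cons' nat_diff_distrib)

lemma contents_snoc: "contents (w @ [b]) = (contents w)(int (length w) := letter b)"
  by (auto simp: contents_def letter_def nth_append fun_eq_iff)

lemma contents_neg: "p < 0 \<Longrightarrow> contents w p = 0"
  by (simp add: contents_def)

lemma read_wtape [simp]: "read (wtape a w) = top_symbol w"
  by (cases w) (simp_all add: wtape_def contents_Cons)

lemma push_wtape: "act (letter b, MStay) (act (top_symbol w, MLeft) (wtape a w)) = wtape (a - 1) (b # w)"
proof -
  have "contents w (p - a) = contents (b # w) (p - (a - 1))" if "p \<noteq> a - 1" for p
    using that by (simp add: contents_Cons)
  moreover have "top_symbol w = contents w 0" using read_wtape[of a w] by (simp add: wtape_def)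
  ultimately show ?thesis by (auto simp: wtape_def contents_Cons fun_eq_iff)
qed

lemma pop_wtape: "act (0, MRight) (wtape a w) = wtape (a + 1) (tl w)"
proof (cases w)
  case (Cons b w')
  have "(\<lambda>p. contents w (p - a))(a := 0) = (\<lambda>p. contents w' (p - (a + 1)))"
    by (rule ext) (simp add: Cons contents_Cons contents_neg diff_diff_eq)
  then show ?thesis using Cons by (simp add: wtape_def)
qed (auto simp: wtape_def fun_eq_iff)

definition pmove :: "nat \<Rightarrow> move \<Rightarrow> prog" where
  "pmove i d = pact i (\<lambda>s. (s, d))"

definition pwrite :: "nat \<Rightarrow> nat \<Rightarrow> move \<Rightarrow> prog" where
  "pwrite i s d = pact i (\<lambda>_. (s, d))"

lemma ok_pmove [simp]: "i < K \<Longrightarrow> ok K (pmove i d)"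
  unfolding pmove_def by (rule ok_pact[where S = "{}"]) auto

lemma ok_pwrite [simp]: "i < K \<Longrightarrow> ok K (pwrite i s d)"
  unfolding pwrite_def by (rule ok_pact[where S = "{s}"]) auto

lemma runs_pmove: "runs (pmove i d) T 1 (T(i := act (read (T i), d) (T i)))"
  unfolding pmove_def by (rule runs_pact)

lemma runs_pwrite: "runs (pwrite i s d) T 1 (T(i := act (s, d) (T i)))"
  unfolding pwrite_def by (rule runs_pact)

type_synonym regs = "nat \<Rightarrow> word"

definition represents :: "regs \<Rightarrow> tapes \<Rightarrow> bool" where
  "represents \<sigma> T \<longleftrightarrow> (\<forall>i. \<exists>a. T i = wtape a (\<sigma> i))"

text \<open>
  All tapes represent registers here, also those that the program does not use.
  Postconditions therefore describe the whole register state, and registers need no frame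
  rule.
\<close>

definition reg :: "prog \<Rightarrow> regs \<Rightarrow> nat \<Rightarrow> regs \<Rightarrow> bool" where
  "reg p \<sigma> n \<sigma>' \<longleftrightarrow> (\<forall>T. represents \<sigma> T \<longrightarrow> (\<exists>T'. runs p T n T' \<and> represents \<sigma>' T'))"

lemma represents_read: "represents \<sigma> T \<Longrightarrow> read (T i) = top_symbol (\<sigma> i)"
  unfolding represents_def by (metis read_wtape)

lemma represents_upd: "represents \<sigma> T \<Longrightarrow> represents (\<sigma>(i := w)) (T(i := wtape a w))"
  unfolding represents_def by auto

lemma reg_weaken: "reg p \<sigma> n \<sigma>' \<Longrightarrow> n \<le> n' \<Longrightarrow> \<sigma>' = \<tau> \<Longrightarrow> reg p \<sigma> n' \<tau>"
  unfolding reg_def using runs_mono by blast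

lemma reg_skip: "reg [] \<sigma> n \<sigma>"
  unfolding reg_def using runs_skip by blast

lemma reg_seq: "reg p \<sigma> m \<sigma>1 \<Longrightarrow> reg q \<sigma>1 n \<sigma>2 \<Longrightarrow> reg (p ;; q) \<sigma> (m + n) \<sigma>2"
  unfolding reg_def using runs_seq by blast

lemma reg_if_True: "P (top_symbol (\<sigma> i)) \<Longrightarrow> reg p \<sigma> n \<sigma>' \<Longrightarrow> reg (pif i P p q) \<sigma> (n + 2) \<sigma>'"
  unfolding reg_def using runs_if_True represents_read by metis

lemma reg_if_False: "\<not> P (top_symbol (\<sigma> i)) \<Longrightarrow> reg q \<sigma> n \<sigma>' \<Longrightarrow> reg (pif i P p q) \<sigma> (n + 2) \<sigma>'"
  unfolding reg_def using runs_if_False represents_read by metis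

lemma reg_if:
  assumes "P (top_symbol (\<sigma> i)) \<Longrightarrow> reg p \<sigma> n \<sigma>'" "\<not> P (top_symbol (\<sigma> i)) \<Longrightarrow> reg q \<sigma> n \<sigma>'"
  shows "reg (pif i P p q) \<sigma> (n + 2) \<sigma>'"
  using assms reg_if_True reg_if_False by blast

lemma reg_while_False: "\<not> P (top_symbol (\<sigma> i)) \<Longrightarrow> reg (pwhile i P p) \<sigma> 1 \<sigma>"
  unfolding reg_def using runs_while_False represents_read by metis

lemma reg_while_True:
  assumes "P (top_symbol (\<sigma> i))" "reg p \<sigma> m \<sigma>1" "reg (pwhile i P p) \<sigma>1 n \<sigma>2"
  shows "reg (pwhile i P p) \<sigma> (m + n + 2) \<sigma>2"
  unfolding reg_def
proof (intro allI impI)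
  fix T assume T: "represents \<sigma> T"
  then obtain T1 where T1: "runs p T m T1" "represents \<sigma>1 T1" using assms(2) unfolding reg_def by blast
  then obtain T2 where "runs (pwhile i P p) T1 n T2" "represents \<sigma>2 T2"
    using assms(3) unfolding reg_def by blast
  then show "\<exists>T'. runs (pwhile i P p) T (m + n + 2) T' \<and> represents \<sigma>2 T'"
    using runs_while_True T1 assms(1) represents_read[OF T] by metis
qed

definition push :: "nat \<Rightarrow> bool \<Rightarrow> prog" where
  "push i b = pmove i MLeft ;; pwrite i (letter b) MStay"

definition pop :: "nat \<Rightarrow> prog" where
  "pop i = pwrite i 0 MRight"

lemma ok_push_pop [simp]: "i < K \<Longrightarrow> ok K (push i b)" "i < K \<Longrightarrow> ok K (pop i)"
  by (simp_all add: push_def pop_def)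

lemma reg_push: "reg (push i b) \<sigma> 2 (\<sigma>(i := b # \<sigma> i))"
  unfolding reg_def
proof (intro allI impI)
  fix T assume T: "represents \<sigma> T"
  then obtain a where a: "T i = wtape a (\<sigma> i)" unfolding represents_def by blast
  let ?T1 = "T(i := act (read (T i), MLeft) (T i))"
  have "runs (push i b) T (1 + 1) (?T1(i := act (letter b, MStay) (?T1 i)))"
    unfolding push_def by (rule runs_seq[OF runs_pmove runs_pwrite])
  moreover have "?T1(i := act (letter b, MStay) (?T1 i)) = T(i := wtape (a - 1) (b # \<sigma> i))"
    by (simp add: a push_wtape)
  ultimately show "\<exists>T'. runs (push i b) T 2 T' \<and> represents (\<sigma>(i := b # \<sigma> i)) T'"
    using represents_upd[OF T] by (metis one_add_one)
qed

lemma reg_pop: "reg (pop i) \<sigma> 1 (\<sigma>(i := tl (\<sigma> i)))"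
  unfolding reg_def
proof (intro allI impI)
  fix T assume T: "represents \<sigma> T"
  then obtain a where a: "T i = wtape a (\<sigma> i)" unfolding represents_def by blast
  have "runs (pop i) T 1 (T(i := wtape (a + 1) (tl (\<sigma> i))))"
    using runs_pwrite[of i 0 MRight T] by (simp only: a pop_wtape pop_def)
  then show "\<exists>T'. runs (pop i) T 1 T' \<and> represents (\<sigma>(i := tl (\<sigma> i))) T'"
    using represents_upd[OF T] by blast
qed

abbreviation nonblank :: "nat \<Rightarrow> bool" where
  "nonblank s \<equiv> s \<noteq> 0"

abbreviation is_letter :: "bool \<Rightarrow> nat \<Rightarrow> bool" where
  "is_letter b s \<equiv> s = letter b"

lemma letter_simps [simp]:
  "letter b = 0 \<longleftrightarrow> False" "0 = letter b \<longleftrightarrow> False" "letter b = letter c \<longleftrightarrow> b = c"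
  by (auto simp: letter_def)

text \<open>
  Meant for a nonempty register \<open>i\<close>, whose top letter is duplicated on \<open>j\<close>: pushing writes a
  constant, so the letter has to be passed through a branch.
\<close>

definition push_top :: "nat \<Rightarrow> nat \<Rightarrow> prog" where
  "push_top i j = pif i (is_letter True) (push j True) (push j False)"

lemma ok_push_top [simp]: "i < K \<Longrightarrow> j < K \<Longrightarrow> ok K (push_top i j)"
  by (simp add: push_top_def)

lemma reg_push_top:
  assumes "\<sigma> i \<noteq> []"
  shows "reg (push_top i j) \<sigma> 4 (\<sigma>(j := hd (\<sigma> i) # \<sigma> j))"
proof -
  have "reg (push_top i j) \<sigma> (2 + 2) (\<sigma>(j := hd (\<sigma> i) # \<sigma> j))"
    unfolding push_top_def using assms reg_push[of j "hd (\<sigma> i)" \<sigma>]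
    by (intro reg_if; cases "\<sigma> i"; cases "hd (\<sigma> i)"; simp)
  then show ?thesis by simp
qed

text \<open>
  A loop that consumes register \<open>i\<close> is verified by giving the effect \<open>\<sigma>'\<close> of one
  round, an invariant \<open>Q\<close>, and the final state \<open>F \<sigma>\<close>, which the rounds must preserve.
\<close>

lemma reg_foreach:
  assumes body: "\<And>b w \<sigma>. \<sigma> i = b # w \<Longrightarrow> Q \<sigma> \<Longrightarrow> reg p \<sigma> c (\<sigma>' \<sigma>) \<and> \<sigma>' \<sigma> i = w \<and> Q (\<sigma>' \<sigma>)"
    and base: "\<And>\<sigma>. \<sigma> i = [] \<Longrightarrow> Q \<sigma> \<Longrightarrow> F \<sigma> = \<sigma>"
    and step: "\<And>b w \<sigma>. \<sigma> i = b # w \<Longrightarrow> Q \<sigma> \<Longrightarrow> F (\<sigma>' \<sigma>) = F \<sigma>"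
    and "Q \<sigma>"
  shows "reg (pwhile i nonblank p) \<sigma> ((c + 2) * length (\<sigma> i) + 1) (F \<sigma>)"
  using \<open>Q \<sigma>\<close>
proof (induction "length (\<sigma> i)" arbitrary: \<sigma>)
  case 0
  then show ?case using reg_while_False[of nonblank \<sigma> i p] base[of \<sigma>] by simp
next
  case (Suc n)
  obtain b w where bw: "\<sigma> i = b # w" using Suc(2) by (cases "\<sigma> i") auto
  note B = body[OF bw Suc(3)]
  have "reg (pwhile i nonblank p) (\<sigma>' \<sigma>) ((c + 2) * length w + 1) (F \<sigma>)"
    using Suc(1)[of "\<sigma>' \<sigma>"] B Suc(2) bw step[OF bw Suc(3)] by simp
  then have "reg (pwhile i nonblank p) \<sigma> (c + ((c + 2) * length w + 1) + 2) (F \<sigma>)"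
    by (intro reg_while_True[of nonblank]) (use B bw in auto)
  then show ?case by (rule reg_weaken) (simp_all add: bw)
qed

definition clear :: "nat \<Rightarrow> prog" where
  "clear i = pwhile i nonblank (pop i)"

lemma ok_clear [simp]: "i < K \<Longrightarrow> ok K (clear i)"
  by (simp add: clear_def)

lemma reg_clear: "reg (clear i) \<sigma> (3 * length (\<sigma> i) + 1) (\<sigma>(i := []))"
proof -
  have "reg (clear i) \<sigma> ((1 + 2) * length (\<sigma> i) + 1) (\<sigma>(i := []))"
    unfolding clear_def
  proof (rule reg_foreach[where Q = "\<lambda>_. True" and \<sigma>' = "\<lambda>\<sigma>. \<sigma>(i := tl (\<sigma> i))" and
        F = "\<lambda>\<sigma>. \<sigma>(i := [])"], goal_cases)
    case (1 b w \<sigma>)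
    then show ?case using reg_pop[of i \<sigma>] by simp
  qed (auto simp: fun_eq_iff)
  then show ?thesis by (rule reg_weaken) simp_all
qed

definition pour :: "nat \<Rightarrow> nat \<Rightarrow> prog" where
  "pour i j = pwhile i nonblank (push_top i j ;; pop i)"

lemma ok_pour [simp]: "i < K \<Longrightarrow> j < K \<Longrightarrow> ok K (pour i j)"
  by (simp add: pour_def)

lemma reg_pour:
  assumes "i \<noteq> j"
  shows "reg (pour i j) \<sigma> (7 * length (\<sigma> i) + 1) (\<sigma>(i := [], j := rev (\<sigma> i) @ \<sigma> j))"
proof -
  have "reg (pour i j) \<sigma> ((5 + 2) * length (\<sigma> i) + 1) (\<sigma>(i := [], j := rev (\<sigma> i) @ \<sigma> j))"
    unfolding pour_def
  proof (rule reg_foreach[where Q = "\<lambda>_. True" and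
        \<sigma>' = "\<lambda>\<sigma>. \<sigma>(j := hd (\<sigma> i) # \<sigma> j, i := tl (\<sigma> i))" and
        F = "\<lambda>\<sigma>. \<sigma>(i := [], j := rev (\<sigma> i) @ \<sigma> j)"], goal_cases)
    case (1 b w \<sigma>)
    have "reg (push_top i j ;; pop i) \<sigma> 5 (\<sigma>(j := hd (\<sigma> i) # \<sigma> j, i := tl (\<sigma> i)))"
      by (rule reg_weaken[OF reg_seq[OF reg_push_top reg_pop]]) (use 1 assms in auto)
    then show ?case using 1 assms by simp
  qed (use assms in \<open>auto simp: fun_eq_iff\<close>)
  then show ?thesis by simp
qed

definition copy :: "nat \<Rightarrow> nat \<Rightarrow> nat \<Rightarrow> prog" where
  "copy i j t = pour i t ;; pwhile t nonblank (push_top t i ;; push_top t j ;; pop t)"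

lemma ok_copy [simp]: "i < K \<Longrightarrow> j < K \<Longrightarrow> t < K \<Longrightarrow> ok K (copy i j t)"
  by (simp add: copy_def)

lemma reg_copy:
  assumes "i \<noteq> j" "i \<noteq> t" "j \<noteq> t" "\<sigma> t = []"
  shows "reg (copy i j t) \<sigma> (18 * length (\<sigma> i) + 2) (\<sigma>(j := \<sigma> i @ \<sigma> j))"
proof -
  let ?b = "pwhile t nonblank (push_top t i ;; push_top t j ;; pop t)"
  have "reg ?b \<sigma> ((9 + 2) * length (\<sigma> t) + 1)
      (\<sigma>(i := rev (\<sigma> t) @ \<sigma> i, j := rev (\<sigma> t) @ \<sigma> j, t := []))" for \<sigma>
  proof (rule reg_foreach[where Q = "\<lambda>_. True" and
        \<sigma>' = "\<lambda>\<sigma>. \<sigma>(i := hd (\<sigma> t) # \<sigma> i, j := hd (\<sigma> t) # \<sigma> j, t := tl (\<sigma> t))" and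
        F = "\<lambda>\<sigma>. \<sigma>(i := rev (\<sigma> t) @ \<sigma> i, j := rev (\<sigma> t) @ \<sigma> j, t := [])"], goal_cases)
    case (1 b w \<sigma>)
    have "reg (push_top t i ;; push_top t j ;; pop t) \<sigma> 9
        (\<sigma>(i := hd (\<sigma> t) # \<sigma> i, j := hd (\<sigma> t) # \<sigma> j, t := tl (\<sigma> t)))"
      by (rule reg_weaken[OF reg_seq[OF reg_push_top reg_seq[OF reg_push_top reg_pop]]])
        (use 1 assms in \<open>auto simp: fun_eq_iff\<close>)
    then show ?case using 1 assms by simp
  qed (use assms in \<open>auto simp: fun_eq_iff\<close>)
  from reg_seq[OF reg_pour[OF assms(2)] this, of \<sigma>]
  show ?thesis unfolding copy_def
    by (rule reg_weaken) (use assms in \<open>auto simp: fun_eq_iff\<close>)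
qed

lemma ok_row_symbol: "ok_row K S L r \<Longrightarrow> fst (snd (r as) i) \<in> S \<union> range as"
  by (simp add: ok_row_def)

section \<open>From programs to Turing machines\<close>

lemma ok_row_target: "ok_row K S L r \<Longrightarrow> fst (r as) \<le> L"
  by (simp add: ok_row_def)

lemma ok_row_symbol_bounded:
  assumes "ok_row K S L r" "\<And>i. as i \<in> S \<union> B"
  shows "fst (snd (r as) i) \<in> S \<union> B"
proof -
  have "fst (snd (r as) i) \<in> S \<or> (\<exists>x. fst (snd (r as) i) = as x)"
    using ok_row_symbol[OF assms(1), of as i] by blast
  then show ?thesis using assms(2) by (elim disjE exE) simp_all
qed

lemma ok_row_frame: "ok_row K S L r \<Longrightarrow> K \<le> i \<Longrightarrow> snd (r as) i = (as i, MStay)"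
  by (simp add: ok_row_def)

lemma pstep_frame:
  assumes "ok K p" "K \<le> i"
  shows "snd (pstep p (c, T)) i = T i"
proof (cases "c < length p")
  case True
  obtain S where "\<And>r. r \<in> set p \<Longrightarrow> ok_row K S (length p) r"
    using assms(1) unfolding ok_def by blast
  then have "snd ((p ! c) (reads T)) i = (reads T i, MStay)"
    using True assms(2) nth_mem unfolding ok_row_def by blast
  then show ?thesis using True by (simp add: pstep.simps)
qed (simp add: pstep.simps)

lemma pstep_frame_pow:
  assumes "ok K p" "K \<le> i"
  shows "snd ((pstep p ^^ n) (c, T)) i = T i"
proof (induction n)
  case (Suc n)
  then show ?case
    using pstep_frame[OF assms, of "fst ((pstep p ^^ n) (c, T))" "snd ((pstep p ^^ n) (c, T))"] by simp
qed simp

lemma runs_frame: "runs p T n T' \<Longrightarrow> ok K p \<Longrightarrow> K \<le> i \<Longrightarrow> T' i = T i"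
  unfolding runs_def using pstep_frame_pow by (metis snd_conv)

definition blank_beyond :: "nat \<Rightarrow> nat list \<Rightarrow> nat \<Rightarrow> nat" where
  "blank_beyond k as = (\<lambda>i. if i < k then as ! i else 0)"

text \<open>
  The extra row reads tape \<open>j\<close> when the program has terminated and jumps to one of two
  further row numbers, which serve as the accepting and the rejecting state.
\<close>

abbreviation with_verdict :: "prog \<Rightarrow> nat \<Rightarrow> prog" where
  "with_verdict p j \<equiv> p @ [jump (\<lambda>s. s = 1) j (length p + 1) (length p + 2)]"

definition machine :: "nat \<Rightarrow> nat set \<Rightarrow> prog \<Rightarrow> nat \<Rightarrow> tm" where
  "machine k S p j = \<lparr>tm_tapes = k, tm_states = {..length p + 2}, tm_symbols = S \<union> {0, 1, 2},
     tm_start = 0, tm_accept = length p + 1, tm_reject = length p + 2,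
     tm_delta = (\<lambda>q as. let r = (with_verdict p j) ! q in
       (fst (r (blank_beyond k as)), map (snd (r (blank_beyond k as))) [0..<k]))\<rparr>"

lemma machine_row:
  assumes "\<And>r. r \<in> set p \<Longrightarrow> ok_row K S (length p) r" "K \<le> k" "q \<le> length p"
  shows "ok_row k S (length p + 2) ((with_verdict p j) ! q)"
proof (cases "q < length p")
  case True
  then have "ok_row K S (length p) (p ! q)" using assms(1) by simp
  then have "ok_row k S (length p + 2) (p ! q)" by (rule ok_row_mono) (use assms(2) in simp_all)
  then show ?thesis using True by (simp add: nth_append)
next
  case False
  then have "q = length p" using assms(3) by simp
  then show ?thesis by (simp add: ok_row_jump)
qed

lemma turing_machine_machine:
  assumes "\<And>r. r \<in> set p \<Longrightarrow> ok_row K S (length p) r" "K \<le> k" "finite S" "k \<ge> 1"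
  shows "turing_machine (machine k S p j)"
  unfolding turing_machine_def
proof (intro conjI ballI allI impI, goal_cases)
  case (7 q as)
  then have "q \<le> length p" by (auto simp: machine_def)
  from ok_row_target[OF machine_row[OF assms(1,2) this], of j "blank_beyond k as"] show ?case
    by (simp add: machine_def Let_def)
next
  case (8 q as)
  then show ?case by (auto simp: machine_def Let_def)
next
  case (9 q as)
  then have q: "q \<le> length p" by (auto simp: machine_def)
  have e: "blank_beyond k as i \<in> S \<union> {0, 1, 2}" for i
  proof (cases "i < k")
    case True
    have "set as \<subseteq> S \<union> {0, 1, 2}" "length as = k" using 9 by (simp_all add: machine_def)
    then have "as ! i \<in> S \<union> {0, 1, 2}" using True by (metis nth_mem subsetD)
    then show ?thesis unfolding blank_beyond_def using True by simp
  qed (simp add: blank_beyond_def)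
  have sym: "fst (snd (((with_verdict p j) ! q) (blank_beyond k as)) i)
      \<in> S \<union> {0, 1, 2}" for i
    by (rule ok_row_symbol_bounded[OF machine_row[OF assms(1,2) q] e])
  show ?case
  proof (rule image_subsetI)
    fix x assume "x \<in> set (snd (tm_delta (machine k S p j) q as))"
    then show "fst x \<in> tm_symbols (machine k S p j)"
      unfolding machine_def Let_def tm.simps snd_conv set_map
      by (elim imageE) (simp only: sym)
  qed
qed (use assms in \<open>auto simp: machine_def\<close>)

text \<open>
  The machine keeps only the first \<open>k\<close> tapes. The program reads blanks on all others, since
  it never changes them, so both see the same symbols.
\<close>

lemma step_machine:
  assumes rows: "\<And>r. r \<in> set p \<Longrightarrow> ok_row K S (length p) r" "K \<le> k"
    and blank: "\<And>i. k \<le> i \<Longrightarrow> read (T i) = 0" and q: "q \<le> length p + 2"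
    and step: "pstep (with_verdict p j) (q, T) = (q', T')"
  shows "step (machine k S p j) (q, map T [0..<k]) = (q', map T' [0..<k]) \<and> q' \<le> length p + 2
    \<and> (\<forall>i\<ge>k. T' i = T i)"
proof (cases "q \<le> length p")
  case True
  let ?r = "(with_verdict p j) ! q"
  have e: "blank_beyond k (map (read \<circ> T) [0..<k]) = reads T"
    by (auto simp: blank_beyond_def reads_def fun_eq_iff blank)
  have q': "q' = fst (?r (reads T))" "T' = (\<lambda>i. act (snd (?r (reads T)) i) (T i))"
    using step True by (auto simp: pstep.simps)
  have r: "ok_row k S (length p + 2) ?r" by (rule machine_row[OF rows True])
  have "map2 act (map (snd (?r (reads T))) [0..<k]) (map T [0..<k]) = map T' [0..<k]"
    by (rule nth_equalityI) (auto simp: q'(2))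
  moreover have "T' i = T i" if "k \<le> i" for i
  proof -
    have "snd (?r (reads T)) i = (reads T i, MStay)" by (rule ok_row_frame[OF r that])
    then show ?thesis by (simp add: q'(2))
  qed
  moreover have "q' \<le> length p + 2" unfolding q'(1) by (rule ok_row_target[OF r])
  moreover have "step (machine k S p j) (q, map T [0..<k]) =
      (fst (?r (reads T)), map2 act (map (snd (?r (reads T))) [0..<k]) (map T [0..<k]))"
    using True by (simp add: machine_def Let_def e)
  ultimately show ?thesis by (simp only: q'(1)) blast
next
  case False
  then have "(q', T') = (q, T)" using step by (simp add: pstep.simps)
  then show ?thesis using False q by (auto simp: machine_def)
qed

lemma step_machine_pow:
  assumes rows: "\<And>r. r \<in> set p \<Longrightarrow> ok_row K S (length p) r" "K \<le> k"
    and blank: "\<And>i. k \<le> i \<Longrightarrow> read (T i) = 0" and q: "q \<le> length p + 2"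
    and step: "(pstep (with_verdict p j) ^^ n) (q, T) = (q', T')"
  shows "(step (machine k S p j) ^^ n) (q, map T [0..<k]) = (q', map T' [0..<k])"
  using blank q step
proof (induction n arbitrary: q T)
  case (Suc n)
  let ?p = "with_verdict p j"
  obtain q1 T1 where 1: "pstep ?p (q, T) = (q1, T1)" by force
  note s = step_machine[OF rows Suc.prems(1,2) 1]
  have "(pstep ?p ^^ n) (q1, T1) = (q', T')"
    using Suc.prems(3) 1 by (simp add: funpow_Suc_right del: funpow.simps)
  then have "(step (machine k S p j) ^^ n) (q1, map T1 [0..<k]) = (q', map T' [0..<k])"
    using Suc.IH[of T1 q1] s Suc.prems(1) by auto
  then show ?case using s by (simp add: funpow_Suc_right del: funpow.simps step.simps)
qed simp

lemma funpow_fixed: "f x = x \<Longrightarrow> (f ^^ n) x = x"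
  by (induction n) auto

lemma funpow_stable:
  assumes "(f ^^ m) x = y" "f y = y" "m \<le> n"
  shows "(f ^^ n) x = y"
  using funpow_trans[OF assms(1) funpow_fixed[of f y "n - m", OF assms(2)]] assms(3) by simp

lemma runs_accept:
  assumes "ok K p" "K \<le> k" "k \<ge> 1"
  shows "\<exists>M. turing_machine M \<and> tm_tapes M = k \<and> (\<forall>T T' n m x. runs p T n T' \<longrightarrow>
     T = (\<lambda>_. (contents [], 0))(0 := (contents x, 0)) \<longrightarrow> n < m \<longrightarrow>
     (step M ^^ m) (init M x) =
       (if read (T' j) = 1 then tm_accept M else tm_reject M, map T' [0..<k]))"
proof -
  obtain S where S: "finite S" "\<And>r. r \<in> set p \<Longrightarrow> ok_row K S (length p) r"
    using assms(1) unfolding ok_def by blast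
  let ?M = "machine k S p j"
  let ?p = "with_verdict p j"
  have "(step ?M ^^ m) (init ?M x) =
      (if read (T' j) = 1 then tm_accept ?M else tm_reject ?M, map T' [0..<k])"
    if runs: "runs p T n T'" and T: "T = (\<lambda>_. (contents [], 0))(0 := (contents x, 0))" and "n < m"
    for T T' n m x
  proof -
    have "\<exists>a\<le>n. (pstep ?p ^^ a) (0, T) = (0 + length p, T')"
      by (rule runs_embed[OF _ runs]) (simp add: nth_append relocate_def)
    then obtain a where a: "a \<le> n" "(pstep ?p ^^ a) (0, T) = (length p, T')" by auto
    let ?q = "if read (T' j) = 1 then length p + 1 else length p + 2"
    have "pstep ?p (length p, T') = (?q, T')"
      using pstep_jump[of "length p" ?p "\<lambda>s. s = 1" j] by simp
    then have "(pstep ?p ^^ Suc a) (0, T) = (?q, T')" using a(2) by simp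
    then have "(step ?M ^^ Suc a) (0, map T [0..<k]) = (?q, map T' [0..<k])"
      by (intro step_machine_pow[OF S(2) assms(2)]) (use assms(3) in \<open>auto simp: T\<close>)
    moreover have "step ?M (?q, map T' [0..<k]) = (?q, map T' [0..<k])"
      by (simp add: machine_def)
    ultimately have "(step ?M ^^ m) (0, map T [0..<k]) = (?q, map T' [0..<k])"
      by (rule funpow_stable) (use a(1) \<open>n < m\<close> in simp)
    moreover have "init ?M x = (0, map T [0..<k])"
    proof -
      have "[0..<k] = 0 # [1..<k]" using assms(3) by (simp add: upt_conv_Cons)
      moreover have "map T [1..<k] = replicate (k - 1) (contents [], 0)"
        by (rule nth_equalityI) (auto simp: T)
      ultimately show ?thesis by (simp add: init_def machine_def T)
    qed
    ultimately show ?thesis by (simp add: machine_def)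
  qed
  note main = this
  show ?thesis
  proof (intro exI[of _ ?M] conjI allI impI)
    show "turing_machine ?M" by (rule turing_machine_machine[OF S(2) assms(2) S(1) assms(3)])
    show "tm_tapes ?M = k" by (simp add: machine_def)
    show "(step ?M ^^ m) (init ?M x) =
      (if read (T' j) = 1 then tm_accept ?M else tm_reject ?M, map T' [0..<k])"
      if "runs p T n T'" "T = (\<lambda>_. (contents [], 0))(0 := (contents x, 0))" "n < m" for T T' n m x
      by (fact main[OF that])
  qed
qed

text \<open>
  A partial function is computed by a total program: the letter in front tells definedness.
\<close>

definition result :: "word option \<Rightarrow> word" where
  "result r = (case r of None \<Rightarrow> [] | Some y \<Rightarrow> True # y)"

lemma result_simps [simp]: "result None = []" "result (Some y) = True # y"
  by (simp_all add: result_def)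

text \<open>
  Bounds are kept as functions: they need not be polynomials but only be dominated by one.
\<close>

definition polyb :: "(nat \<Rightarrow> nat) \<Rightarrow> bool" where
  "polyb t \<longleftrightarrow> (\<exists>p :: nat poly. \<forall>n. t n \<le> poly p n)"

text \<open>
  The output must start in cell 0, whereas the origin of a stack drifts. The result is
  therefore copied to a fresh tape, from left to right.
\<close>

definition emit :: "nat \<Rightarrow> prog" where
  "emit j = pwhile 0 nonblank
     (pif 0 (is_letter True) (pwrite j (letter True) MRight) (pwrite j (letter False) MRight) ;; pop 0)"

lemma runs_emit:
  assumes "T 0 = wtape a u" "T j = (contents w, int (length w))" "j \<noteq> 0"
  shows "\<exists>T'. runs (emit j) T (6 * length u + 1) T' \<and> fst (T' j) = contents (w @ u) \<and>
    (\<forall>i. i \<noteq> 0 \<longrightarrow> i \<noteq> j \<longrightarrow> T' i = T i)"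
  using assms(1,2)
proof (induction u arbitrary: T a w)
  case Nil
  have "runs (emit j) T 1 T" unfolding emit_def by (rule runs_while_False) (simp add: Nil)
  then show ?case using Nil by auto
next
  case (Cons b u)
  let ?T1 = "T(j := act (letter b, MRight) (T j))"
  let ?T2 = "?T1(0 := act (0, MRight) (?T1 0))"
  have T2: "?T2 0 = wtape (a + 1) u" "?T2 j = (contents (w @ [b]), int (length (w @ [b])))"
    using assms(3) Cons.prems by (auto simp: pop_wtape contents_snoc)
  obtain T' where T': "runs (emit j) ?T2 (6 * length u + 1) T'" "fst (T' j) = contents ((w @ [b]) @ u)"
    "\<forall>i. i \<noteq> 0 \<longrightarrow> i \<noteq> j \<longrightarrow> T' i = ?T2 i"
    using Cons.IH[OF T2] by blast
  have "runs (pif 0 (is_letter True) (pwrite j (letter True) MRight) (pwrite j (letter False) MRight)) T (1 + 2) ?T1"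
  proof (cases b)
    case True
    then have b: "b = True" by simp
    show ?thesis unfolding b by (rule runs_if_True[OF _ runs_pwrite]) (simp add: Cons.prems(1) b)
  next
    case False
    then have b: "b = False" by simp
    show ?thesis unfolding b by (rule runs_if_False[OF _ runs_pwrite]) (simp add: Cons.prems(1) b)
  qed
  note body = runs_seq[OF this runs_pwrite[of 0 0 MRight], folded pop_def]
  have "runs (emit j) T ((1 + 2) + 1 + (6 * length u + 1) + 2) T'"
    unfolding emit_def
    by (rule runs_while_True[OF _ body T'(1)[unfolded emit_def]]) (simp add: Cons.prems(1))
  then have "runs (emit j) T (6 * length (b # u) + 1) T'" by (rule runs_mono) simp
  then show ?case using T'(2,3) by (intro exI[of _ T']) auto
qed

text \<open>
  Behind the \<open>K\<close> tapes of the program there are two more: tape \<open>Suc K\<close> is marked when the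
  result is defined and decides between acceptance and rejection, and tape \<open>Suc (Suc K)\<close>
  receives the output. Both are still untouched when the program ends, by \<open>runs_frame\<close>, so
  that their heads are in cell 0.
\<close>

lemma polytime_computableI:
  assumes "ok K p" "polyb t"
    and runs: "\<And>x. \<exists>\<sigma>. reg p ((\<lambda>_. [])(0 := x)) (t (length x)) \<sigma> \<and> \<sigma> 0 = result (f x) \<and>
      length (\<sigma> 0) \<le> t (length x)"
  shows "polytime_computable f"
proof -
  obtain P :: "nat poly" where P: "t n \<le> poly P n" for n using assms(2) unfolding polyb_def by blast
  let ?F = "Suc K" let ?O = "Suc (Suc K)"
  let ?p = "p ;; pif 0 nonblank (pop 0 ;; pwrite ?F 1 MStay ;; emit ?O) []"
  have ok: "ok (?O + 1) ?p"
    using assms(1) by (intro ok_seq ok_if) (auto simp: emit_def intro: ok_mono)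
  have "?O + 1 \<ge> 1" by simp
  from runs_accept[OF ok order_refl this, of ?F]
  obtain M where M: "turing_machine M" "tm_tapes M = ?O + 1" and run0: "\<forall>T T' n m x. runs ?p T n T' \<longrightarrow>
     T = (\<lambda>_. (contents [], 0))(0 := (contents x, 0)) \<longrightarrow> n < m \<longrightarrow>
     (step M ^^ m) (init M x) =
       (if read (T' ?F) = 1 then tm_accept M else tm_reject M, map T' [0..<?O + 1])"
    by (elim exE conjE)
  have run: "(step M ^^ m) (init M x) =
       (if read (T' ?F) = 1 then tm_accept M else tm_reject M, map T' [0..<?O + 1])"
    if "runs ?p T n T'" "T = (\<lambda>_. (contents [], 0))(0 := (contents x, 0))" "n < m"
    for T T' n m x using run0 that by simp
  let ?Q = "smult 8 P + [:10:]"
  have "case (step M ^^ poly ?Q (length x)) (init M x) of (q, ts) \<Rightarrow>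
           (case f x of
              None \<Rightarrow> q = tm_reject M
            | Some y \<Rightarrow> q = tm_accept M \<and> fst (last ts) = contents y)" for x
  proof -
    define T :: tapes where "T = (\<lambda>_. (contents [], 0))(0 := (contents x, 0))"
    obtain \<sigma> where \<sigma>: "reg p ((\<lambda>_. [])(0 := x)) (t (length x)) \<sigma>" "\<sigma> 0 = result (f x)"
      "length (\<sigma> 0) \<le> t (length x)" using runs by blast
    have "represents ((\<lambda>_. [])(0 := x)) T"
      unfolding represents_def T_def wtape_def by (intro allI exI[of _ 0]) auto
    then obtain T1 where T1: "runs p T (t (length x)) T1" "represents \<sigma> T1"
      using \<sigma>(1) unfolding reg_def by blast
    have fr: "T1 i = (contents [], 0)" if "i > K" for i
      using runs_frame[OF T1(1) assms(1), of i] that by (simp add: T_def)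
    have rd: "read (T1 0) = top_symbol (result (f x))" using represents_read[OF T1(2)] \<sigma>(2) by simp
    have len: "last (map T' [0..<?O + 1]) = T' ?O" for T' :: tapes by simp
    have bd: "t (length x) + (6 * length (\<sigma> 0) + 7) < poly ?Q (length x)"
      using P[of "length x"] \<sigma>(3) by simp
    show ?thesis
    proof (cases "f x")
      case None
      have "runs ?p T (t (length x) + (0 + 2)) T1"
        by (rule runs_seq[OF T1(1) runs_if_False]) (use None rd in auto)
      from run[OF this T_def, of "poly ?Q (length x)"] bd fr[of ?F] None
      show ?thesis by simp
    next
      case (Some y)
      obtain a where a: "T1 0 = wtape a (True # y)" using T1(2) \<sigma>(2) Some unfolding represents_def by (metis result_simps(2))
      let ?T2 = "T1(0 := act (0, MRight) (T1 0))"
      let ?T3 = "?T2(?F := act (1, MStay) (?T2 ?F))"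
      have F: "T1 ?F = (contents [], 0)" "T1 ?O = (contents [], 0)" by (rule fr; simp)+
      have T3: "?T3 0 = wtape (a + 1) y" "?T3 ?O = (contents [], int (length []))" "read (?T3 ?F) = 1"
        by (simp_all add: F a pop_wtape)
      obtain T' where T': "runs (emit ?O) ?T3 (6 * length y + 1) T'" "fst (T' ?O) = contents ([] @ y)"
        "\<forall>i. i \<noteq> 0 \<longrightarrow> i \<noteq> ?O \<longrightarrow> T' i = ?T3 i"
        using runs_emit[OF T3(1,2)] by blast
      have "runs (pop 0 ;; pwrite ?F 1 MStay ;; emit ?O) T1 (1 + (1 + (6 * length y + 1))) T'"
        unfolding pop_def by (rule runs_seq[OF runs_pwrite runs_seq[OF runs_pwrite T'(1)]])
      then have "runs ?p T (t (length x) + (1 + (1 + (6 * length y + 1)) + 2)) T'"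
        by (intro runs_seq[OF T1(1)] runs_if_True) (use Some rd in auto)
      from run[OF this T_def, of "poly ?Q (length x)"] bd
      show ?thesis using Some T'(2,3) T3(3) \<sigma>(2) len[of T'] by simp
    qed
  qed
  then show ?thesis unfolding polytime_computable_def using M(1) by blast
qed

section \<open>Simulating a Turing machine inside a program\<close>

text \<open>
  After a simulated computation the tapes contain garbage at unknown places, which has to be
  removed before the next call. The simulation therefore writes an extra symbol \<open>V\<close> instead
  of the blank. The visited cells then form one block of nonblank cells next to the head,
  and the block can be found and cleared.
\<close>

definition strip :: "nat \<Rightarrow> nat \<Rightarrow> nat" where
  "strip V s = (if s = V then 0 else s)"

definition dress :: "nat set \<Rightarrow> nat \<Rightarrow> nat \<Rightarrow> nat" where
  "dress S V s = (if s \<in> S - {0} then s else V)"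

text \<open>
  The head may have just left the block on either side.
\<close>

definition blob :: "nat \<Rightarrow> tape \<Rightarrow> int \<Rightarrow> int \<Rightarrow> bool" where
  "blob n T l r \<longleftrightarrow> (\<forall>p. fst T p \<noteq> 0 \<longleftrightarrow> l \<le> p \<and> p < r) \<and>
     l - 1 \<le> snd T \<and> snd T \<le> r \<and> l \<le> r \<and> r - l \<le> int n"

lemma blob_act:
  assumes "blob n T l r" "s \<noteq> 0"
  shows "blob (Suc n) (act (s, d) T) (min l (snd T)) (max r (snd T + 1))"
proof (cases T)
  case (Pair t h)
  have t: "t p \<noteq> 0 \<longleftrightarrow> l \<le> p \<and> p < r" for p
    using assms(1) by (simp add: blob_def Pair)
  have h: "l - 1 \<le> h" "h \<le> r" "l \<le> r" "r - l \<le> int n"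
    using assms(1) by (simp_all add: blob_def Pair)
  have "(t(h := s)) p \<noteq> 0 \<longleftrightarrow> min l h \<le> p \<and> p < max r (h + 1)" for p
    using t[of p] h assms(2) by (cases "p = h") (simp_all, linarith)
  moreover have "min l h - 1 \<le> shift d h" "shift d h \<le> max r (h + 1)"
    by (cases d; simp)+
  moreover have "min l h \<le> max r (h + 1)" "max r (h + 1) - min l h \<le> int (Suc n)"
    using h by linarith+
  ultimately show ?thesis by (simp only: blob_def Pair act.simps fst_conv snd_conv) blast
qed

text \<open>
  The simulated and the simulating tape may differ by a translation, because registers have
  no fixed origin.
\<close>

definition simtape :: "nat set \<Rightarrow> nat \<Rightarrow> nat \<Rightarrow> tape \<Rightarrow> tape \<Rightarrow> bool" where
  "simtape S V n t T \<longleftrightarrow> (\<exists>a. snd T = snd t + a \<and> (\<forall>p. fst t p = strip V (fst T (p + a)))) \<and>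
     range (fst t) \<subseteq> S \<and> (\<exists>l r. blob n T l r)"

lemma simtape_act:
  assumes "simtape S V n t T" "s \<in> S" "V \<notin> S" "0 \<in> S"
  shows "simtape S V (Suc n) (act (s, d) t) (act (dress S V s, d) T)"
proof -
  obtain t' h' where T: "T = (t', h')" by force
  obtain t1 h1 where t: "t = (t1, h1)" by force
  obtain a l r where a: "h' = h1 + a" "\<And>p. t1 p = strip V (t' (p + a))" and r: "range t1 \<subseteq> S"
    and b: "blob n T l r"
    using assms(1) unfolding simtape_def T t by auto
  have V: "V \<noteq> 0" using assms(3,4) by metis
  have sd: "strip V (dress S V s) = s" using assms(2,3) by (auto simp: strip_def dress_def)
  have "dress S V s \<noteq> 0" using V by (auto simp: dress_def)
  note B = blob_act[OF b this, of d]
  have "snd (act (dress S V s, d) T) = snd (act (s, d) t) + a"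
    by (cases d) (simp_all add: T t a(1))
  moreover have "fst (act (s, d) t) p = strip V (fst (act (dress S V s, d) T) (p + a))" for p
    using sd a by (auto simp: T t)
  moreover have "range (fst (act (s, d) t)) \<subseteq> S" using r assms(2) by (auto simp: t)
  ultimately show ?thesis unfolding simtape_def
    by (intro conjI exI[of _ a] exI[of _ "min l (snd T)"] exI[of _ "max r (snd T + 1)"] allI B) simp_all
qed

lemma simtapeE:
  assumes "simtape S V n t T"
  obtains a l r where "snd T = snd t + a" "\<And>p. fst t p = strip V (fst T (p + a))"
    "range (fst t) \<subseteq> S" "blob n T l r"
proof -
  obtain a where "snd T = snd t + a \<and> (\<forall>p. fst t p = strip V (fst T (p + a)))"
    using assms unfolding simtape_def by (elim conjE) (erule exE)
  moreover obtain l r where "blob n T l r" using assms unfolding simtape_def by (elim conjE exE)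
  moreover have "range (fst t) \<subseteq> S" using assms unfolding simtape_def by (elim conjE)
  ultimately show ?thesis by (intro that) simp_all
qed

lemma simtape_read:
  assumes "simtape S V n t T"
  shows "strip V (read T) = read t" "read t \<in> S"
proof -
  obtain a l r where a: "snd T = snd t + a" "\<And>p. fst t p = strip V (fst T (p + a))"
    "range (fst t) \<subseteq> S" "blob n T l r"
    by (rule simtapeE[OF assms]) (rule that)
  have "read t = fst t (snd t)" "read T = fst T (snd T)" by (cases t, simp) (cases T, simp)
  then show "strip V (read T) = read t" "read t \<in> S"
    using a(1) a(2)[of "snd t"] subsetD[OF a(3) rangeI, of "snd t"] by simp_all
qed

lemma blob_mono: "blob n T l r \<Longrightarrow> n \<le> m \<Longrightarrow> blob m T l r"
  by (simp add: blob_def)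

lemma simtape_mono: "simtape S V n t T \<Longrightarrow> n \<le> m \<Longrightarrow> simtape S V m t T"
  by (erule simtapeE) (auto simp: simtape_def intro: blob_mono)

lemma contents_nonzero: "contents x p \<noteq> 0 \<longleftrightarrow> 0 \<le> p \<and> p < int (length x)"
  by (simp add: contents_def)

lemma simtape_wtape:
  assumes "{0, 1, 2} \<subseteq> S" "V \<notin> S"
  shows "simtape S V (length x) (contents x, 0) (wtape a x)"
proof -
  have c: "contents x p \<in> S" for p using assms(1) by (auto simp: contents_def)
  then have "strip V (contents x p) = contents x p" for p
    using c[of p] assms(2) by (cases "contents x p = V") (simp_all add: strip_def)
  moreover have "blob (length x) (wtape a x) a (a + int (length x))"
    unfolding blob_def wtape_def fst_conv snd_conv contents_nonzero by auto
  ultimately show ?thesis unfolding simtape_def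
    by (intro conjI exI[of _ a] exI[of _ "a + int (length x)"]) (auto simp: wtape_def c)
qed

text \<open>
  States of the machine are shifted by one, since row 0 enters the start state. A target
  outside the state set and symbols outside the symbol set never occur in a computation;
  they are redirected to 0 and \<open>V\<close> so that the row is well-formed even where the transition
  function is unconstrained.
\<close>

definition sim_row :: "tm \<Rightarrow> nat \<Rightarrow> nat \<Rightarrow> nat \<Rightarrow> row" where
  "sim_row M V b q = (\<lambda>as. let d = tm_delta M q (map (\<lambda>m. strip V (as (b + m))) [0..<tm_tapes M]) in
     (if fst d \<in> tm_states M then Suc (fst d) else 0,
      \<lambda>i. if b \<le> i \<and> i < b + tm_tapes M
          then (dress (tm_symbols M) V (fst (snd d ! (i - b))), snd (snd d ! (i - b)))
          else (as i, MStay)))"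

text \<open>
  The tape behind the tapes of the machine is used as a flag register, which becomes
  nonempty on acceptance.
\<close>

definition simulate :: "tm \<Rightarrow> nat \<Rightarrow> nat \<Rightarrow> prog" where
  "simulate M V b = (let L = Suc (Suc (Max (tm_states M))) in
     (\<lambda>as. (Suc (tm_start M), keep as)) #
     map (\<lambda>q. if q = tm_accept M then (\<lambda>as. (L, (keep as)(b + tm_tapes M := (letter True, MStay))))
       else if q = tm_reject M then (\<lambda>as. (L, keep as)) else sim_row M V b q)
     [0..<Suc (Max (tm_states M))])"

lemma length_simulate: "length (simulate M V b) = Suc (Suc (Max (tm_states M)))"
  by (simp add: simulate_def Let_def)

lemma simulate_0: "simulate M V b ! 0 = (\<lambda>as. (Suc (tm_start M), keep as))"
  by (simp add: simulate_def Let_def)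

lemma simulate_Suc: "q \<le> Max (tm_states M) \<Longrightarrow> simulate M V b ! Suc q =
    (if q = tm_accept M
       then (\<lambda>as. (length (simulate M V b), (keep as)(b + tm_tapes M := (letter True, MStay))))
     else if q = tm_reject M then (\<lambda>as. (length (simulate M V b), keep as)) else sim_row M V b q)"
  unfolding length_simulate unfolding simulate_def Let_def by (simp del: upt_Suc)

lemma ok_rowI:
  assumes "\<And>as. fst (r as) \<le> L" "\<And>as i. K \<le> i \<Longrightarrow> snd (r as) i = (as i, MStay)"
    "\<And>as i. fst (snd (r as) i) \<in> S \<union> range as"
  shows "ok_row K S L r"
  unfolding ok_row_def by (intro allI conjI impI assms)

lemma ok_simulate:
  assumes M: "turing_machine M"
  shows "ok (b + tm_tapes M + 1) (simulate M V b)"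
proof -
  let ?S = "tm_symbols M \<union> {V, letter True}" and ?L = "Suc (Suc (Max (tm_states M)))"
  let ?K = "b + tm_tapes M + 1"
  have fin: "finite (tm_states M)" "finite ?S" "tm_start M \<in> tm_states M"
    using M by (auto simp: turing_machine_def)
  have d: "dress (tm_symbols M) V s \<in> ?S" for s by (auto simp: dress_def)
  have "ok_row ?K ?S ?L (sim_row M V b q)" for q
  proof (rule ok_rowI)
    fix as i
    show "fst (sim_row M V b q as) \<le> ?L"
      using Max_ge[OF fin(1)] by (simp add: sim_row_def Let_def le_SucI)
    show "?K \<le> i \<Longrightarrow> snd (sim_row M V b q as) i = (as i, MStay)"
      by (simp add: sim_row_def Let_def)
    show "fst (snd (sim_row M V b q as) i) \<in> ?S \<union> range as"
      by (simp add: sim_row_def Let_def) (use d in blast)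
  qed
  moreover have "ok_row ?K ?S ?L (\<lambda>as. (?L, (keep as)(b + tm_tapes M := (letter True, MStay))))"
    by (rule ok_rowI) (simp_all add: keep_def)
  moreover have "ok_row ?K ?S ?L (\<lambda>as. (?L, keep as))"
    by (rule ok_rowI) (simp_all add: keep_def)
  moreover have "ok_row ?K ?S ?L (\<lambda>as. (Suc (tm_start M), keep as))"
    using Max_ge[OF fin(1,3)] by (intro ok_rowI) (simp_all add: keep_def)
  ultimately have "\<forall>r \<in> set (simulate M V b). ok_row ?K ?S ?L r"
    unfolding simulate_def Let_def list.set set_map ball_simps
    by (intro conjI ballI) (simp_all only: simp_thms split: if_split)
  then show ?thesis unfolding ok_def length_simulate using fin(2) by blast
qed

lemma simulate_step:
  assumes M: "turing_machine M" and V: "V \<notin> tm_symbols M"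
    and q: "q \<in> tm_states M" "q \<noteq> tm_accept M" "q \<noteq> tm_reject M" and ts: "length ts = tm_tapes M"
    and sim: "\<forall>m < tm_tapes M. simtape (tm_symbols M) V n (ts ! m) (T (b + m))"
    and step: "step M (q, ts) = (q', ts')"
  shows "\<exists>T'. pstep (simulate M V b) (Suc q, T) = (Suc q', T') \<and> q' \<in> tm_states M \<and>
    length ts' = tm_tapes M \<and>
    (\<forall>m < tm_tapes M. simtape (tm_symbols M) V (Suc n) (ts' ! m) (T' (b + m))) \<and>
    (\<forall>i. i < b \<or> b + tm_tapes M \<le> i \<longrightarrow> T' i = T i)"
proof -
  let ?k = "tm_tapes M" and ?S = "tm_symbols M"
  let ?d = "tm_delta M q (map read ts)"
  have fin: "finite (tm_states M)" and S: "0 \<in> ?S" using M by (auto simp: turing_machine_def)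
  have q': "q' = fst ?d" "ts' = map2 act (snd ?d) ts"
    using step q(2,3) by (auto simp: case_prod_beta)
  have rd: "map (\<lambda>m. strip V (reads T (b + m))) [0..<?k] = map read ts"
    by (rule nth_equalityI) (simp_all add: ts reads_def simtape_read(1)[OF sim[rule_format]])
  have "set (map read ts) \<subseteq> ?S"
  proof
    fix s assume "s \<in> set (map read ts)"
    then obtain m where "m < ?k" "s = read (ts ! m)" using ts by (auto simp: in_set_conv_nth)
    then show "s \<in> ?S" using simtape_read(2)[OF sim[rule_format]] by simp
  qed
  then have D: "fst ?d \<in> tm_states M" "length (snd ?d) = ?k" "fst ` set (snd ?d) \<subseteq> ?S"
    using M q ts unfolding turing_machine_def by auto
  define T' where "T' = (\<lambda>i. act (snd (sim_row M V b q (reads T)) i) (T i))"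
  have "pstep (simulate M V b) (Suc q, T) = (Suc q', T')"
    using q Max_ge[OF fin q(1)] D(1)
    by (simp add: pstep.simps length_simulate simulate_Suc T'_def q'(1))
      (simp add: sim_row_def Let_def rd)
  moreover have "simtape ?S V (Suc n) (ts' ! m) (T' (b + m))" if "m < ?k" for m
  proof -
    have "fst (snd ?d ! m) \<in> ?S" using D(2,3) that by (auto simp: image_subset_iff)
    from simtape_act[OF sim[rule_format, OF that] this V S, of "snd (snd ?d ! m)"]
    show ?thesis using that D(2) ts by (simp add: q'(2) T'_def sim_row_def Let_def rd)
  qed
  moreover have "T' i = T i" if "i < b \<or> b + ?k \<le> i" for i
  proof -
    have "\<not> (b \<le> i \<and> i < b + ?k)" using that by auto
    then have "snd (sim_row M V b q (reads T)) i = (reads T i, MStay)"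
      by (simp only: sim_row_def Let_def snd_conv if_False)
    then show ?thesis by (simp add: T'_def)
  qed
  ultimately show ?thesis using D(1,2) ts
    by (intro exI[of _ T'] conjI allI impI) (simp_all add: q')
qed

lemma simulate_pow:
  assumes M: "turing_machine M" and V: "V \<notin> tm_symbols M"
    and q: "q \<in> tm_states M" and ts: "length ts = tm_tapes M"
    and sim: "\<forall>m < tm_tapes M. simtape (tm_symbols M) V n (ts ! m) (T (b + m))"
    and steps: "(step M ^^ j) (q, ts) = (qf, ts')" and qf: "qf = tm_accept M \<or> qf = tm_reject M"
  shows "\<exists>m T'. m \<le> Suc j \<and> (pstep (simulate M V b) ^^ m) (Suc q, T) = (length (simulate M V b), T') \<and>
    length ts' = tm_tapes M \<and>
    (\<forall>m < tm_tapes M. simtape (tm_symbols M) V (n + j) (ts' ! m) (T' (b + m))) \<and>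
    T' (b + tm_tapes M) =
      (if qf = tm_accept M then act (letter True, MStay) (T (b + tm_tapes M)) else T (b + tm_tapes M)) \<and>
    (\<forall>i. i < b \<or> b + tm_tapes M < i \<longrightarrow> T' i = T i)"
  using q ts sim steps
proof (induction j arbitrary: q ts n T)
  case (Suc j)
  let ?p = "simulate M V b"
  show ?case
  proof (cases "q = tm_accept M \<or> q = tm_reject M")
    case True
    then have fixed: "step M (q, ts) = (q, ts)" by simp
    then have "(step M ^^ j) (q, ts) = (qf, ts')"
      using Suc.prems(4) by (simp only: funpow_Suc_right comp_apply)
    note * = Suc.IH[OF Suc.prems(1-3) this]
    obtain m T' where T': "m \<le> Suc j" "(pstep ?p ^^ m) (Suc q, T) = (length ?p, T')"
      "length ts' = tm_tapes M"
      "\<forall>m < tm_tapes M. simtape (tm_symbols M) V (n + j) (ts' ! m) (T' (b + m))"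
      "T' (b + tm_tapes M) =
         (if qf = tm_accept M then act (letter True, MStay) (T (b + tm_tapes M)) else T (b + tm_tapes M))"
      "\<forall>i. i < b \<or> b + tm_tapes M < i \<longrightarrow> T' i = T i"
      using * by (elim exE conjE) (rule that)
    have "\<forall>m < tm_tapes M. simtape (tm_symbols M) V (n + Suc j) (ts' ! m) (T' (b + m))"
      using T'(4) simtape_mono[of _ V "n + j" _ _ "n + Suc j"] by simp
    then show ?thesis using T' by (intro exI[of _ m] exI[of _ T'] conjI) (simp_all only: le_SucI)
  next
    case False
    then have ne: "q \<noteq> tm_accept M" "q \<noteq> tm_reject M" by simp_all
    obtain q1 ts1 where 1: "step M (q, ts) = (q1, ts1)" by force
    have st: "(step M ^^ j) (q1, ts1) = (qf, ts')"
      using Suc.prems(4) 1 by (simp only: funpow_Suc_right comp_apply)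
    obtain T1 where T1: "pstep ?p (Suc q, T) = (Suc q1, T1)" "q1 \<in> tm_states M" "length ts1 = tm_tapes M"
      "\<forall>m < tm_tapes M. simtape (tm_symbols M) V (Suc n) (ts1 ! m) (T1 (b + m))"
      "\<forall>i. i < b \<or> b + tm_tapes M \<le> i \<longrightarrow> T1 i = T i"
      using simulate_step[OF M V Suc.prems(1) ne Suc.prems(2,3) 1] by (elim exE conjE) (rule that)
    obtain m T' where T': "m \<le> Suc j" "(pstep ?p ^^ m) (Suc q1, T1) = (length ?p, T')"
      "length ts' = tm_tapes M"
      "\<forall>m < tm_tapes M. simtape (tm_symbols M) V (Suc n + j) (ts' ! m) (T' (b + m))"
      "T' (b + tm_tapes M) =
         (if qf = tm_accept M then act (letter True, MStay) (T1 (b + tm_tapes M)) else T1 (b + tm_tapes M))"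
      "\<forall>i. i < b \<or> b + tm_tapes M < i \<longrightarrow> T' i = T1 i"
      using Suc.IH[OF T1(2-4) st] by (elim exE conjE) (rule that)
    have "(pstep ?p ^^ Suc m) (Suc q, T) = (length ?p, T')"
      using T'(2) T1(1) by (simp only: funpow_Suc_right comp_apply)
    then show ?thesis using T' T1(5)
      by (intro exI[of _ "Suc m"] exI[of _ T'] conjI) simp_all
  qed
next
  case 0
  then have qf: "q = qf" "ts = ts'" using 0 by auto
  let ?p = "simulate M V b"
  have "finite (tm_states M)" using M by (simp add: turing_machine_def)
  then have le: "qf \<le> Max (tm_states M)" using 0 qf by simp
  define T' where "T' = (if qf = tm_accept M
    then T(b + tm_tapes M := act (letter True, MStay) (T (b + tm_tapes M))) else T)"
  have "pstep ?p (Suc qf, T) = (length ?p, T')"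
  proof (cases "qf = tm_accept M")
    case True
    then show ?thesis using le
      by (simp add: pstep.simps simulate_Suc length_simulate T'_def fun_eq_iff)
  next
    case False
    then show ?thesis using le assms(7)
      by (simp add: pstep.simps simulate_Suc length_simulate T'_def fun_eq_iff)
  qed
  then have "(pstep ?p ^^ 1) (Suc q, T) = (length ?p, T')" by (simp add: qf)
  then show ?case using 0 qf by (intro exI[of _ 1] exI[of _ T']) (auto simp: T'_def)
qed

lemma runs_simulate:
  assumes M: "turing_machine M" and V: "V \<notin> tm_symbols M"
    and sim: "\<forall>m < tm_tapes M. simtape (tm_symbols M) V n (snd (init M x) ! m) (T (b + m))"
    and steps: "(step M ^^ j) (init M x) = (qf, ts')" and qf: "qf = tm_accept M \<or> qf = tm_reject M"
  shows "\<exists>T'. runs (simulate M V b) T (j + 2) T' \<and> length ts' = tm_tapes M \<and>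
    (\<forall>m < tm_tapes M. simtape (tm_symbols M) V (n + j) (ts' ! m) (T' (b + m))) \<and>
    T' (b + tm_tapes M) =
      (if qf = tm_accept M then act (letter True, MStay) (T (b + tm_tapes M)) else T (b + tm_tapes M)) \<and>
    (\<forall>i. i < b \<or> b + tm_tapes M < i \<longrightarrow> T' i = T i)"
proof -
  let ?p = "simulate M V b"
  have st: "tm_start M \<in> tm_states M" and k: "tm_tapes M \<ge> 1" using M by (auto simp: turing_machine_def)
  have i: "init M x = (tm_start M, snd (init M x))" by (simp add: init_def)
  have len: "length (snd (init M x)) = tm_tapes M" using k by (simp add: init_def)
  have steps': "(step M ^^ j) (tm_start M, snd (init M x)) = (qf, ts')"
    using steps by (subst i[symmetric])
  obtain m T' where T': "m \<le> Suc j" "(pstep ?p ^^ m) (Suc (tm_start M), T) = (length ?p, T')"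
    "length ts' = tm_tapes M"
    "\<forall>m < tm_tapes M. simtape (tm_symbols M) V (n + j) (ts' ! m) (T' (b + m))"
    "T' (b + tm_tapes M) =
       (if qf = tm_accept M then act (letter True, MStay) (T (b + tm_tapes M)) else T (b + tm_tapes M))"
    "\<forall>i. i < b \<or> b + tm_tapes M < i \<longrightarrow> T' i = T i"
    using simulate_pow[OF M V st len sim steps' qf] by (elim exE conjE) (rule that)
  have "pstep ?p (0, T) = (Suc (tm_start M), T)"
    by (simp add: pstep.simps length_simulate simulate_0)
  then have "(pstep ?p ^^ Suc m) (0, T) = (length ?p, T')"
    using T'(2) by (simp only: funpow_Suc_right comp_apply)
  then have "runs ?p T (j + 2) T'" unfolding runs_def using T'(1) by (intro exI[of _ "Suc m"]) simp
  then show ?thesis using T'(3-6) by (intro exI[of _ T'] conjI)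
qed

section \<open>Cleaning up after a simulation\<close>

text \<open>
  The clean-up routines work on one tape and leave the others unchanged, which permits
  calculating with a single tape.
\<close>

definition on_tape :: "nat \<Rightarrow> prog \<Rightarrow> tape \<Rightarrow> nat \<Rightarrow> tape \<Rightarrow> bool" where
  "on_tape i p x n y \<longleftrightarrow> (\<forall>T. T i = x \<longrightarrow> runs p T n (T(i := y)))"

lemma on_tape_seq: "on_tape i p x m y \<Longrightarrow> on_tape i q y n z \<Longrightarrow> on_tape i (p ;; q) x (m + n) z"
  unfolding on_tape_def
proof (intro allI impI)
  fix T :: tapes assume 1: "\<forall>T. T i = x \<longrightarrow> runs p T m (T(i := y))" and x: "T i = x"
    and 2: "\<forall>T. T i = y \<longrightarrow> runs q T n (T(i := z))"
  have "runs q (T(i := y)) n (T(i := z))" using 2[rule_format, of "T(i := y)"] by simp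
  then show "runs (p ;; q) T (m + n) (T(i := z))" by (rule runs_seq[OF 1[rule_format, of T, OF x]])
qed

lemma on_tape_mono: "on_tape i p x m y \<Longrightarrow> m \<le> n \<Longrightarrow> on_tape i p x n y"
  unfolding on_tape_def using runs_mono by blast

lemma on_tape_pact: "on_tape i (pact i g) (t, h) 1 (act (g (t h)) (t, h))"
  unfolding on_tape_def using runs_pact by (metis read.simps)

lemma on_tape_pmove: "on_tape i (pmove i d) (t, h) 1 (t, shift d h)"
  using on_tape_pact[of i "\<lambda>s. (s, d)" t h] by (simp add: pmove_def)

definition sweep :: "nat \<Rightarrow> (nat \<Rightarrow> bool) \<Rightarrow> bool \<Rightarrow> move \<Rightarrow> prog" where
  "sweep i P e d = pwhile i P (pact i (\<lambda>s. (if e then 0 else s, d)))"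

lemma ok_sweep [simp]: "i < K \<Longrightarrow> ok K (sweep i P e d)"
  unfolding sweep_def by (intro ok_while ok_pact[where S = "{0}"]) auto

text \<open>
  The step width \<open>\<delta>\<close> is \<open>1\<close> or \<open>-1\<close>, so that both directions are treated at once.
\<close>

lemma on_tape_sweep:
  assumes "\<And>h. shift d h = h + \<delta>" "\<delta> \<noteq> 0"
    and "\<forall>k<n. P (t (h + \<delta> * int k))" "\<not> P (t (h + \<delta> * int n))"
    and "t' = (\<lambda>p. if e \<and> (\<exists>k<n. p = h + \<delta> * int k) then 0 else t p)" "h' = h + \<delta> * int n"
  shows "on_tape i (sweep i P e d) (t, h) (3 * n + 1) (t', h')"
  using assms(3-6)
proof (induction n arbitrary: t h)
  case 0
  then have t': "t' = t" "h' = h" by simp_all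
  show ?case unfolding on_tape_def
  proof (intro allI impI)
    fix T :: tapes assume T: "T i = (t, h)"
    then have "T(i := (t', h')) = T" by (simp add: t' fun_upd_idem)
    moreover have "runs (sweep i P e d) T 1 T"
      unfolding sweep_def by (rule runs_while_False) (use T 0 in simp)
    ultimately show "runs (sweep i P e d) T (3 * 0 + 1) (T(i := (t', h')))" by simp
  qed
next
  case (Suc n)
  let ?t = "t(h := if e then 0 else t h)" and ?h = "h + \<delta>"
  have pos: "h + \<delta> * int (Suc k) = ?h + \<delta> * int k" for k by (simp add: algebra_simps)
  have ne: "?h + \<delta> * int k \<noteq> h" for k
  proof -
    have "\<delta> * int (Suc k) \<noteq> 0" using assms(2) by simp
    then show ?thesis using pos[of k] by linarith
  qed
  have P: "P (?t (?h + \<delta> * int k))" if "k < n" for k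
    using Suc.prems(1)[rule_format, of "Suc k"] that ne[of k] by (simp only: pos fun_upd_apply) simp
  have nP: "\<not> P (?t (?h + \<delta> * int n))"
    using Suc.prems(2) ne[of n] by (simp only: pos fun_upd_apply) simp
  have t': "t' = (\<lambda>p. if e \<and> (\<exists>k<n. p = ?h + \<delta> * int k) then 0 else ?t p)"
  proof
    fix p
    have "(\<exists>k<Suc n. p = h + \<delta> * int k) \<longleftrightarrow> p = h \<or> (\<exists>k<n. p = ?h + \<delta> * int k)"
      by (simp only: Ex_less_Suc2 pos) simp
    then show "t' p = (if e \<and> (\<exists>k<n. p = ?h + \<delta> * int k) then 0 else ?t p)"
      unfolding Suc.prems(3) by (simp only:) (cases "p = h"; cases e; auto)
  qed
  have IH: "on_tape i (sweep i P e d) (?t, ?h) (3 * n + 1) (t', h')"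
    by (rule Suc.IH[OF _ nP t']) (use P Suc.prems(4) pos in simp_all)
  show ?case unfolding on_tape_def
  proof (intro allI impI)
    fix T :: tapes assume T: "T i = (t, h)"
    let ?T = "T(i := (?t, ?h))"
    have "runs (pact i (\<lambda>s. (if e then 0 else s, d))) T 1 ?T"
      using runs_pact[of i "\<lambda>s. (if e then 0 else s, d)" T]
      by (simp only: T read.simps act.simps assms(1))
    moreover have "runs (sweep i P e d) ?T (3 * n + 1) (?T(i := (t', h')))"
      by (rule IH[unfolded on_tape_def, rule_format, of ?T, OF fun_upd_same])
    moreover have "P (read (T i))" using Suc.prems(1)[rule_format, of 0] T by simp
    ultimately have "runs (sweep i P e d) T (1 + (3 * n + 1) + 2) (?T(i := (t', h')))"
      unfolding sweep_def by (intro runs_while_True)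
    then show "runs (sweep i P e d) T (3 * Suc n + 1) (T(i := (t', h')))"
      by (simp add: runs_mono)
  qed
qed

lemma on_tape_sweep_right:
  assumes "h \<le> h'" "\<And>p. h \<le> p \<Longrightarrow> p < h' \<Longrightarrow> P (t p)" "\<not> P (t h')" "h' - h \<le> int n"
    and "t' = (\<lambda>p. if e \<and> h \<le> p \<and> p < h' then 0 else t p)"
  shows "on_tape i (sweep i P e MRight) (t, h) (3 * n + 1) (t', h')"
proof (rule on_tape_mono[OF on_tape_sweep[where n = "nat (h' - h)" and \<delta> = 1]])
  have "(\<exists>k<nat (h' - h). p = h + 1 * int k) \<longleftrightarrow> h \<le> p \<and> p < h'" for p
  proof
    assume "h \<le> p \<and> p < h'"
    then show "\<exists>k<nat (h' - h). p = h + 1 * int k" by (intro exI[of _ "nat (p - h)"]) auto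
  qed auto
  then show "t' = (\<lambda>p. if e \<and> (\<exists>k<nat (h' - h). p = h + 1 * int k) then 0 else t p)"
    by (simp only: assms(5))
  show "\<forall>k<nat (h' - h). P (t (h + 1 * int k))" by (intro allI impI assms(2)) linarith+
  have e: "h + 1 * int (nat (h' - h)) = h'" using assms(1) by simp
  show "\<not> P (t (h + 1 * int (nat (h' - h))))" using assms(3) unfolding e .
  show "h' = h + 1 * int (nat (h' - h))" by (rule e[symmetric])
qed (use assms(4) in simp_all)

lemma on_tape_sweep_left:
  assumes "h' \<le> h" "\<And>p. h' < p \<Longrightarrow> p \<le> h \<Longrightarrow> P (t p)" "\<not> P (t h')" "h - h' \<le> int n"
    and "t' = (\<lambda>p. if e \<and> h' < p \<and> p \<le> h then 0 else t p)"
  shows "on_tape i (sweep i P e MLeft) (t, h) (3 * n + 1) (t', h')"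
proof (rule on_tape_mono[OF on_tape_sweep[where n = "nat (h - h')" and \<delta> = "-1"]])
  have "(\<exists>k<nat (h - h'). p = h + -1 * int k) \<longleftrightarrow> h' < p \<and> p \<le> h" for p
  proof
    assume "h' < p \<and> p \<le> h"
    then show "\<exists>k<nat (h - h'). p = h + -1 * int k" by (intro exI[of _ "nat (h - p)"]) auto
  qed auto
  then show "t' = (\<lambda>p. if e \<and> (\<exists>k<nat (h - h'). p = h + -1 * int k) then 0 else t p)"
    by (simp only: assms(5))
  show "\<forall>k<nat (h - h'). P (t (h + -1 * int k))" by (intro allI impI assms(2)) linarith+
  have e: "h + -1 * int (nat (h - h')) = h'" using assms(1) by simp
  show "\<not> P (t (h + -1 * int (nat (h - h'))))" using assms(3) unfolding e .
  show "h' = h + -1 * int (nat (h - h'))" by (rule e[symmetric])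
qed (use assms(4) in simp_all)

lemma blob_nonzero: "blob n (t, h) l r \<Longrightarrow> t p \<noteq> 0 \<longleftrightarrow> l \<le> p \<and> p < r"
  by (simp add: blob_def)

text \<open>
  Writing a nonblank symbol first makes the cell under the head part of the block. Then the
  left end of the block is found and the block is erased from left to right.
\<close>

definition wipe :: "nat \<Rightarrow> prog" where
  "wipe i = pwrite i 1 MStay ;; sweep i nonblank False MLeft ;; pmove i MRight ;;
     sweep i nonblank True MRight"

lemma ok_wipe [simp]: "i < K \<Longrightarrow> ok K (wipe i)"
  by (simp add: wipe_def)

lemma on_tape_wipe:
  assumes "blob n x l r"
  shows "\<exists>a. on_tape i (wipe i) x (6 * n + 20) (wtape a [])"
proof -
  obtain t h where x: "x = (t, h)" by force
  define t1 where "t1 = t(h := 1)"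
  define l1 where "l1 = min l h"
  define r1 where "r1 = max r (h + 1)"
  have B: "blob (Suc n) (t1, h) l1 r1"
    using blob_act[OF assms one_neq_zero, of MStay]
    by (simp only: x act.simps shift.simps snd_conv t1_def l1_def r1_def)
  have nz: "t1 p = 0 \<longleftrightarrow> \<not> (l1 \<le> p \<and> p < r1)" "0 < t1 p \<longleftrightarrow> l1 \<le> p \<and> p < r1" for p
    using blob_nonzero[OF B, of p] by auto
  have len: "r1 - l1 \<le> int n + 1" using B by (simp add: blob_def)
  have lr: "l1 \<le> h" "h < r1" by (simp_all add: l1_def r1_def)
  have 1: "on_tape i (pwrite i 1 MStay) (t, h) 1 (t1, h)"
    using on_tape_pact[of i "\<lambda>_. (1, MStay)" t h] by (simp add: pwrite_def t1_def)
  have 2: "on_tape i (sweep i nonblank False MLeft) (t1, h) (3 * (n + 2) + 1) (t1, l1 - 1)"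
    by (rule on_tape_sweep_left) (use nz len lr in auto)
  have 3: "on_tape i (pmove i MRight) (t1, l1 - 1) 1 (t1, l1)"
    using on_tape_pmove[of i MRight t1 "l1 - 1"] by simp
  have 4: "on_tape i (sweep i nonblank True MRight) (t1, l1) (3 * (n + 2) + 1) (\<lambda>_. 0, r1)"
  proof (rule on_tape_sweep_right)
    show "(\<lambda>_. 0) = (\<lambda>p. if True \<and> l1 \<le> p \<and> p < r1 then 0 else t1 p)"
      by (auto simp: nz fun_eq_iff)
  qed (use nz len lr in auto)
  have w: "(\<lambda>_. 0, r1) = wtape r1 []" by (simp add: wtape_def)
  have "on_tape i (wipe i) x (1 + ((3 * (n + 2) + 1) + (1 + (3 * (n + 2) + 1)))) (wtape r1 [])"
    unfolding wipe_def x w[symmetric] by (intro on_tape_seq[OF 1] on_tape_seq[OF 2] on_tape_seq[OF 3] 4)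
  then have "on_tape i (wipe i) x (6 * n + 20) (wtape r1 [])" by (rule on_tape_mono) simp
  then show ?thesis by (rule exI)
qed

text \<open>
  The tape holds the output between two runs of \<open>V\<close>. The run on the left is erased from the
  left end of the block, the run on the right from its right end, and the head returns to
  the first letter.
\<close>

definition trim :: "nat \<Rightarrow> nat \<Rightarrow> prog" where
  "trim i V = pact i (\<lambda>s. (if s = 0 then V else s, MStay)) ;; sweep i nonblank False MLeft ;;
     pmove i MRight ;; sweep i (\<lambda>s. s = V) True MRight ;; sweep i nonblank False MRight ;;
     pmove i MLeft ;; sweep i (\<lambda>s. s = V) True MLeft ;; sweep i nonblank False MLeft ;;
     pmove i MRight"

lemma ok_trim [simp]: "i < K \<Longrightarrow> ok K (trim i V)"
  unfolding trim_def by (intro ok_seq ok_sweep ok_pmove ok_pact[where S = "{V}"]) auto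

text \<open>
  The block of visited cells contains the output, which gives the bound on the output
  length.
\<close>

lemma on_tape_trim:
  assumes sim: "simtape S V n (contents y, h0) x" and S: "{0, 1, 2} \<subseteq> S" "V \<notin> S"
  shows "(\<exists>a. on_tape i (trim i V) x (18 * n + 60) (wtape a y)) \<and> length y \<le> n"
proof -
  obtain t h where x: "x = (t, h)" by force
  obtain a0 l r where a0: "\<And>p. contents y p = strip V (t (p + a0))" and B: "blob n (t, h) l r"
    using simtapeE[OF sim] unfolding x fst_conv by metis
  have V0: "V \<noteq> 0" "V \<noteq> 1" "V \<noteq> 2" using S by (metis insertI1 insertI2 subsetD)+
  have nz0: "t p \<noteq> 0 \<longleftrightarrow> l \<le> p \<and> p < r" for p
    by (rule blob_nonzero[OF B])
  have h: "l - 1 \<le> h" "h \<le> r" "l \<le> r" "r - l \<le> int n" using B by (simp_all add: blob_def)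
  define t1 where "t1 = t(h := if t h = 0 then V else t h)"
  define l1 where "l1 = min l h"
  define r1 where "r1 = max r (h + 1)"
  have lr: "l1 \<le> h" "h < r1" "r1 - l1 \<le> int n + 1" "l1 \<le> l" "r \<le> r1" using h by (auto simp: l1_def r1_def)
  have nz: "t1 p \<noteq> 0 \<longleftrightarrow> l1 \<le> p \<and> p < r1" for p
    using nz0[of p] h V0 unfolding t1_def l1_def r1_def by (cases "p = h") auto
  have st: "strip V (t1 p) = contents y (p - a0)" for p
    using a0[of "p - a0"] V0 by (auto simp: t1_def strip_def)
  \<comment> \<open>on the empty word any origin will do\<close>
  define a where "a = (if y = [] then r1 else a0)"
  define c where "c = (\<lambda>p. contents y (p - a))"
  let ?m = "int (length y)"
  have c0: "c p \<noteq> 0 \<longleftrightarrow> a \<le> p \<and> p < a + ?m" for p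
    by (auto simp: c_def contents_def)
  have c0': "0 < c p \<longleftrightarrow> a \<le> p \<and> p < a + ?m" "c p = 0 \<longleftrightarrow> \<not> (a \<le> p \<and> p < a + ?m)" for p
    using c0[of p] by auto
  have cV: "c p \<noteq> V" for p using V0 by (auto simp: c_def contents_def)
  have st': "strip V (t1 p) = c p" for p using st by (simp add: c_def a_def)
  have ends: "t a0 \<noteq> 0" "t (a0 + ?m - 1) \<noteq> 0" if "y \<noteq> []"
  proof -
    have "t (p + a0) \<noteq> 0" if "contents y p \<noteq> 0" for p
      using that unfolding a0 by (rule contrapos_nn) (simp add: strip_def)
    from this[of 0] this[of "?m - 1"] show "t a0 \<noteq> 0" "t (a0 + ?m - 1) \<noteq> 0"
      using that unfolding contents_nonzero by (simp_all add: algebra_simps Suc_le_eq)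
  qed
  have y: "l \<le> a0" "a0 + ?m \<le> r" if "y \<noteq> []" using ends[OF that] nz0 by force+
  have len: "length y \<le> n"
  proof (cases "y = []")
    case False
    then show ?thesis using y h by linarith
  qed simp
  have ar: "l1 \<le> a" "a + ?m \<le> r1" using y lr by (auto simp: a_def)
  \<comment> \<open>the tape that holds the output and the symbol \<open>V\<close> in all other cells from \<open>u\<close> up to \<open>v\<close>\<close>
  define F where "F u v = (\<lambda>p. if c p \<noteq> 0 then c p else if u \<le> p \<and> p < v then V else 0)" for u v :: int
  have t1: "t1 = F l1 r1"
  proof
    fix p
    show "t1 p = F l1 r1 p"
      using st'[of p] nz[of p] cV[of p] V0(1) unfolding F_def strip_def by (auto split: if_splits)
  qed
  have F0: "0 < F u v p \<longleftrightarrow> a \<le> p \<and> p < a + ?m \<or> u \<le> p \<and> p < v"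
    "F u v p = 0 \<longleftrightarrow> \<not> (a \<le> p \<and> p < a + ?m \<or> u \<le> p \<and> p < v)" for u v p
    using V0(1) c0[of p] by (auto simp: F_def)
  have FV: "F u v p = V \<longleftrightarrow> \<not> (a \<le> p \<and> p < a + ?m) \<and> u \<le> p \<and> p < v" for u v p
    using V0(1) c0[of p] cV[of p] by (auto simp: F_def)
  have 1: "on_tape i (pact i (\<lambda>s. (if s = 0 then V else s, MStay))) (t, h) 1 (F l1 r1, h)"
    using on_tape_pact[of i "\<lambda>s. (if s = 0 then V else s, MStay)" t h] by (simp add: t1[symmetric] t1_def)
  have 2: "on_tape i (sweep i nonblank False MLeft) (F l1 r1, h) (3 * (n + 2) + 1) (F l1 r1, l1 - 1)"
    by (rule on_tape_sweep_left) (use lr ar in \<open>auto simp: F0\<close>)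
  have 3: "on_tape i (pmove i MRight) (F l1 r1, l1 - 1) 1 (F l1 r1, l1)"
    using on_tape_pmove[of i MRight "F l1 r1" "l1 - 1"] by simp
  have 4: "on_tape i (sweep i (\<lambda>s. s = V) True MRight) (F l1 r1, l1) (3 * (n + 2) + 1) (F a r1, a)"
  proof (rule on_tape_sweep_right)
    show "F a r1 = (\<lambda>p. if True \<and> l1 \<le> p \<and> p < a then 0 else F l1 r1 p)"
      using ar c0 by (auto simp: F_def fun_eq_iff)
    show "F l1 r1 a \<noteq> V" using ar by (auto simp: FV a_def)
  qed (use lr ar in \<open>auto simp: FV\<close>)
  have 5: "on_tape i (sweep i nonblank False MRight) (F a r1, a) (3 * (n + 2) + 1) (F a r1, r1)"
    by (rule on_tape_sweep_right) (use lr ar in \<open>auto simp: F0\<close>)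
  have 6: "on_tape i (pmove i MLeft) (F a r1, r1) 1 (F a r1, r1 - 1)"
    using on_tape_pmove[of i MLeft "F a r1" r1] by simp
  have 7: "on_tape i (sweep i (\<lambda>s. s = V) True MLeft) (F a r1, r1 - 1) (3 * (n + 2) + 1) (c, a + ?m - 1)"
  proof (rule on_tape_sweep_left)
    show "c = (\<lambda>p. if True \<and> a + ?m - 1 < p \<and> p \<le> r1 - 1 then 0 else F a r1 p)"
    proof
      fix p
      show "c p = (if True \<and> a + ?m - 1 < p \<and> p \<le> r1 - 1 then 0 else F a r1 p)"
        using ar c0[of p] by (auto simp: F_def)
    qed
    show "F a r1 (a + ?m - 1) \<noteq> V" by (auto simp: FV)
  qed (use lr ar in \<open>auto simp: FV\<close>)
  have 8: "on_tape i (sweep i nonblank False MLeft) (c, a + ?m - 1) (3 * (n + 2) + 1) (c, a - 1)"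
    by (rule on_tape_sweep_left) (use len c0 c0' in auto)
  have 9: "on_tape i (pmove i MRight) (c, a - 1) 1 (wtape a y)"
    using on_tape_pmove[of i MRight c "a - 1"] by (simp add: wtape_def c_def)
  have "on_tape i (trim i V) x (1 + ((3 * (n + 2) + 1) + (1 + ((3 * (n + 2) + 1) + ((3 * (n + 2) + 1) +
      (1 + ((3 * (n + 2) + 1) + ((3 * (n + 2) + 1) + 1)))))))) (wtape a y)"
    unfolding trim_def x
    by (intro on_tape_seq[OF 1] on_tape_seq[OF 2] on_tape_seq[OF 3] on_tape_seq[OF 4]
        on_tape_seq[OF 5] on_tape_seq[OF 6] on_tape_seq[OF 7] on_tape_seq[OF 8] 9)
  then have "on_tape i (trim i V) x (18 * n + 60) (wtape a y)" by (rule on_tape_mono) simp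
  then show ?thesis using len by blast
qed

section \<open>Polynomial-time functions as subprograms\<close>

fun wipes :: "nat list \<Rightarrow> prog" where
  "wipes [] = []"
| "wipes (i # is) = wipe i ;; wipes is"

lemma ok_wipes [simp]: "\<forall>i \<in> set is. i < K \<Longrightarrow> ok K (wipes is)"
  by (induction "is") simp_all

lemma runs_wipes:
  assumes "distinct is" "\<forall>i \<in> set is. \<exists>l r. blob n (T i) l r"
  shows "\<exists>T'. runs (wipes is) T (length is * (6 * n + 20)) T' \<and>
    (\<forall>i \<in> set is. \<exists>a. T' i = wtape a []) \<and> (\<forall>i. i \<notin> set is \<longrightarrow> T' i = T i)"
  using assms
proof (induction "is" arbitrary: T)
  case Nil
  then show ?case by (intro exI[of _ T]) simp
next
  case (Cons i "is")
  obtain l r where "blob n (T i) l r" using Cons.prems(2) by auto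
  from on_tape_wipe[OF this, of i] obtain a where
    "on_tape i (wipe i) (T i) (6 * n + 20) (wtape a [])" by (elim exE)
  then have 1: "runs (wipe i) T (6 * n + 20) (T(i := wtape a []))"
    unfolding on_tape_def by simp
  have "\<forall>j \<in> set is. \<exists>l r. blob n ((T(i := wtape a [])) j) l r"
    using Cons.prems by (metis distinct.simps(2) fun_upd_other list.set_intros(2))
  have "distinct is" "i \<notin> set is" using Cons.prems(1) by simp_all
  from Cons.IH[OF this(1) \<open>\<forall>j \<in> set is. _\<close>] obtain T' where
    T': "runs (wipes is) (T(i := wtape a [])) (length is * (6 * n + 20)) T'"
      "\<forall>i \<in> set is. \<exists>a. T' i = wtape a []" "\<forall>j. j \<notin> set is \<longrightarrow> T' j = (T(i := wtape a [])) j"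
    by (elim exE conjE) (rule that)
  have "T' i = wtape a []" using T'(3) Cons.prems(1) by simp
  then have "\<forall>j \<in> set (i # is). \<exists>a. T' j = wtape a []" using T'(2) by auto
  moreover have "\<forall>j. j \<notin> set (i # is) \<longrightarrow> T' j = T j" using T'(3) by simp
  moreover have "runs (wipes (i # is)) T (length (i # is) * (6 * n + 20)) T'"
    unfolding wipes.simps by (rule runs_mono[OF runs_seq[OF 1 T'(1)]]) simp
  ultimately show ?case by (intro exI[of _ T'] conjI)
qed

lemma pseq_assoc: "(p ;; q) ;; r = p ;; (q ;; r)"
  by (simp add: pseq_def relocate_def comp_def add.assoc add.commute[of "length q"])

text \<open>
  The output is on the last tape of the machine, the input register is the first. The result
  is poured twice, via the flag register, because pouring reverses a word and because the
  two tapes coincide for a machine with one tape.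
\<close>

definition call :: "tm \<Rightarrow> nat \<Rightarrow> nat \<Rightarrow> prog" where
  "call M V b = (let o1 = b + tm_tapes M - 1; flag = b + tm_tapes M in
     simulate M V b ;; wipes [b..<o1] ;;
     pif flag nonblank (pop flag ;; trim o1 V ;; push o1 True) (wipe o1) ;;
     pour o1 flag ;; pour flag b)"

lemma ok_call:
  assumes "turing_machine M"
  shows "ok (b + tm_tapes M + 1) (call M V b)"
proof -
  have "tm_tapes M \<ge> 1" using assms by (simp add: turing_machine_def)
  then show ?thesis unfolding call_def Let_def
    by (intro ok_seq ok_simulate[OF assms] ok_if ok_wipes ok_wipe ok_push_pop ok_trim ok_pour) auto
qed

text \<open>
  Let \<open>N\<close> be the bound on the visited blocks. Wiping a tape takes at most \<open>6 * N + 20\<close>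
  steps. Eight more terms of this size absorb the simulation, trimming, pushing and the two
  pourings.
\<close>

lemma reg_call:
  assumes M: "turing_machine M" and V: "V \<notin> tm_symbols M"
    and run: "case (step M ^^ j) (init M x) of (q, ts) \<Rightarrow>
           (case r of None \<Rightarrow> q = tm_reject M
            | Some y \<Rightarrow> q = tm_accept M \<and> fst (last ts) = contents y)"
    and \<sigma>: "\<sigma> b = x" "\<forall>i. b < i \<and> i < b + tm_tapes M + 1 \<longrightarrow> \<sigma> i = []"
  shows "reg (call M V b) \<sigma> ((tm_tapes M + 8) * (6 * (length x + j) + 20)) (\<sigma>(b := result r)) \<and>
    (\<forall>y. r = Some y \<longrightarrow> length y \<le> length x + j)"
proof -
  let ?k = "tm_tapes M" and ?S = "tm_symbols M" and ?N = "length x + j"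
  let ?o = "b + ?k - 1" and ?f = "b + ?k"
  let ?branch = "pif ?f nonblank (pop ?f ;; trim ?o V ;; push ?o True) (wipe ?o)"
  have k: "?k \<ge> 1" and S: "{0, 1, 2} \<subseteq> ?S" and ne: "tm_accept M \<noteq> tm_reject M"
    using M by (auto simp: turing_machine_def)
  obtain q ts where qts: "(step M ^^ j) (init M x) = (q, ts)" by force
  have qf: "q = tm_accept M \<or> q = tm_reject M" using run qts by (cases r) auto
  have acc: "q = tm_accept M \<longleftrightarrow> r \<noteq> None" using run qts ne by (cases r) auto
  let ?\<sigma> = "\<sigma>(b := [], ?o := result r)"
  have main: "(\<exists>T'. runs (simulate M V b ;; wipes [b..<?o] ;;
      ?branch) T
        ((j + 2) + (?k * (6 * ?N + 20) + (18 * ?N + 65))) T' \<and> represents ?\<sigma> T') \<and>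
      (\<forall>y. r = Some y \<longrightarrow> length y \<le> ?N)" if T: "represents \<sigma> T" for T
  proof -
    have "simtape ?S V (length x) (snd (init M x) ! m) (T (b + m))" if m: "m < ?k" for m
    proof (cases m)
      case 0
      obtain a where "T b = wtape a x" using T \<sigma>(1) unfolding represents_def by auto
      then show ?thesis using simtape_wtape[OF S V, of x a] 0 by (simp add: init_def)
    next
      case (Suc m')
      have "\<sigma> (b + m) = []" using \<sigma>(2) m Suc by simp
      then obtain a where "T (b + m) = wtape a []" using T unfolding represents_def by metis
      moreover have "snd (init M x) ! m = (contents [], 0)" using m Suc by (simp add: init_def)
      ultimately show ?thesis
        using simtape_mono[OF simtape_wtape[OF S V, of "[]" a], of "length x"] by simp
    qed
    then have sim: "\<forall>m<?k. simtape ?S V (length x) (snd (init M x) ! m) (T (b + m))" by simp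
    obtain T1 where T1: "runs (simulate M V b) T (j + 2) T1" "length ts = ?k"
      "\<forall>m<?k. simtape ?S V ?N (ts ! m) (T1 (b + m))"
      "T1 ?f = (if q = tm_accept M then act (letter True, MStay) (T ?f) else T ?f)"
      "\<forall>i. i < b \<or> ?f < i \<longrightarrow> T1 i = T i"
      using runs_simulate[OF M V sim qts qf] by (elim exE conjE) (rule that)
    have blobs: "\<exists>l r. blob ?N (T1 i) l r" if "b \<le> i" "i < b + ?k" for i
    proof -
      have "simtape ?S V ?N (ts ! (i - b)) (T1 i)" using T1(3)[rule_format, of "i - b"] that by simp
      then show ?thesis unfolding simtape_def by (elim conjE)
    qed
    have "\<forall>i \<in> set [b..<?o]. \<exists>l r. blob ?N (T1 i) l r"
    proof
      fix i assume "i \<in> set [b..<?o]"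
      then have "b \<le> i" "i < b + ?k" using k by auto
      then show "\<exists>l r. blob ?N (T1 i) l r" by (rule blobs)
    qed
    from runs_wipes[OF distinct_upt this]
    obtain T2 where T2: "runs (wipes [b..<?o]) T1 (length [b..<?o] * (6 * ?N + 20)) T2"
      "\<forall>i \<in> set [b..<?o]. \<exists>a. T2 i = wtape a []" "\<forall>i. i \<notin> set [b..<?o] \<longrightarrow> T2 i = T1 i"
      by (elim exE conjE) (rule that)
    have T2': "runs (wipes [b..<?o]) T1 (?k * (6 * ?N + 20)) T2"
      by (rule runs_mono[OF T2(1)]) (intro mult_right_mono, simp_all)
    have "\<sigma> ?f = []" using \<sigma>(2) k by simp
    then obtain a where a: "T ?f = wtape a []" using T unfolding represents_def by metis
    have T2f: "T2 ?f = (if q = tm_accept M then act (letter True, MStay) (wtape a []) else wtape a [])"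
      using T2(3)[rule_format, of ?f] T1(4) a by simp
    have T2o: "T2 ?o = T1 ?o" using T2(3)[rule_format, of ?o] by simp
    have rest: "\<exists>a. T2 i = wtape a (\<sigma> i)" if "i < b \<or> ?f < i" for i
    proof -
      have "T2 i = T i" using that T2(3)[rule_format, of i] T1(5)[rule_format, of i] by auto
      then show ?thesis using T unfolding represents_def by simp
    qed
    have mid: "\<exists>a. T2 i = wtape a []" if "b \<le> i" "i < ?o" for i using T2(2) that by simp
    have represents: "represents (\<sigma>(b := [], ?o := w)) T'"
      if T': "\<exists>a. T' ?f = wtape a []" "\<exists>a. T' ?o = wtape a w" "\<forall>i. i \<noteq> ?f \<longrightarrow> i \<noteq> ?o \<longrightarrow> T' i = T2 i"
      for T' w
      unfolding represents_def
    proof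
      fix i
      have fo: "?f \<noteq> ?o" "b \<noteq> ?f" using k by simp_all
      consider "i = ?f" | "i = ?o" | "b \<le> i" "i < ?o" | "i < b \<or> ?f < i" by linarith
      then show "\<exists>a. T' i = wtape a ((\<sigma>(b := [], ?o := w)) i)"
      proof cases
        case 1
        then show ?thesis using T'(1) fo \<open>\<sigma> ?f = []\<close> by auto
      next
        case 2
        then show ?thesis using T'(2) by simp
      next
        case 3
        then have "(\<sigma>(b := [], ?o := w)) i = []" using \<sigma>(2) by auto
        moreover have "T' i = T2 i" using T'(3) 3 by simp
        ultimately show ?thesis using mid[OF 3] by simp
      next
        case 4
        then have "(\<sigma>(b := [], ?o := w)) i = \<sigma> i" using k by auto
        moreover have "T' i = T2 i" using T'(3) 4 k by auto
        ultimately show ?thesis using rest[OF 4] by simp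
      qed
    qed
    show ?thesis
    proof (cases r)
      case None
      then have q: "q \<noteq> tm_accept M" using acc by simp
      have "b \<le> ?o" "?o < b + ?k" using k by simp_all
      from blobs[OF this] obtain l r' where "blob ?N (T2 ?o) l r'" unfolding T2o by (elim exE)
      from on_tape_wipe[OF this, of ?o] obtain c where
        "on_tape ?o (wipe ?o) (T2 ?o) (6 * ?N + 20) (wtape c [])" by (elim exE)
      then have "runs (wipe ?o) T2 (6 * ?N + 20) (T2(?o := wtape c []))"
        unfolding on_tape_def by simp
      then have "runs (wipe ?o) T2 (18 * ?N + 63) (T2(?o := wtape c []))" by (rule runs_mono) simp
      then have "runs ?branch T2
          (18 * ?N + 63 + 2) (T2(?o := wtape c []))"
        by (rule runs_if_False[rotated]) (simp add: T2f q)
      then have "runs ?branch T2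
          (18 * ?N + 65) (T2(?o := wtape c []))" by (rule runs_mono) simp
      from runs_seq[OF T1(1) runs_seq[OF T2' this]]
      have R: "runs (simulate M V b ;; wipes [b..<?o] ;;
          ?branch) T
          ((j + 2) + (?k * (6 * ?N + 20) + (18 * ?N + 65))) (T2(?o := wtape c []))" .
      have "represents (\<sigma>(b := [], ?o := [])) (T2(?o := wtape c []))"
      proof (rule represents)
        show "\<exists>a. (T2(?o := wtape c [])) ?f = wtape a []" using T2f q k by auto
      qed auto
      then have "represents ?\<sigma> (T2(?o := wtape c []))" by (simp only: None result_simps)
      then show ?thesis using R None by (intro conjI exI[of _ "T2(?o := wtape c [])"]) simp_all
    next
      case (Some y)
      then have q: "q = tm_accept M" using acc by simp
      have y: "fst (last ts) = contents y" using run qts Some by simp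
      have "ts \<noteq> []" using T1(2) k by auto
      then have "ts ! (?k - 1) = last ts" using T1(2) by (simp add: last_conv_nth)
      moreover have "last ts = (contents y, snd (last ts))" using y by (simp add: prod_eq_iff)
      ultimately have so: "simtape ?S V ?N (contents y, snd (last ts)) (T2 ?o)"
        using T1(3)[rule_format, of "?k - 1"] k T2o by simp
      from on_tape_trim[OF this S V, of ?o] obtain c where len: "length y \<le> ?N"
        and c: "on_tape ?o (trim ?o V) (T2 ?o) (18 * ?N + 60) (wtape c y)" by (elim exE conjE)
      have f: "T2 ?f = wtape (a + 0) [True]"
        using T2f q by (auto simp: wtape_def contents_Cons fun_eq_iff)
      let ?T3 = "T2(?f := wtape (a + 1) [])" let ?T4 = "?T3(?o := wtape c y)"
      have "runs (pop ?f) T2 1 (T2(?f := act (0, MRight) (T2 ?f)))"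
        unfolding pop_def by (rule runs_pwrite)
      then have R3: "runs (pop ?f) T2 1 ?T3" by (simp only: f pop_wtape list.sel) simp
      have ofne: "?o \<noteq> ?f" using k by linarith
      then have "?T3 ?o = T2 ?o" by (rule fun_upd_other)
      then have R4: "runs (trim ?o V) ?T3 (18 * ?N + 60) ?T4"
        using c unfolding on_tape_def by simp
      have "represents (\<sigma>(b := [], ?o := y)) ?T4"
      proof (rule represents)
        have "?T4 ?f = wtape (a + 1) []" by (simp only: fun_upd_other[OF ofne[symmetric]] fun_upd_same)
        then show "\<exists>a. ?T4 ?f = wtape a []" by (rule exI)
      qed auto
      then obtain T5 where T5: "runs (push ?o True) ?T4 2 T5"
        "represents ((\<sigma>(b := [], ?o := y))(?o := True # (\<sigma>(b := [], ?o := y)) ?o)) T5"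
        using reg_push[of ?o True "\<sigma>(b := [], ?o := y)"] unfolding reg_def by (elim allE impE exE conjE)
      have "runs (pop ?f ;; trim ?o V ;; push ?o True) T2 (1 + (18 * ?N + 60 + 2)) T5"
        by (intro runs_seq[OF R3] runs_seq[OF R4] T5(1))
      then have "runs ?branch T2
          (1 + (18 * ?N + 60 + 2) + 2) T5"
        by (rule runs_if_True[rotated]) (simp add: f)
      then have "runs ?branch T2
          (18 * ?N + 65) T5" by (rule runs_mono) simp
      from runs_seq[OF T1(1) runs_seq[OF T2' this]]
      have R: "runs (simulate M V b ;; wipes [b..<?o] ;;
          ?branch) T
          ((j + 2) + (?k * (6 * ?N + 20) + (18 * ?N + 65))) T5" .
      have "represents ?\<sigma> T5" using T5(2) by (simp add: Some)
      then show ?thesis using R Some len by (intro conjI exI[of _ T5]) simp_all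
    qed
  qed
  let ?p = "simulate M V b ;; wipes [b..<?o] ;;
      ?branch"
  let ?n = "(j + 2) + (?k * (6 * ?N + 20) + (18 * ?N + 65))"
  have "represents \<sigma> (\<lambda>i. wtape 0 (\<sigma> i))" unfolding represents_def by (intro allI exI) (rule refl)
  from main[OF this] have len: "\<forall>y. r = Some y \<longrightarrow> length y \<le> ?N" by (elim conjE)
  then have lr: "length (result r) \<le> ?N + 1" by (cases r) simp_all
  have fo: "?o \<noteq> ?f" "?f \<noteq> b" using k by simp_all
  have *: "reg (pour ?f b) (?\<sigma>(?o := [], ?f := rev (result r))) (7 * length (result r) + 1)
    (?\<sigma>(?o := [], ?f := [], b := result r))"
    by (rule reg_weaken[OF reg_pour[OF fo(2)]]) (use fo k in \<open>auto simp: fun_eq_iff\<close>)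
  have "\<sigma> ?f = []" using \<sigma>(2) k by simp
  then have p1: "reg (pour ?o ?f) ?\<sigma> (7 * length (result r) + 1) (?\<sigma>(?o := [], ?f := rev (result r)))"
    by (intro reg_weaken[OF reg_pour[OF fo(1)]]) (use fo k in \<open>auto simp: fun_eq_iff\<close>)
  have o0: "\<sigma> ?o = []" if "?o \<noteq> b"
  proof -
    have "b < ?o \<and> ?o < b + ?k + 1" using k that by linarith
    then show ?thesis using \<sigma>(2) by blast
  qed
  have fin: "?\<sigma>(?o := [], ?f := [], b := result r) = \<sigma>(b := result r)"
    using o0 \<open>\<sigma> ?f = []\<close> by (auto simp: fun_eq_iff)
  have "reg (call M V b) \<sigma> (?n + ((7 * length (result r) + 1) + (7 * length (result r) + 1))) (\<sigma>(b := result r))"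
    unfolding reg_def
  proof (intro allI impI)
    fix T assume T: "represents \<sigma> T"
    from main[OF T] obtain T' where T': "runs ?p T ?n T'" "represents ?\<sigma> T'" by (elim conjE exE)
    from reg_seq[OF p1 *] obtain T'' where
      T'': "runs (pour ?o ?f ;; pour ?f b) T' ((7 * length (result r) + 1) + (7 * length (result r) + 1)) T''"
      "represents (\<sigma>(b := result r)) T''"
      using T'(2) unfolding reg_def fin by (elim allE impE exE conjE)
    have "call M V b = ?p ;; (pour ?o ?f ;; pour ?f b)"
      unfolding call_def Let_def by (simp only: pseq_assoc)
    then show "\<exists>T'. runs (call M V b) T (?n + ((7 * length (result r) + 1) + (7 * length (result r) + 1))) T'
        \<and> represents (\<sigma>(b := result r)) T'"
      using runs_seq[OF T'(1) T''(1)] T''(2) by (intro exI[of _ T''] conjI) simp_all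
  qed
  moreover have "?n + ((7 * length (result r) + 1) + (7 * length (result r) + 1))
      \<le> (?k + 8) * (6 * ?N + 20)"
    using lr by (simp add: algebra_simps)
  ultimately have "reg (call M V b) \<sigma> ((?k + 8) * (6 * ?N + 20)) (\<sigma>(b := result r))"
    by (rule reg_weaken) (rule refl)
  then show ?thesis using len by (rule conjI)
qed

lemma polyb_poly: "polyb (poly p)"
  unfolding polyb_def by blast

lemma polyb_const: "polyb (\<lambda>_. c)"
  unfolding polyb_def by (intro exI[of _ "[:c:]"]) simp

lemma polyb_id: "polyb (\<lambda>n. n)"
  unfolding polyb_def by (intro exI[of _ "[:0, 1:]"]) simp

lemma polyb_add: "polyb s \<Longrightarrow> polyb t \<Longrightarrow> polyb (\<lambda>n. s n + t n)"
  unfolding polyb_def by (elim exE, rule_tac x = "p + pa" in exI) (simp add: add_mono)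

lemma polyb_mult: "polyb s \<Longrightarrow> polyb t \<Longrightarrow> polyb (\<lambda>n. s n * t n)"
  unfolding polyb_def by (elim exE, rule_tac x = "p * pa" in exI) (simp add: mult_mono)

lemma polyb_comp:
  assumes "polyb s" "polyb t" shows "polyb (\<lambda>n. s (t n))"
proof -
  obtain p where p: "\<And>n. s n \<le> poly p n" using assms(1) unfolding polyb_def by blast
  obtain q where q: "\<And>n. t n \<le> poly q n" using assms(2) unfolding polyb_def by blast
  have "s (t n) \<le> poly (pcompose p q) n" for n
    using p[of "t n"] poly_mono_nat[OF q[of n], of p] by (simp add: poly_pcompose)
  then show ?thesis unfolding polyb_def by blast
qed

lemmas polyb_intros = polyb_add polyb_mult polyb_id polyb_const polyb_poly

text \<open>
  The subprogram works in the registers from \<open>b\<close> to \<open>b + K - 1\<close> and expects all but the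
  first of them to be empty; it leaves them empty again, so that it can be called
  repeatedly.
\<close>

definition callable :: "pfun \<Rightarrow> nat \<Rightarrow> (nat \<Rightarrow> nat) \<Rightarrow> bool" where
  "callable f K t \<longleftrightarrow> polyb t \<and> mono t \<and> (\<forall>x. length (result (f x)) \<le> t (length x)) \<and>
     (\<forall>b. \<exists>p. ok (b + K) p \<and> (\<forall>\<sigma>. (\<forall>i. b < i \<and> i < b + K \<longrightarrow> \<sigma> i = []) \<longrightarrow>
        reg p \<sigma> (t (length (\<sigma> b))) (\<sigma>(b := result (f (\<sigma> b))))))"

lemma polytime_callable:
  assumes "polytime_computable f"
  shows "\<exists>K t. callable f K t"
proof -
  obtain M P where M: "turing_machine M" and P: "\<And>x. case (step M ^^ poly P (length x)) (init M x) of (q, ts) \<Rightarrow>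
           (case f x of
              None \<Rightarrow> q = tm_reject M
            | Some y \<Rightarrow> q = tm_accept M \<and> fst (last ts) = contents y)"
    using assms unfolding polytime_computable_def by blast
  have "finite (tm_symbols M)" using M by (simp add: turing_machine_def)
  then obtain V where V: "V \<notin> tm_symbols M" using ex_new_if_finite[OF infinite_UNIV_nat] by blast
  let ?K = "tm_tapes M + 1"
  let ?t = "\<lambda>n. (tm_tapes M + 8) * (6 * (n + poly P n) + 20)"
  have call: "reg (call M V b) \<sigma> (?t (length (\<sigma> b))) (\<sigma>(b := result (f (\<sigma> b)))) \<and>
      (\<forall>y. f (\<sigma> b) = Some y \<longrightarrow> length y \<le> length (\<sigma> b) + poly P (length (\<sigma> b)))"
    if "\<forall>i. b < i \<and> i < b + ?K \<longrightarrow> \<sigma> i = []" for b \<sigma>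
    by (rule reg_call[OF M V P refl]) (use that in \<open>simp add: add.assoc\<close>)
  have "callable f ?K ?t"
    unfolding callable_def
  proof (intro conjI allI)
    show "polyb ?t" by (intro polyb_intros)
    show "mono ?t" by (intro monoI mult_le_mono add_le_mono poly_mono_nat order_refl)
    show "length (result (f x)) \<le> ?t (length x)" for x
    proof (cases "f x")
      case (Some y)
      let ?n = "length x + poly P (length x)"
      have "length y \<le> ?n"
        using call[of 0 "(\<lambda>_. [])(0 := x)"] Some by simp
      then have "length (result (f x)) \<le> 1 * (6 * ?n + 20)" using Some by simp
      also have "\<dots> \<le> ?t (length x)" by (intro mult_le_mono) simp_all
      finally show ?thesis .
    qed simp
    show "\<exists>p. ok (b + ?K) p \<and> (\<forall>\<sigma>. (\<forall>i. b < i \<and> i < b + ?K \<longrightarrow> \<sigma> i = []) \<longrightarrow>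
        reg p \<sigma> (?t (length (\<sigma> b))) (\<sigma>(b := result (f (\<sigma> b)))))" for b
    proof (intro exI[of _ "call M V b"] conjI allI impI)
      show "ok (b + ?K) (call M V b)" using ok_call[OF M, of b V] by (simp add: add.assoc)
    qed (use call in blast)
  qed
  then show ?thesis by (intro exI)
qed

lemma callableE:
  assumes "callable f K t"
  obtains p where "ok (b + K) p"
    "\<And>\<sigma>. (\<forall>i > b. \<sigma> i = []) \<Longrightarrow> reg p \<sigma> (t (length (\<sigma> b))) (\<sigma>(b := result (f (\<sigma> b))))"
proof -
  obtain p where "ok (b + K) p" "\<forall>\<sigma>. (\<forall>i. b < i \<and> i < b + K \<longrightarrow> \<sigma> i = []) \<longrightarrow>
        reg p \<sigma> (t (length (\<sigma> b))) (\<sigma>(b := result (f (\<sigma> b))))"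
    using assms unfolding callable_def by (elim conjE allE[of _ b] exE)
  then show ?thesis by (intro that[of p]) blast+
qed

lemma callable_polyb: "callable f K t \<Longrightarrow> polyb t"
  and callable_mono: "callable f K t \<Longrightarrow> m \<le> n \<Longrightarrow> t m \<le> t n"
  and callable_length: "callable f K t \<Longrightarrow> length (result (f x)) \<le> t (length x)"
  unfolding callable_def mono_def by blast+

text \<open>
  Six registers suffice for all programs below; the others are only used, and emptied again,
  by called subprograms.
\<close>

definition st :: "word \<Rightarrow> word \<Rightarrow> word \<Rightarrow> word \<Rightarrow> word \<Rightarrow> word \<Rightarrow> regs" where
  "st a b c d e f = (\<lambda>_. [])(0 := a, 1 := b, 2 := c, 3 := d, 4 := e, 5 := f)"

lemma st_get [simp]:
  "st a b c d e f 0 = a" "st a b c d e f (Suc 0) = b" "st a b c d e f 2 = c"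
  "st a b c d e f 3 = d" "st a b c d e f 4 = e" "st a b c d e f 5 = f"
  by (simp_all add: st_def)

lemma st_put [simp]:
  "(st a b c d e f)(0 := x) = st x b c d e f" "(st a b c d e f)(Suc 0 := x) = st a x c d e f"
  "(st a b c d e f)(2 := x) = st a b x d e f" "(st a b c d e f)(3 := x) = st a b c x e f"
  "(st a b c d e f)(4 := x) = st a b c d x f" "(st a b c d e f)(5 := x) = st a b c d e x"
  by (auto simp: st_def fun_eq_iff)

lemma st_init: "(\<lambda>_. [])(0 := x) = st x [] [] [] [] []"
  by (auto simp: st_def fun_eq_iff)

lemma st_clear_above:
  "\<forall>i>0. st a [] [] [] [] [] i = []" "\<forall>i>Suc 0. st a b [] [] [] [] i = []"
  "\<forall>i>2. st a b c [] [] [] i = []" "\<forall>i>3. st a b c d [] [] i = []"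
  "\<forall>i>4. st a b c d e [] i = []" "\<forall>i>5. st a b c d e f i = []"
  by (auto simp: st_def)

lemma polytime_computable_st:
  assumes "ok K p" "polyb t"
    and runs: "\<And>x. \<exists>b c d e g. reg p (st x [] [] [] [] []) (t (length x)) (st (result (f x)) b c d e g)"
    and len: "\<And>x. length (result (f x)) \<le> t (length x)"
  shows "polytime_computable f"
proof (rule polytime_computableI[OF assms(1,2)])
  fix x
  obtain b c d e g where
    "reg p (st x [] [] [] [] []) (t (length x)) (st (result (f x)) b c d e g)"
    using runs[of x] by (elim exE)
  then show "\<exists>\<sigma>. reg p ((\<lambda>_. [])(0 := x)) (t (length x)) \<sigma> \<and> \<sigma> 0 = result (f x) \<and>
      length (\<sigma> 0) \<le> t (length x)"
    unfolding st_init using len[of x]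
    by (intro exI[of _ "st (result (f x)) b c d e g"]) simp
qed

section \<open>Composition\<close>

lemma polytime_comp:
  assumes "polytime_computable f" "polytime_computable g"
  shows "polytime_computable (f \<circ>\<^sub>m g)"
proof -
  obtain K s L t where f: "callable f K s" and g: "callable g L t"
    using assms[THEN polytime_callable] by (elim exE)
  obtain p where p: "ok (0 + K) p"
    "\<And>\<sigma>. (\<forall>i>0. \<sigma> i = []) \<Longrightarrow> reg p \<sigma> (s (length (\<sigma> 0))) (\<sigma>(0 := result (f (\<sigma> 0))))"
    using callableE[OF f, of 0] by metis
  obtain q where q: "ok (0 + L) q"
    "\<And>\<sigma>. (\<forall>i>0. \<sigma> i = []) \<Longrightarrow> reg q \<sigma> (t (length (\<sigma> 0))) (\<sigma>(0 := result (g (\<sigma> 0))))"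
    using callableE[OF g, of 0] by metis
  let ?r = "q ;; pif 0 nonblank (pop 0 ;; p) []"
  let ?t = "\<lambda>n. t n + (1 + s (t n) + 2)"
  have len: "length (result ((f \<circ>\<^sub>m g) x)) \<le> s (t (length x))" for x
  proof (cases "g x")
    case (Some z)
    have "length z \<le> t (length x)" using callable_length[OF g, of x] Some by simp
    then show ?thesis
      using callable_length[OF f, of z] callable_mono[OF f, of "length z" "t (length x)"] Some by simp
  qed simp
  show ?thesis
  proof (rule polytime_computable_st)
    show "ok (K + L + 1) ?r"
      using p(1) q(1) by (intro ok_seq ok_if ok_push_pop ok_skip) (auto intro: ok_mono)
    have "polyb (\<lambda>n. s (t n))"
      by (rule polyb_comp[OF callable_polyb[OF f] callable_polyb[OF g]])
    then show "polyb ?t" by (intro polyb_intros callable_polyb[OF g])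
    fix x
    show "length (result ((f \<circ>\<^sub>m g) x)) \<le> ?t (length x)" using len[of x] by simp
    have 1: "reg q (st x [] [] [] [] []) (t (length x)) (st (result (g x)) [] [] [] [] [])"
      using q(2)[OF st_clear_above(1), of x] by simp
    have 2: "reg (pif 0 nonblank (pop 0 ;; p) []) (st (result (g x)) [] [] [] [] [])
        (1 + s (t (length x)) + 2) (st (result ((f \<circ>\<^sub>m g) x)) [] [] [] [] [])"
    proof (cases "g x")
      case None
      show ?thesis by (rule reg_if_False) (simp_all add: None reg_skip)
    next
      case (Some z)
      have "length z \<le> t (length x)" using callable_length[OF g, of x] Some by simp
      then have le: "s (length z) \<le> s (t (length x))" by (rule callable_mono[OF f])
      have a: "reg (pop 0) (st (True # z) [] [] [] [] []) 1 (st z [] [] [] [] [])"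
        by (rule reg_weaken[OF reg_pop]) simp_all
      have b: "reg p (st z [] [] [] [] []) (s (t (length x))) (st (result (f z)) [] [] [] [] [])"
        by (rule reg_weaken[OF p(2)[OF st_clear_above(1)]]) (simp_all add: le)
      show ?thesis by (rule reg_if_True) (use reg_seq[OF a b] Some in simp_all)
    qed
    show "\<exists>b c d e h. reg ?r (st x [] [] [] [] []) (?t (length x)) (st (result ((f \<circ>\<^sub>m g) x)) b c d e h)"
      by (intro exI) (rule reg_seq[OF 1 2])
  qed
qed

section \<open>A self-delimiting code\<close>

fun encode_bits :: "word \<Rightarrow> word" where
  "encode_bits [] = []"
| "encode_bits (b # x) = False # b # encode_bits x"

text \<open>
  Every letter is announced by \<open>False\<close> and the end by \<open>True\<close>. So a reader knows where a code
  ends, and no code is a proper prefix of another one.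
\<close>

definition encode :: "word \<Rightarrow> word" where
  "encode x = encode_bits x @ [True]"

fun decode :: "word \<Rightarrow> (word \<times> word) option" where
  "decode [] = None"
| "decode (True # w) = Some ([], w)"
| "decode [False] = None"
| "decode (False # b # w) = map_option (apfst ((#) b)) (decode w)"

lemma encode_bits_append: "encode_bits (x @ y) = encode_bits x @ encode_bits y"
  by (induction x) simp_all

lemma length_encode_bits: "length (encode_bits x) = 2 * length x"
  by (induction x) simp_all

lemma length_encode: "length (encode x) = 2 * length x + 1"
  by (simp add: encode_def length_encode_bits)

lemma decode_encode: "decode (encode x @ w) = Some (x, w)"
  by (induction x) (simp_all add: encode_def)

lemma decode_SomeD: "decode z = Some (x, w) \<Longrightarrow> z = encode x @ w"
  by (induction z arbitrary: x rule: decode.induct) (auto simp: encode_def)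

definition encode_loop :: "nat \<Rightarrow> nat \<Rightarrow> prog" where
  "encode_loop i j = pwhile i nonblank (push_top i j ;; pop i ;; push j False)"

lemma ok_encode_loop [simp]: "i < K \<Longrightarrow> j < K \<Longrightarrow> ok K (encode_loop i j)"
  by (simp add: encode_loop_def)

lemma reg_encode_loop:
  assumes "i \<noteq> j"
  shows "reg (encode_loop i j) \<sigma> (9 * length (\<sigma> i) + 1)
    (\<sigma>(i := [], j := encode_bits (rev (\<sigma> i)) @ \<sigma> j))"
proof -
  have "reg (encode_loop i j) \<sigma> ((7 + 2) * length (\<sigma> i) + 1)
    (\<sigma>(i := [], j := encode_bits (rev (\<sigma> i)) @ \<sigma> j))"
    unfolding encode_loop_def
  proof (rule reg_foreach[where Q = "\<lambda>_. True" and
        \<sigma>' = "\<lambda>\<sigma>. \<sigma>(j := False # hd (\<sigma> i) # \<sigma> j, i := tl (\<sigma> i))" and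
        F = "\<lambda>\<sigma>. \<sigma>(i := [], j := encode_bits (rev (\<sigma> i)) @ \<sigma> j)"], goal_cases)
    case (1 b w \<sigma>)
    have "reg (push_top i j ;; pop i ;; push j False) \<sigma> 7 (\<sigma>(j := False # hd (\<sigma> i) # \<sigma> j, i := tl (\<sigma> i)))"
      by (rule reg_weaken[OF reg_seq[OF reg_push_top reg_seq[OF reg_pop reg_push]]])
        (use 1 assms in \<open>auto simp: fun_eq_iff\<close>)
    then show ?case using 1 assms by simp
  qed (use assms in \<open>auto simp: fun_eq_iff encode_bits_append\<close>)
  then show ?thesis by (rule reg_weaken) simp_all
qed

definition decode_loop :: "nat \<Rightarrow> nat \<Rightarrow> prog" where
  "decode_loop i j = pwhile i (is_letter False) (pop i ;; pif i nonblank (push_top i j) [] ;; pop i)"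

lemma ok_decode_loop [simp]: "i < K \<Longrightarrow> j < K \<Longrightarrow> ok K (decode_loop i j)"
  by (simp add: decode_loop_def)

text \<open>
  The content of register \<open>j\<close> is left open for words that cannot be decoded.
\<close>

lemma reg_decode_loop:
  assumes ij: "i \<noteq> j" and "\<sigma> i = z"
  shows "\<exists>w. reg (decode_loop i j) \<sigma> (10 * length z + 1)
      (\<sigma>(i := case decode z of None \<Rightarrow> [] | Some (x, v) \<Rightarrow> True # v, j := w)) \<and>
    (\<forall>x v. decode z = Some (x, v) \<longrightarrow> w = rev x @ \<sigma> j)"
  using assms(2)
proof (induction z arbitrary: \<sigma> rule: decode.induct)
  case 1
  have *: "reg (decode_loop i j) \<sigma> 1 \<sigma>"
    unfolding decode_loop_def by (rule reg_while_False) (simp add: 1)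
  have eq: "\<sigma> = \<sigma>(i := [], j := \<sigma> j)" using 1 by (auto simp: fun_eq_iff)
  have "reg (decode_loop i j) \<sigma> (10 * length [] + 1) (\<sigma>(i := [], j := \<sigma> j))"
    by (rule reg_weaken[OF * _ eq]) simp
  then show ?case unfolding decode.simps option.case prod.case
    by (intro exI[of _ "\<sigma> j"] conjI, assumption) simp
next
  case (2 w)
  have *: "reg (decode_loop i j) \<sigma> 1 \<sigma>"
    unfolding decode_loop_def by (rule reg_while_False) (simp add: 2)
  have eq: "\<sigma> = \<sigma>(i := True # w, j := \<sigma> j)" using 2 by (auto simp: fun_eq_iff)
  have "reg (decode_loop i j) \<sigma> (10 * length (True # w) + 1) (\<sigma>(i := True # w, j := \<sigma> j))"
    by (rule reg_weaken[OF * _ eq]) simp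
  then show ?case unfolding decode.simps option.case prod.case
    by (intro exI[of _ "\<sigma> j"] conjI, assumption) simp
next
  case 3
  let ?s = "\<sigma>(i := [])"
  have a: "reg (pop i) \<sigma> 1 ?s" by (rule reg_weaken[OF reg_pop]) (simp_all add: 3)
  have b: "reg (pif i nonblank (push_top i j) []) ?s (0 + 2) ?s"
    by (rule reg_if_False) (simp_all add: reg_skip)
  have c: "reg (pop i) ?s 1 ?s" by (rule reg_weaken[OF reg_pop]) simp_all
  have d: "reg (decode_loop i j) ?s 1 ?s"
    unfolding decode_loop_def by (rule reg_while_False) simp
  have *: "reg (decode_loop i j) \<sigma> ((1 + ((0 + 2) + 1)) + 1 + 2) ?s"
    unfolding decode_loop_def
    by (rule reg_while_True[OF _ reg_seq[OF a reg_seq[OF b c]] d[unfolded decode_loop_def]]) (simp add: 3)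
  have eq: "?s = \<sigma>(i := [], j := \<sigma> j)" using ij by (auto simp: fun_eq_iff)
  have "reg (decode_loop i j) \<sigma> (10 * length [False] + 1) (\<sigma>(i := [], j := \<sigma> j))"
    by (rule reg_weaken[OF * _ eq]) simp
  then show ?case unfolding decode.simps option.case prod.case
    by (intro exI[of _ "\<sigma> j"] conjI, assumption) simp
next
  case (4 b w)
  let ?s1 = "\<sigma>(i := b # w)" let ?s2 = "?s1(j := b # \<sigma> j)" let ?s3 = "\<sigma>(i := w, j := b # \<sigma> j)"
  have a: "reg (pop i) \<sigma> 1 ?s1" by (rule reg_weaken[OF reg_pop]) (simp_all add: 4)
  have b: "reg (pif i nonblank (push_top i j) []) ?s1 (4 + 2) ?s2"
    by (rule reg_if_True[OF _ reg_weaken[OF reg_push_top]]) (use ij in simp_all)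
  have c: "reg (pop i) ?s2 1 ?s3"
    by (rule reg_weaken[OF reg_pop]) (use ij in \<open>auto simp: fun_eq_iff\<close>)
  have w: "?s3 i = w" using ij by simp
  have j: "?s3 j = b # \<sigma> j" by simp
  from 4(1)[of ?s3, OF w] obtain v where
    d: "reg (decode_loop i j) ?s3 (10 * length w + 1)
      (?s3(i := case decode w of None \<Rightarrow> [] | Some (x, v) \<Rightarrow> True # v, j := v))"
    and v: "\<forall>x u. decode w = Some (x, u) \<longrightarrow> v = rev x @ b # \<sigma> j"
    unfolding j by (elim exE conjE)
  have *: "reg (decode_loop i j) \<sigma> ((1 + ((4 + 2) + 1)) + (10 * length w + 1) + 2)
      (?s3(i := case decode w of None \<Rightarrow> [] | Some (x, v) \<Rightarrow> True # v, j := v))"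
    unfolding decode_loop_def
    by (rule reg_while_True[OF _ reg_seq[OF a reg_seq[OF b c]] d[unfolded decode_loop_def]]) (simp add: 4(2))
  have e: "(case decode w of None \<Rightarrow> [] | Some (x, v) \<Rightarrow> True # v) =
      (case decode (False # b # w) of None \<Rightarrow> [] | Some (x, v) \<Rightarrow> True # v)"
    by (auto split: option.splits)
  have eq: "?s3(i := u, j := v) = \<sigma>(i := u, j := v)" for u by (auto simp: fun_eq_iff)
  have "reg (decode_loop i j) \<sigma> (10 * length (False # b # w) + 1)
      (\<sigma>(i := case decode (False # b # w) of None \<Rightarrow> [] | Some (x, v) \<Rightarrow> True # v, j := v))"
    unfolding e[symmetric] by (rule reg_weaken[OF * _ eq]) simp
  moreover have "\<forall>x u. decode (False # b # w) = Some (x, u) \<longrightarrow> v = rev x @ \<sigma> j"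
    using v by auto
  ultimately show ?case by (intro exI[of _ v] conjI)
qed

lemma decode_loop_st:
  "\<exists>w. reg (decode_loop 0 1) (st z [] [] [] [] []) (10 * length z + 1)
      (st (case decode z of None \<Rightarrow> [] | Some (x, v) \<Rightarrow> True # v) w [] [] [] []) \<and>
    (\<forall>x v. decode z = Some (x, v) \<longrightarrow> w = rev x)"
  using reg_decode_loop[of 0 1 "st z [] [] [] [] []" z] by simp

lemma polytime_decode: "polytime_computable (\<lambda>z. map_option fst (decode z))"
proof -
  let ?p = "decode_loop 0 1 ;; pif 0 nonblank (clear 0 ;; pour 1 0 ;; push 0 True) []"
  let ?t = "\<lambda>n. (10 * n + 1) + ((3 * n + 1) + ((7 * n + 1) + 2) + 2)"
  show ?thesis
  proof (rule polytime_computable_st)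
    show "ok 2 ?p" by simp
    show "polyb ?t" by (intro polyb_intros)
    fix z :: word
    obtain w where 1: "reg (decode_loop 0 1) (st z [] [] [] [] []) (10 * length z + 1)
        (st (case decode z of None \<Rightarrow> [] | Some (x, v) \<Rightarrow> True # v) w [] [] [] [])"
      and w: "\<forall>x v. decode z = Some (x, v) \<longrightarrow> w = rev x" using decode_loop_st by blast
    have len: "2 * length x + 1 + length v = length z" if "decode z = Some (x, v)" for x v
      using decode_SomeD[OF that] by (simp add: length_encode)
    show "length (result (map_option fst (decode z))) \<le> ?t (length z)"
    proof (cases "decode z")
      case (Some xv)
      then obtain x v where xv: "decode z = Some (x, v)" by (cases xv) simp
      show ?thesis using len[OF xv] by (simp add: xv)
    qed simp
    have "\<exists>w'. reg (pif 0 nonblank (clear 0 ;; pour 1 0 ;; push 0 True) [])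
        (st (case decode z of None \<Rightarrow> [] | Some (x, v) \<Rightarrow> True # v) w [] [] [] [])
        ((3 * length z + 1) + ((7 * length z + 1) + 2) + 2)
        (st (result (map_option fst (decode z))) w' [] [] [] [])"
    proof (cases "decode z")
      case None
      then have "reg (pif 0 nonblank (clear 0 ;; pour 1 0 ;; push 0 True) [])
        (st [] w [] [] [] []) ((3 * length z + 1) + ((7 * length z + 1) + 2) + 2) (st [] w [] [] [] [])"
        by (intro reg_if_False) (simp_all add: reg_skip)
      then show ?thesis by (intro exI[of _ w]) (simp add: None)
    next
      case (Some xv)
      then obtain x v where xv: "decode z = Some (x, v)" by (cases xv) simp
      have a: "reg (clear 0) (st (True # v) (rev x) [] [] [] []) (3 * length z + 1) (st [] (rev x) [] [] [] [])"
        by (rule reg_weaken[OF reg_clear]) (use len[OF xv] in simp_all)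
      have b: "reg (pour 1 0) (st [] (rev x) [] [] [] []) (7 * length z + 1) (st x [] [] [] [] [])"
        by (rule reg_weaken[OF reg_pour]) (use len[OF xv] in simp_all)
      have c: "reg (push 0 True) (st x [] [] [] [] []) 2 (st (True # x) [] [] [] [] [])"
        by (rule reg_weaken[OF reg_push]) simp_all
      have "reg (pif 0 nonblank (clear 0 ;; pour 1 0 ;; push 0 True) []) (st (True # v) (rev x) [] [] [] [])
          ((3 * length z + 1) + ((7 * length z + 1) + 2) + 2) (st (True # x) [] [] [] [] [])"
        by (rule reg_if_True[OF _ reg_seq[OF a reg_seq[OF b c]]]) simp
      then show ?thesis using w xv by (intro exI[of _ "[]"]) simp
    qed
    then obtain w' where 2: "reg (pif 0 nonblank (clear 0 ;; pour 1 0 ;; push 0 True) [])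
        (st (case decode z of None \<Rightarrow> [] | Some (x, v) \<Rightarrow> True # v) w [] [] [] [])
        ((3 * length z + 1) + ((7 * length z + 1) + 2) + 2)
        (st (result (map_option fst (decode z))) w' [] [] [] [])" by (elim exE)
    show "\<exists>b c d e h. reg ?p (st z [] [] [] [] []) (?t (length z))
        (st (result (map_option fst (decode z))) b c d e h)"
      by (intro exI) (rule reg_seq[OF 1 2])
  qed
qed

text \<open>
  In contrast to \<open>f\<close>, this morphism is defined on a prefix code whose images again form a
  prefix code: every preimage of \<open>encode y @ w\<close> is some \<open>encode u @ w\<close> with \<open>f u = y\<close>.
\<close>

definition encoded :: "pfun \<Rightarrow> pfun" where
  "encoded f = (\<lambda>z. case decode z of None \<Rightarrow> None | Some (x, w) \<Rightarrow> map_option (\<lambda>y. encode y @ w) (f x))"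

lemma polytime_encoded:
  assumes "polytime_computable f"
  shows "polytime_computable (encoded f)"
proof -
  obtain K s where f: "callable f K s" using polytime_callable[OF assms] by (elim exE)
  obtain p where p: "ok (2 + K) p"
    "\<And>\<sigma>. (\<forall>i>2. \<sigma> i = []) \<Longrightarrow> reg p \<sigma> (s (length (\<sigma> 2))) (\<sigma>(2 := result (f (\<sigma> 2))))"
    using callableE[OF f, of 2] by metis
  let ?yes = "pop 2 ;; pour 2 1 ;; push 0 True ;; encode_loop 1 0 ;; push 0 True"
  let ?body = "pop 0 ;; pour 1 2 ;; p ;; pif 2 nonblank ?yes (clear 0)"
  let ?p = "decode_loop 0 1 ;; pif 0 nonblank ?body []"
  let ?ty = "\<lambda>n. (1 + ((7 * s n + 1) + (2 + ((9 * s n + 1) + 2)))) + (3 * n + 1)"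
  let ?tb = "\<lambda>n. 1 + ((7 * n + 1) + (s n + (?ty n + 2)))"
  let ?t = "\<lambda>n. (10 * n + 1) + (?tb n + 2)"
  show ?thesis
  proof (rule polytime_computable_st)
    show "ok (3 + K) ?p" using ok_mono[OF p(1), of "3 + K"] by simp
    show "polyb ?t" by (intro polyb_intros callable_polyb[OF f])
    fix z :: word
    let ?n = "length z"
    obtain w where 1: "reg (decode_loop 0 1) (st z [] [] [] [] []) (10 * ?n + 1)
        (st (case decode z of None \<Rightarrow> [] | Some (x, v) \<Rightarrow> True # v) w [] [] [] [])"
      and w: "\<forall>x v. decode z = Some (x, v) \<longrightarrow> w = rev x" using decode_loop_st by blast
    have len: "2 * length x + 1 + length v = length z" if "decode z = Some (x, v)" for x v
      using decode_SomeD[OF that] by (simp add: length_encode)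
    have ylen: "length y < s ?n" if "decode z = Some (x, v)" "f x = Some y" for x v y
    proof -
      have "length x \<le> ?n" using len[OF that(1)] by simp
      then show ?thesis using callable_length[OF f, of x] callable_mono[OF f, of "length x" ?n] that(2) by simp
    qed
    show "length (result (encoded f z)) \<le> ?t ?n"
    proof (cases "decode z")
      case (Some xv)
      then obtain x v where xv: "decode z = Some (x, v)" by (cases xv) simp
      then show ?thesis using ylen[OF xv] len[OF xv]
        by (cases "f x") (simp_all add: encoded_def length_encode)
    qed (simp add: encoded_def)
    have "\<exists>w'. reg (pif 0 nonblank ?body [])
        (st (case decode z of None \<Rightarrow> [] | Some (x, v) \<Rightarrow> True # v) w [] [] [] [])
        (?tb ?n + 2) (st (result (encoded f z)) w' [] [] [] [])"
    proof (cases "decode z")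
      case None
      then have "reg (pif 0 nonblank ?body []) (st [] w [] [] [] []) (?tb ?n + 2) (st [] w [] [] [] [])"
        by (intro reg_if_False) (simp_all add: reg_skip)
      then show ?thesis by (intro exI[of _ w]) (simp add: None encoded_def)
    next
      case (Some xv)
      then obtain x v where xv: "decode z = Some (x, v)" by (cases xv) simp
      have xl: "length x \<le> ?n" "length v \<le> ?n" using len[OF xv] by simp_all
      have a: "reg (pop 0) (st (True # v) (rev x) [] [] [] []) 1 (st v (rev x) [] [] [] [])"
        by (rule reg_weaken[OF reg_pop]) simp_all
      have b: "reg (pour 1 2) (st v (rev x) [] [] [] []) (7 * ?n + 1) (st v [] x [] [] [])"
        by (rule reg_weaken[OF reg_pour]) (use xl in simp_all)
      have c: "reg p (st v [] x [] [] []) (s ?n) (st v [] (result (f x)) [] [] [])"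
        by (rule reg_weaken[OF p(2)[OF st_clear_above(3)]]) (use callable_mono[OF f xl(1)] in simp_all)
      have d: "reg (pif 2 nonblank ?yes (clear 0)) (st v [] (result (f x)) [] [] []) (?ty ?n + 2)
        (st (result (encoded f z)) [] [] [] [] [])"
      proof (cases "f x")
        case None
        have "reg (clear 0) (st v [] [] [] [] []) (?ty ?n) (st [] [] [] [] [] [])"
          by (rule reg_weaken[OF reg_clear]) (use xl in simp_all)
        then show ?thesis by (intro reg_if_False) (simp_all add: None xv encoded_def)
      next
        case (Some y)
        have yl: "length y \<le> s ?n" using ylen[OF xv Some] by simp
        have d1: "reg (pop 2) (st v [] (True # y) [] [] []) 1 (st v [] y [] [] [])"
          by (rule reg_weaken[OF reg_pop]) simp_all
        have d2: "reg (pour 2 1) (st v [] y [] [] []) (7 * s ?n + 1) (st v (rev y) [] [] [] [])"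
          by (rule reg_weaken[OF reg_pour]) (use yl in simp_all)
        have d3: "reg (push 0 True) (st v (rev y) [] [] [] []) 2 (st (True # v) (rev y) [] [] [] [])"
          by (rule reg_weaken[OF reg_push]) simp_all
        have d4: "reg (encode_loop 1 0) (st (True # v) (rev y) [] [] [] []) (9 * s ?n + 1)
            (st (encode y @ v) [] [] [] [] [])"
          by (rule reg_weaken[OF reg_encode_loop]) (use yl in \<open>simp_all add: encode_def\<close>)
        have d5: "reg (push 0 True) (st (encode y @ v) [] [] [] [] []) 2
            (st (result (encoded f z)) [] [] [] [] [])"
          by (rule reg_weaken[OF reg_push]) (simp_all add: encoded_def xv Some)
        have "reg ?yes (st v [] (True # y) [] [] []) (?ty ?n) (st (result (encoded f z)) [] [] [] [] [])"
          by (rule reg_weaken[OF reg_seq[OF d1 reg_seq[OF d2 reg_seq[OF d3 reg_seq[OF d4 d5]]]]]) simp_all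
        then show ?thesis by (intro reg_if_True) (simp_all add: Some)
      qed
      have "reg (pif 0 nonblank ?body []) (st (True # v) (rev x) [] [] [] []) (?tb ?n + 2)
          (st (result (encoded f z)) [] [] [] [] [])"
        by (rule reg_if_True[OF _ reg_seq[OF a reg_seq[OF b reg_seq[OF c d]]]]) simp
      then show ?thesis using w xv by (intro exI[of _ "[]"]) simp
    qed
    then obtain w' where 2: "reg (pif 0 nonblank ?body [])
        (st (case decode z of None \<Rightarrow> [] | Some (x, v) \<Rightarrow> True # v) w [] [] [] [])
        (?tb ?n + 2) (st (result (encoded f z)) w' [] [] [] [])" by (elim exE)
    show "\<exists>b c d e h. reg ?p (st z [] [] [] [] []) (?t ?n) (st (result (encoded f z)) b c d e h)"
      by (intro exI) (rule reg_seq[OF 1 2])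
  qed
qed

section \<open>Padding by a polynomial number of zeros\<close>

lemma zeros_append: "replicate m False @ replicate n False = replicate (m + n) False"
  by (simp add: replicate_add)

fun push_zeros :: "nat \<Rightarrow> nat \<Rightarrow> prog" where
  "push_zeros i 0 = []"
| "push_zeros i (Suc n) = push i False ;; push_zeros i n"

lemma ok_push_zeros [simp]: "i < K \<Longrightarrow> ok K (push_zeros i n)"
  by (induction n) simp_all

lemma reg_push_zeros: "reg (push_zeros i n) \<sigma> (2 * n) (\<sigma>(i := replicate n False @ \<sigma> i))"
proof (induction n arbitrary: \<sigma>)
  case 0
  show ?case by (simp add: reg_skip)
next
  case (Suc n)
  have "reg (push_zeros i (Suc n)) \<sigma> (2 + 2 * n)
      ((\<sigma>(i := False # \<sigma> i))(i := replicate n False @ (\<sigma>(i := False # \<sigma> i)) i))"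
    unfolding push_zeros.simps by (rule reg_seq[OF reg_push Suc])
  then show ?case by (rule reg_weaken) (auto simp: replicate_app_Cons_same fun_eq_iff)
qed

lemma reg_add_multiple:
  "reg (pwhile 5 nonblank (copy 4 3 2 ;; pop 5)) (st a b [] c (replicate m False) x)
    ((18 * m + 5) * length x + 1) (st a b [] (replicate (length x * m) False @ c) (replicate m False) [])"
proof (induction x arbitrary: c)
  case Nil
  have "reg (pwhile 5 nonblank (copy 4 3 2 ;; pop 5)) (st a b [] c (replicate m False) []) 1
      (st a b [] c (replicate m False) [])"
    by (rule reg_while_False) simp
  then show ?case by simp
next
  case (Cons d x)
  have 1: "reg (copy 4 3 2) (st a b [] c (replicate m False) (d # x)) (18 * m + 2)
      (st a b [] (replicate m False @ c) (replicate m False) (d # x))"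
    by (rule reg_weaken[OF reg_copy]) simp_all
  have 2: "reg (pop 5) (st a b [] (replicate m False @ c) (replicate m False) (d # x)) 1
      (st a b [] (replicate m False @ c) (replicate m False) x)"
    by (rule reg_weaken[OF reg_pop]) simp_all
  have "reg (pwhile 5 nonblank (copy 4 3 2 ;; pop 5)) (st a b [] c (replicate m False) (d # x))
     ((18 * m + 2 + 1) + ((18 * m + 5) * length x + 1) + 2)
     (st a b [] (replicate (length x * m) False @ replicate m False @ c) (replicate m False) [])"
    by (rule reg_while_True[OF _ reg_seq[OF 1 2] Cons]) simp
  then show ?case
  proof (rule reg_weaken)
    have "replicate (length x * m) False @ replicate m False @ c
        = replicate (length (d # x) * m) False @ c"
      by (simp add: append_assoc[symmetric] zeros_append add.commute del: append_assoc)
    then show "st a b [] (replicate (length x * m) False @ replicate m False @ c) (replicate m False) []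
        = st a b [] (replicate (length (d # x) * m) False @ c) (replicate m False) []"
      by (rule arg_cong)
  qed simp
qed

text \<open>
  A number is represented by a register with that many zeros. Evaluation follows the Horner
  scheme, whose step \<open>a + n * m\<close> appends \<open>n\<close> copies of the register with \<open>m\<close> zeros.
\<close>

lemma horner:
  "\<exists>p t. ok 6 p \<and> polyb t \<and> (\<forall>x. reg p (st [] x [] [] [] []) (t (length x))
     (st [] x [] (replicate (poly P (length x)) False) [] []))"
proof (induction P rule: pCons_induct)
  case 0
  have "reg [] (st [] x [] [] [] []) 0 (st [] x [] (replicate (poly 0 (length x)) False) [] [])" for x
    by (simp add: reg_skip)
  then show ?case using ok_skip polyb_const[of 0] by blast
next
  case (pCons a P)
  obtain p t where p: "ok 6 p" "polyb t" "\<forall>x. reg p (st [] x [] [] [] []) (t (length x))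
     (st [] x [] (replicate (poly P (length x)) False) [] [])"
    using pCons(2) by (elim exE conjE) (rule that)
  let ?q = "p ;; pour 3 4 ;; copy 1 5 2 ;; pwhile 5 nonblank (copy 4 3 2 ;; pop 5) ;; clear 4 ;; push_zeros 3 a"
  let ?t = "\<lambda>n. t n + ((7 * poly P n + 1) + ((18 * n + 2) + (((18 * poly P n + 5) * n + 1) +
     ((3 * poly P n + 1) + 2 * a))))"
  have "ok 6 ?q" using p(1) by simp
  moreover have "polyb ?t" by (intro polyb_intros p(2))
  moreover have "reg ?q (st [] x [] [] [] []) (?t (length x))
      (st [] x [] (replicate (poly (pCons a P) (length x)) False) [] [])" for x
  proof -
    let ?n = "length x" let ?m = "poly P ?n"
    have 2: "reg (pour 3 4) (st [] x [] (replicate ?m False) [] []) (7 * ?m + 1)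
        (st [] x [] [] (replicate ?m False) [])"
      by (rule reg_weaken[OF reg_pour]) simp_all
    have 3: "reg (copy 1 5 2) (st [] x [] [] (replicate ?m False) []) (18 * ?n + 2)
        (st [] x [] [] (replicate ?m False) x)"
      by (rule reg_weaken[OF reg_copy]) simp_all
    have 4: "reg (pwhile 5 nonblank (copy 4 3 2 ;; pop 5)) (st [] x [] [] (replicate ?m False) x)
        ((18 * ?m + 5) * ?n + 1) (st [] x [] (replicate (?n * ?m) False) (replicate ?m False) [])"
      using reg_add_multiple[of "[]" x "[]" ?m x] by simp
    have 5: "reg (clear 4) (st [] x [] (replicate (?n * ?m) False) (replicate ?m False) []) (3 * ?m + 1)
        (st [] x [] (replicate (?n * ?m) False) [] [])"
      by (rule reg_weaken[OF reg_clear]) simp_all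
    have 6: "reg (push_zeros 3 a) (st [] x [] (replicate (?n * ?m) False) [] []) (2 * a)
        (st [] x [] (replicate (poly (pCons a P) ?n) False) [] [])"
      by (rule reg_weaken[OF reg_push_zeros]) (simp_all add: zeros_append)
    show ?thesis
      by (rule reg_seq[OF p(3)[rule_format] reg_seq[OF 2 reg_seq[OF 3 reg_seq[OF 4 reg_seq[OF 5 6]]]]])
  qed
  ultimately show ?case by blast
qed

lemma polytime_encode_padded:
  "polytime_computable (\<lambda>y. Some (encode y @ replicate (poly P (length y)) False))"
proof -
  obtain h t where h: "ok 6 h" "polyb t" "\<forall>x. reg h (st [] x [] [] [] []) (t (length x))
     (st [] x [] (replicate (poly P (length x)) False) [] [])"
    using horner[of P] by (elim exE conjE) (rule that)
  let ?p = "pour 0 2 ;; pour 2 1 ;; h ;; pour 1 2 ;; pour 3 0 ;; push 0 True ;; encode_loop 2 0 ;; push 0 True"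
  let ?t = "\<lambda>n. (7 * n + 1) + ((7 * n + 1) + (t n + ((7 * n + 1) + ((7 * poly P n + 1) +
     (2 + ((9 * n + 1) + 2))))))"
  show ?thesis
  proof (rule polytime_computable_st)
    show "ok 6 ?p" using h(1) by simp
    show "polyb ?t" by (intro polyb_intros h(2))
    fix y :: word
    let ?n = "length y" let ?z = "replicate (poly P (length y)) False"
    show "length (result (Some (encode y @ ?z))) \<le> ?t ?n" by (simp add: length_encode)
    have 1: "reg (pour 0 2) (st y [] [] [] [] []) (7 * ?n + 1) (st [] [] (rev y) [] [] [])"
      by (rule reg_weaken[OF reg_pour]) simp_all
    have 2: "reg (pour 2 1) (st [] [] (rev y) [] [] []) (7 * ?n + 1) (st [] y [] [] [] [])"
      by (rule reg_weaken[OF reg_pour]) simp_all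
    have 4: "reg (pour 1 2) (st [] y [] ?z [] []) (7 * ?n + 1) (st [] [] (rev y) ?z [] [])"
      by (rule reg_weaken[OF reg_pour]) simp_all
    have 5: "reg (pour 3 0) (st [] [] (rev y) ?z [] []) (7 * poly P ?n + 1) (st ?z [] (rev y) [] [] [])"
      by (rule reg_weaken[OF reg_pour]) simp_all
    have 6: "reg (push 0 True) (st ?z [] (rev y) [] [] []) 2 (st (True # ?z) [] (rev y) [] [] [])"
      by (rule reg_weaken[OF reg_push]) simp_all
    have 7: "reg (encode_loop 2 0) (st (True # ?z) [] (rev y) [] [] []) (9 * ?n + 1)
        (st (encode y @ ?z) [] [] [] [] [])"
      by (rule reg_weaken[OF reg_encode_loop]) (simp_all add: encode_def)
    have 8: "reg (push 0 True) (st (encode y @ ?z) [] [] [] [] []) 2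
        (st (result (Some (encode y @ ?z))) [] [] [] [] [])"
      by (rule reg_weaken[OF reg_push]) simp_all
    show "\<exists>b c d e g. reg ?p (st y [] [] [] [] []) (?t ?n) (st (result (Some (encode y @ ?z))) b c d e g)"
      by (intro exI) (rule reg_seq[OF 1 reg_seq[OF 2 reg_seq[OF h(3)[rule_format] reg_seq[OF 4
              reg_seq[OF 5 reg_seq[OF 6 reg_seq[OF 7 8]]]]]]])
  qed
qed

section \<open>Checked preimages\<close>

abbreviation compare_tops :: prog where
  "compare_tops \<equiv> pif 0 (is_letter True) (pif 3 (is_letter True) [] (push 1 True))
     (pif 3 (is_letter False) [] (push 1 True)) ;; pop 0 ;; pop 3"

definition compare :: prog where
  "compare = pwhile 0 nonblank
     compare_tops ;;
   pif 3 nonblank (push 1 True ;; clear 3) []"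

lemma ok_compare [simp]: "3 < K \<Longrightarrow> ok K compare"
  by (simp add: compare_def)

text \<open>
  A mismatch is recorded by pushing on register 1; also a word that is too short counts as
  one, as the top of the empty register is no letter.
\<close>

lemma reg_compare_loop:
  "\<exists>d'. reg (pwhile 0 nonblank
     compare_tops)
     (st x d u y [] []) (10 * length x + 1) (st [] d' u (drop (length x) y) [] []) \<and>
     (d' = [] \<longleftrightarrow> d = [] \<and> prefix x y) \<and> length d' \<le> length d + length x"
  (is "\<exists>d'. reg ?w _ _ _ \<and> _")
proof (induction x arbitrary: d y)
  case Nil
  have "reg ?w (st [] d u y [] []) 1 (st [] d u y [] [])"
    by (rule reg_while_False) simp
  then show ?case by (intro exI[of _ d]) simp
next
  case (Cons b x)
  define d1 where "d1 = (if y \<noteq> [] \<and> hd y = b then d else True # d)"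
  have top: "top_symbol y = letter c \<longleftrightarrow> y \<noteq> [] \<and> hd y = c" for c by (cases y) simp_all
  have test: "reg (pif 3 (is_letter b) [] (push 1 True)) (st (b # x) d u y [] []) (2 + 2) (st (b # x) d1 u y [] [])"
  proof (cases "y \<noteq> [] \<and> hd y = b")
    case True
    then have "d1 = d" by (simp add: d1_def)
    then show ?thesis using True by (intro reg_if_True) (simp_all add: reg_skip top)
  next
    case False
    then have "d1 = True # d" by (auto simp: d1_def)
    moreover have "reg (push 1 True) (st (b # x) d u y [] []) 2 (st (b # x) (True # d) u y [] [])"
      by (rule reg_weaken[OF reg_push]) simp_all
    ultimately show ?thesis using False by (intro reg_if_False) (simp_all add: top)
  qed
  have 1: "reg (pif 0 (is_letter True) (pif 3 (is_letter True) [] (push 1 True))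
       (pif 3 (is_letter False) [] (push 1 True))) (st (b # x) d u y [] []) (2 + 2 + 2) (st (b # x) d1 u y [] [])"
  proof (cases b)
    case True
    then have b: "b = True" by simp
    show ?thesis by (rule reg_if_True) (use test in \<open>simp_all only: b st_get top_symbol_simps\<close>)
  next
    case False
    then have b: "b = False" by simp
    show ?thesis by (rule reg_if_False) (use test in \<open>simp_all add: b\<close>)
  qed
  have 2: "reg (pop 0) (st (b # x) d1 u y [] []) 1 (st x d1 u y [] [])"
    by (rule reg_weaken[OF reg_pop]) simp_all
  have 3: "reg (pop 3) (st x d1 u y [] []) 1 (st x d1 u (tl y) [] [])"
    by (rule reg_weaken[OF reg_pop]) simp_all
  obtain d' where d': "reg ?w (st x d1 u (tl y) [] []) (10 * length x + 1) (st [] d' u (drop (length x) (tl y)) [] [])"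
    "d' = [] \<longleftrightarrow> d1 = [] \<and> prefix x (tl y)" "length d' \<le> length d1 + length x"
    using Cons[of d1 "tl y"] by (elim exE conjE)
  have "reg ?w (st (b # x) d u y [] []) ((2 + 2 + 2 + (1 + 1)) + (10 * length x + 1) + 2)
      (st [] d' u (drop (length x) (tl y)) [] [])"
    by (rule reg_while_True[OF _ reg_seq[OF 1 reg_seq[OF 2 3]] d'(1)]) simp
  then have "reg ?w (st (b # x) d u y [] []) (10 * length (b # x) + 1) (st [] d' u (drop (length (b # x)) y) [] [])"
    by (rule reg_weaken) (simp_all add: drop_Suc)
  moreover have "d' = [] \<longleftrightarrow> d = [] \<and> prefix (b # x) y"
    unfolding d'(2) d1_def by (cases y) auto
  moreover have "length d' \<le> length d + length (b # x)"
    using d'(3) unfolding d1_def by (auto split: if_splits)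
  ultimately show ?case by (intro exI[of _ d'] conjI)
qed

lemma reg_compare:
  "\<exists>d. reg compare (st x [] u y [] []) (10 * length x + 1 + (2 + (3 * length y + 1) + 2)) (st [] d u [] [] []) \<and>
     (d = [] \<longleftrightarrow> x = y) \<and> length d \<le> length x + 1"
proof -
  let ?t = "2 + (3 * length y + 1) + 2"
  obtain d where d: "reg (pwhile 0 nonblank
     compare_tops)
     (st x [] u y [] []) (10 * length x + 1) (st [] d u (drop (length x) y) [] [])"
    "d = [] \<longleftrightarrow> prefix x y" "length d \<le> length x"
    using reg_compare_loop[of x "[]" u y] by auto
  show ?thesis
  proof (cases "drop (length x) y = []")
    case True
    then have "prefix x y \<longleftrightarrow> x = y"
      by (auto simp: prefix_def)
    then have "d = [] \<longleftrightarrow> x = y" using d(2) by simp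
    moreover have 3: "reg (pif 3 nonblank (push 1 True ;; clear 3) []) (st [] d u (drop (length x) y) [] []) ?t (st [] d u [] [] [])"
      unfolding True by (rule reg_if_False) (simp_all add: reg_skip)
    have "reg compare (st x [] u y [] []) (10 * length x + 1 + ?t) (st [] d u [] [] [])"
      unfolding compare_def by (rule reg_seq[OF d(1) 3])
    moreover have "length d \<le> length x + 1" using d(3) by simp
    ultimately show ?thesis by (intro exI[of _ d] conjI)
  next
    case False
    let ?y = "drop (length x) y"
    have 1: "reg (push 1 True) (st [] d u ?y [] []) 2 (st [] (True # d) u ?y [] [])"
      by (rule reg_weaken[OF reg_push]) simp_all
    have 2: "reg (clear 3) (st [] (True # d) u ?y [] []) (3 * length y + 1) (st [] (True # d) u [] [] [])"
      by (rule reg_weaken[OF reg_clear]) simp_all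
    have "top_symbol ?y \<noteq> 0" using False by (cases ?y) simp_all
    then have 3: "reg (pif 3 nonblank (push 1 True ;; clear 3) []) (st [] d u ?y [] []) ?t (st [] (True # d) u [] [] [])"
      by (intro reg_if_True reg_seq[OF 1 2]) simp
    have "True # d = [] \<longleftrightarrow> x = y" using False by auto
    moreover have "reg compare (st x [] u y [] []) (10 * length x + 1 + ?t) (st [] (True # d) u [] [] [])"
      unfolding compare_def by (rule reg_seq[OF d(1) 3])
    moreover have "length (True # d) \<le> length x + 1" using d(3) by simp
    ultimately show ?thesis by (intro exI[of _ "True # d"] conjI)
  qed
qed

text \<open>
  The check makes the domain exact: an inverse of a class may take any value outside of the
  padded codes of the image.
\<close>

definition checked :: "pfun \<Rightarrow> pfun \<Rightarrow> pfun" where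
  "checked f k = (\<lambda>y. case k y of None \<Rightarrow> None | Some u \<Rightarrow> if f u = Some y then Some u else None)"

lemma polytime_checked:
  assumes "polytime_computable f" "polytime_computable k"
  shows "polytime_computable (checked f k)"
proof -
  obtain K s L t where f: "callable f K s" and k: "callable k L t"
    using assms[THEN polytime_callable] by (elim exE)
  obtain p where p: "ok (3 + K) p"
    "\<And>\<sigma>. (\<forall>i>3. \<sigma> i = []) \<Longrightarrow> reg p \<sigma> (s (length (\<sigma> 3))) (\<sigma>(3 := result (f (\<sigma> 3))))"
    using callableE[OF f, of 3] by metis
  obtain q where q: "ok (3 + L) q"
    "\<And>\<sigma>. (\<forall>i>3. \<sigma> i = []) \<Longrightarrow> reg q \<sigma> (t (length (\<sigma> 3))) (\<sigma>(3 := result (k (\<sigma> 3))))"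
    using callableE[OF k, of 3] by metis
  let ?verdict = "pif 1 nonblank (clear 1 ;; clear 2) (pour 2 1 ;; pour 1 0 ;; push 0 True)"
  let ?yes = "pop 3 ;; copy 3 2 1 ;; p ;; push 0 True ;; compare ;; ?verdict"
  let ?p = "copy 0 3 1 ;; q ;; pif 3 nonblank ?yes (clear 0)"
  let ?tv = "\<lambda>n. (3 * (n + 2) + 1) + (14 * t n + 4)"
  let ?ty = "\<lambda>n. 1 + ((18 * t n + 2) + (s (t n) + (2 +
      ((10 * (n + 1) + 1 + (2 + (3 * s (t n) + 1) + 2)) + (?tv n + 2))))) + (3 * n + 1)"
  let ?t = "\<lambda>n. (18 * n + 2) + (t n + (?ty n + 2))"
  show ?thesis
  proof (rule polytime_computable_st)
    show "ok (4 + K + L) ?p" using ok_mono[OF p(1), of "4 + K + L"] ok_mono[OF q(1), of "4 + K + L"] by simp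
    have "polyb (\<lambda>n. s (t n))"
      by (rule polyb_comp[OF callable_polyb[OF f] callable_polyb[OF k]])
    then show "polyb ?t" by (intro polyb_intros callable_polyb[OF k])
    fix y :: word
    let ?n = "length y"
    have ul: "length u < t ?n" if "k y = Some u" for u
      using callable_length[OF k, of y] that by simp
    show "length (result (checked f k y)) \<le> ?t ?n"
      using ul by (cases "k y") (auto simp: checked_def less_imp_le)
    have 1: "reg (copy 0 3 1) (st y [] [] [] [] []) (18 * ?n + 2) (st y [] [] y [] [])"
      by (rule reg_weaken[OF reg_copy]) simp_all
    have 2: "reg q (st y [] [] y [] []) (t ?n) (st y [] [] (result (k y)) [] [])"
      using q(2)[OF st_clear_above(4), of y "[]" "[]" y] by simp
    have 3: "reg (pif 3 nonblank ?yes (clear 0)) (st y [] [] (result (k y)) [] []) (?ty ?n + 2)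
        (st (result (checked f k y)) [] [] [] [] [])"
    proof (cases "k y")
      case None
      have "reg (clear 0) (st y [] [] [] [] []) (?ty ?n) (st [] [] [] [] [] [])"
        by (rule reg_weaken[OF reg_clear]) simp_all
      then show ?thesis by (intro reg_if_False) (simp_all add: None checked_def)
    next
      case (Some u)
      have u: "length u \<le> t ?n" using ul[OF Some] by simp
      have fl: "length (result (f u)) \<le> s (t ?n)"
        using callable_length[OF f, of u] callable_mono[OF f u] by simp
      have a: "reg (pop 3) (st y [] [] (True # u) [] []) 1 (st y [] [] u [] [])"
        by (rule reg_weaken[OF reg_pop]) simp_all
      have b: "reg (copy 3 2 1) (st y [] [] u [] []) (18 * t ?n + 2) (st y [] u u [] [])"
        by (rule reg_weaken[OF reg_copy]) (use u in simp_all)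
      have c: "reg p (st y [] u u [] []) (s (t ?n)) (st y [] u (result (f u)) [] [])"
        by (rule reg_weaken[OF p(2)[OF st_clear_above(4)]]) (use callable_mono[OF f u] in simp_all)
      have d: "reg (push 0 True) (st y [] u (result (f u)) [] []) 2 (st (True # y) [] u (result (f u)) [] [])"
        by (rule reg_weaken[OF reg_push]) simp_all
      obtain v where v: "reg compare (st (True # y) [] u (result (f u)) [] [])
          (10 * length (True # y) + 1 + (2 + (3 * length (result (f u)) + 1) + 2)) (st [] v u [] [] [])"
        "v = [] \<longleftrightarrow> True # y = result (f u)" "length v \<le> length (True # y) + 1"
        using reg_compare[of "True # y" u "result (f u)"] by (elim exE conjE)
      have e: "reg compare (st (True # y) [] u (result (f u)) [] [])
          (10 * (?n + 1) + 1 + (2 + (3 * s (t ?n) + 1) + 2)) (st [] v u [] [] [])"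
        by (rule reg_weaken[OF v(1)]) (use fl in simp_all)
      have v': "v = [] \<longleftrightarrow> f u = Some y" unfolding v(2) by (cases "f u") auto
      have g: "reg ?verdict (st [] v u [] [] []) (?tv ?n + 2) (st (result (checked f k y)) [] [] [] [] [])"
      proof (cases "f u = Some y")
        case True
        then have "v = []" using v' by simp
        have 1: "reg (pour 2 1) (st [] [] u [] [] []) (7 * t ?n + 1) (st [] (rev u) [] [] [] [])"
          by (rule reg_weaken[OF reg_pour]) (use u in simp_all)
        have 2: "reg (pour 1 0) (st [] (rev u) [] [] [] []) (7 * t ?n + 1) (st u [] [] [] [] [])"
          by (rule reg_weaken[OF reg_pour]) (use u in simp_all)
        have 3: "reg (push 0 True) (st u [] [] [] [] []) 2 (st (True # u) [] [] [] [] [])"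
          by (rule reg_weaken[OF reg_push]) simp_all
        have "reg (pour 2 1 ;; pour 1 0 ;; push 0 True) (st [] [] u [] [] []) (?tv ?n) (st (True # u) [] [] [] [] [])"
          by (rule reg_weaken[OF reg_seq[OF 1 reg_seq[OF 2 3]]]) simp_all
        then show ?thesis using \<open>v = []\<close> by (intro reg_if_False) (simp_all add: Some True checked_def)
      next
        case False
        then have "v \<noteq> []" using v' by simp
        then have top: "top_symbol v \<noteq> 0" by (cases v) simp_all
        have 1: "reg (clear 1) (st [] v u [] [] []) (3 * (?n + 2) + 1) (st [] [] u [] [] [])"
          by (rule reg_weaken[OF reg_clear]) (use v(3) in simp_all)
        have 2: "reg (clear 2) (st [] [] u [] [] []) (14 * t ?n + 4) (st [] [] [] [] [] [])"
          by (rule reg_weaken[OF reg_clear]) (use u in simp_all)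
        show ?thesis using reg_seq[OF 1 2] top
          by (intro reg_if_True) (simp_all add: Some False checked_def)
      qed
      have "reg ?yes (st y [] [] (True # u) [] []) (?ty ?n) (st (result (checked f k y)) [] [] [] [] [])"
        by (rule reg_weaken[OF reg_seq[OF a reg_seq[OF b reg_seq[OF c reg_seq[OF d reg_seq[OF e g]]]]]]) simp_all
      then show ?thesis by (intro reg_if_True) (simp_all add: Some)
    qed
    show "\<exists>b c d e g. reg ?p (st y [] [] [] [] []) (?t ?n) (st (result (checked f k y)) b c d e g)"
      by (intro exI) (rule reg_seq[OF 1 reg_seq[OF 2 3]])
  qed
qed

section \<open>Cutting a word at its shortest prefix in the domain\<close>

text \<open>
  \<open>attempts\<close> tries the prefixes from the longest to the shortest, and a success replaces the
  previous result \<open>r\<close>. This finds the shortest prefix without leaving the loop early. The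
  prefix is kept in reverse, as a stack, and \<open>s\<close> is the remaining suffix.
\<close>

definition attempt :: "pfun \<Rightarrow> word \<Rightarrow> word \<Rightarrow> word \<Rightarrow> word" where
  "attempt k p s r = (case k (rev p) of None \<Rightarrow> r | Some u \<Rightarrow> True # u @ s)"

fun attempts :: "pfun \<Rightarrow> word \<Rightarrow> word \<Rightarrow> word \<Rightarrow> word" where
  "attempts k [] s r = r"
| "attempts k (b # p) s r = attempts k p (b # s) (attempt k p (b # s) r)"

lemma attempts_none:
  "(\<And>i. i < length p \<Longrightarrow> k (take i (rev p)) = None) \<Longrightarrow> attempts k p s r = r"
proof (induction p arbitrary: s r)
  case (Cons b p)
  have "k (take i (rev p)) = None" if "i < length p" for i
    using Cons.prems[of i] that by simp
  moreover have "k (rev p) = None" using Cons.prems[of "length p"] by simp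
  ultimately show ?case using Cons.IH by (simp add: attempt_def)
qed simp

lemma attempts_some:
  "i < length p \<Longrightarrow> k (take i (rev p)) = Some u \<Longrightarrow> (\<And>j. j < i \<Longrightarrow> k (take j (rev p)) = None) \<Longrightarrow>
    attempts k p s r = True # u @ drop i (rev p) @ s"
proof (induction p arbitrary: s r)
  case (Cons b p)
  show ?case
  proof (cases "i < length p")
    case True
    have "k (take i (rev p)) = Some u" using Cons.prems(2) True by simp
    moreover have "k (take j (rev p)) = None" if "j < i" for j
      using Cons.prems(3)[OF that] that True by simp
    ultimately show ?thesis using Cons.IH[OF True] True by simp
  next
    case False
    then have i: "i = length p" using Cons.prems(1) by simp
    have "k (take j (rev p)) = None" if "j < length p" for j
      using Cons.prems(3)[of j] that i by simp
    then have "attempts k p (b # s) r' = r'" for r' by (rule attempts_none)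
    moreover have "k (rev p) = Some u" using Cons.prems(2) i by simp
    ultimately show ?thesis by (simp add: attempt_def i)
  qed
qed simp

definition shortest :: "pfun \<Rightarrow> pfun" where
  "shortest k y = (if \<exists>i. k (take i y) \<noteq> None
     then let i = (LEAST i. k (take i y) \<noteq> None) in map_option (\<lambda>u. u @ drop i y) (k (take i y))
     else None)"

lemma shortest_none: "(\<And>i. k (take i y) = None) \<Longrightarrow> shortest k y = None"
  by (simp add: shortest_def)

lemma shortest_some:
  assumes "k (take i y) = Some u" "\<And>j. j < i \<Longrightarrow> k (take j y) = None"
  shows "shortest k y = Some (u @ drop i y)"
proof -
  have "(LEAST i. k (take i y) \<noteq> None) = i"
  proof (rule Least_equality)
    show "i \<le> j" if "k (take j y) \<noteq> None" for j
      using assms(2)[of j] that by (meson not_le_imp_less)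
  qed (use assms(1) in simp)
  moreover have "\<exists>i. k (take i y) \<noteq> None" using assms(1) by (intro exI[of _ i]) simp
  ultimately show ?thesis using assms(1) by (simp add: shortest_def)
qed

lemma shortest_cases:
  obtains "\<forall>i. k (take i y) = None" "shortest k y = None"
  | i u where "i \<le> length y" "k (take i y) = Some u" "\<forall>j<i. k (take j y) = None"
      "shortest k y = Some (u @ drop i y)"
proof (cases "\<exists>i. k (take i y) \<noteq> None")
  case False
  then have none: "k (take i y) = None" for i by blast
  then show ?thesis by (intro that(1) allI shortest_none)
next
  case True
  define i where "i = (LEAST i. k (take i y) \<noteq> None)"
  have "k (take i y) \<noteq> None" unfolding i_def using True by (rule LeastI_ex)
  then obtain u where u: "k (take i y) = Some u" by blast
  have least: "k (take j y) = None" if "j < i" for j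
    using not_less_Least[of j "\<lambda>i. k (take i y) \<noteq> None"] that unfolding i_def by blast
  have "i \<le> length y"
  proof (rule ccontr)
    assume "\<not> i \<le> length y"
    then have "length y < i" "take i y = take (length y) y" by simp_all
    then show False using least[of "length y"] u by simp
  qed
  moreover have "shortest k y = Some (u @ drop i y)"
    by (rule shortest_some) (use u least in simp_all)
  ultimately show ?thesis using that(2)[of i u] u least by simp
qed

lemma result_shortest: "result (shortest k y) = attempts k (rev y) [] (attempt k (rev y) [] [])"
proof (cases rule: shortest_cases[of k y])
  case 1
  then have "k y = None" using 1(1)[rule_format, of "length y"] by simp
  moreover have "attempts k (rev y) [] r = r" for r by (rule attempts_none) (simp add: 1(1))
  ultimately show ?thesis using 1(2) by (simp add: attempt_def)
next
  case (2 i u)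
  show ?thesis
  proof (cases "i < length y")
    case True
    have "attempts k (rev y) [] r = True # u @ drop i (rev (rev y)) @ []" for r
      by (rule attempts_some) (use True 2 in simp_all)
    then show ?thesis using 2(4) by simp
  next
    case False
    then have i: "i = length y" using 2(1) by simp
    have "attempts k (rev y) [] r = r" for r by (rule attempts_none) (use 2(3) i in simp)
    then show ?thesis using 2(2,4) i by (simp add: attempt_def)
  qed
qed

text \<open>
  Lengths of intermediate results stay below \<open>t n + n + 1\<close>, since a success yields a value
  of \<open>k\<close> followed by a suffix of the input.
\<close>

lemma polytime_shortest:
  assumes "polytime_computable k"
  shows "polytime_computable (shortest k)"
proof -
  obtain K t where k: "callable k K t" using polytime_callable[OF assms] by (elim exE)
  obtain q where q: "ok (5 + K) q"
    "\<And>\<sigma>. (\<forall>i>5. \<sigma> i = []) \<Longrightarrow> reg q \<sigma> (t (length (\<sigma> 5))) (\<sigma>(5 := result (k (\<sigma> 5))))"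
    using callableE[OF k, of 5] by metis
  let ?yes = "pop 5 ;; clear 3 ;; copy 2 3 0 ;; pour 5 4 ;; pour 4 3 ;; push 3 True"
  let ?try = "copy 1 4 0 ;; pour 4 5 ;; q ;; pif 5 nonblank ?yes []"
  let ?loop = "pwhile 1 nonblank (push_top 1 2 ;; pop 1 ;; ?try)"
  let ?p = "pour 0 1 ;; ?try ;; ?loop ;; pour 3 4 ;; pour 4 0"
  let ?B = "\<lambda>n. t n + n + 1"
  let ?ty = "\<lambda>n. 1 + ((3 * ?B n + 1) + ((18 * n + 2) + ((7 * t n + 1) + ((7 * t n + 1) + 2))))"
  let ?tt = "\<lambda>n. (18 * n + 2) + ((7 * n + 1) + (t n + (?ty n + 2)))"
  let ?t = "\<lambda>n. (7 * n + 1) + (?tt n + (((4 + (1 + ?tt n) + 2) * n + 1) + ((7 * ?B n + 1) + (7 * ?B n + 1))))"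
  have attempt_length: "length (attempt k p s r) \<le> ?B n"
    if "length p + length s = n" "length r \<le> ?B n" for p s r n
  proof (cases "k (rev p)")
    case (Some u)
    have "length u < t (length p)" using callable_length[OF k, of "rev p"] Some by simp
    moreover have "t (length p) \<le> t n" using that(1) by (intro callable_mono[OF k]) simp
    ultimately show ?thesis using that(1) by (simp add: attempt_def Some)
  qed (use that in \<open>simp add: attempt_def\<close>)
  have round: "reg ?try (st [] p s r [] []) (?tt n) (st [] p s (attempt k p s r) [] [])"
    if n: "length p + length s = n" "length r \<le> ?B n" for p s r n
  proof -
    have pn: "length p \<le> n" "length s \<le> n" using n(1) by simp_all
    have tn: "t (length p) \<le> t n" by (rule callable_mono[OF k pn(1)])
    have 1: "reg (copy 1 4 0) (st [] p s r [] []) (18 * n + 2) (st [] p s r p [])"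
      by (rule reg_weaken[OF reg_copy]) (use pn in simp_all)
    have 2: "reg (pour 4 5) (st [] p s r p []) (7 * n + 1) (st [] p s r [] (rev p))"
      by (rule reg_weaken[OF reg_pour]) (use pn in simp_all)
    have 3: "reg q (st [] p s r [] (rev p)) (t n) (st [] p s r [] (result (k (rev p))))"
      by (rule reg_weaken[OF q(2)[OF st_clear_above(6)]]) (use tn in simp_all)
    have 4: "reg (pif 5 nonblank ?yes []) (st [] p s r [] (result (k (rev p)))) (?ty n + 2)
        (st [] p s (attempt k p s r) [] [])"
    proof (cases "k (rev p)")
      case None
      then show ?thesis by (intro reg_if_False) (simp_all add: attempt_def reg_skip)
    next
      case (Some u)
      have u: "length u \<le> t n" using callable_length[OF k, of "rev p"] Some tn by simp
      have a: "reg (pop 5) (st [] p s r [] (True # u)) 1 (st [] p s r [] u)"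
        by (rule reg_weaken[OF reg_pop]) simp_all
      have b: "reg (clear 3) (st [] p s r [] u) (3 * ?B n + 1) (st [] p s [] [] u)"
        by (rule reg_weaken[OF reg_clear]) (use n(2) in simp_all)
      have c: "reg (copy 2 3 0) (st [] p s [] [] u) (18 * n + 2) (st [] p s s [] u)"
        by (rule reg_weaken[OF reg_copy]) (use pn in simp_all)
      have d: "reg (pour 5 4) (st [] p s s [] u) (7 * t n + 1) (st [] p s s (rev u) [])"
        by (rule reg_weaken[OF reg_pour]) (use u in simp_all)
      have e: "reg (pour 4 3) (st [] p s s (rev u) []) (7 * t n + 1) (st [] p s (u @ s) [] [])"
        by (rule reg_weaken[OF reg_pour]) (use u in simp_all)
      have f: "reg (push 3 True) (st [] p s (u @ s) [] []) 2 (st [] p s (True # u @ s) [] [])"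
        by (rule reg_weaken[OF reg_push]) simp_all
      have "reg ?yes (st [] p s r [] (True # u)) (?ty n) (st [] p s (True # u @ s) [] [])"
        by (rule reg_seq[OF a reg_seq[OF b reg_seq[OF c reg_seq[OF d reg_seq[OF e f]]]]])
      then show ?thesis by (intro reg_if_True) (simp_all add: Some attempt_def)
    qed
    show ?thesis by (rule reg_seq[OF 1 reg_seq[OF 2 reg_seq[OF 3 4]]])
  qed
  have loop: "reg ?loop (st [] p s r [] []) ((4 + (1 + ?tt n) + 2) * length p + 1)
        (st [] [] (rev p @ s) (attempts k p s r) [] []) \<and> length (attempts k p s r) \<le> ?B n"
    if "length p + length s = n" "length r \<le> ?B n" for p s r n
    using that
  proof (induction p arbitrary: s r)
    case Nil
    have "reg ?loop (st [] [] s r [] []) 1 (st [] [] s r [] [])" by (rule reg_while_False) simp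
    then show ?case using Nil by simp
  next
    case (Cons b p)
    have len: "length p + length (b # s) = n" using Cons.prems(1) by simp
    let ?r = "attempt k p (b # s) r"
    note r = attempt_length[OF len Cons.prems(2)]
    note IH = Cons.IH[OF len r]
    have 1: "reg (push_top 1 2) (st [] (b # p) s r [] []) 4 (st [] (b # p) (b # s) r [] [])"
      by (rule reg_weaken[OF reg_push_top]) simp_all
    have 2: "reg (pop 1) (st [] (b # p) (b # s) r [] []) 1 (st [] p (b # s) r [] [])"
      by (rule reg_weaken[OF reg_pop]) simp_all
    note 3 = round[OF len Cons.prems(2)]
    have "reg ?loop (st [] (b # p) s r [] [])
        ((4 + (1 + ?tt n)) + ((4 + (1 + ?tt n) + 2) * length p + 1) + 2)
        (st [] [] (rev p @ b # s) (attempts k p (b # s) ?r) [] [])"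
      by (rule reg_while_True[OF _ reg_seq[OF 1 reg_seq[OF 2 3]] conjunct1[OF IH]]) simp
    then have "reg ?loop (st [] (b # p) s r [] []) ((4 + (1 + ?tt n) + 2) * length (b # p) + 1)
        (st [] [] (rev (b # p) @ s) (attempts k (b # p) s r) [] [])"
    proof (rule reg_weaken)
      show "(4 + (1 + ?tt n)) + ((4 + (1 + ?tt n) + 2) * length p + 1) + 2
          \<le> (4 + (1 + ?tt n) + 2) * length (b # p) + 1"
        by (simp only: list.size mult_Suc_right add_Suc_right add_0_right)
    qed simp
    then show ?case using IH by simp
  qed
  show ?thesis
  proof (rule polytime_computable_st)
    show "ok (6 + K) ?p" using ok_mono[OF q(1), of "6 + K"] by simp
    show "polyb ?t" by (intro polyb_intros callable_polyb[OF k])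
    fix y :: word
    let ?n = "length y" and ?r0 = "attempt k (rev y) [] []"
    have n: "length (rev y) + length ([] :: word) = ?n" "length ([] :: word) \<le> ?B ?n" by simp_all
    note L = loop[OF n(1) attempt_length[OF n]]
    have R: "attempts k (rev y) [] ?r0 = result (shortest k y)" by (rule result_shortest[symmetric])
    have len: "length (result (shortest k y)) \<le> ?B ?n" using conjunct2[OF L] by (simp only: R)
    then show "length (result (shortest k y)) \<le> ?t ?n" by simp
    have 1: "reg (pour 0 1) (st y [] [] [] [] []) (7 * ?n + 1) (st [] (rev y) [] [] [] [])"
      by (rule reg_weaken[OF reg_pour]) simp_all
    note 2 = round[OF n]
    have 3: "reg ?loop (st [] (rev y) [] ?r0 [] []) ((4 + (1 + ?tt ?n) + 2) * ?n + 1)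
        (st [] [] y (result (shortest k y)) [] [])"
      using conjunct1[OF L] by (simp only: R rev_rev_ident append_Nil2 length_rev)
    have 4: "reg (pour 3 4) (st [] [] y (result (shortest k y)) [] []) (7 * ?B ?n + 1)
        (st [] [] y [] (rev (result (shortest k y))) [])"
      by (rule reg_weaken[OF reg_pour]) (use len in simp_all)
    have 5: "reg (pour 4 0) (st [] [] y [] (rev (result (shortest k y))) []) (7 * ?B ?n + 1)
        (st (result (shortest k y)) [] y [] [] [])"
      by (rule reg_weaken[OF reg_pour]) (use len in simp_all)
    show "\<exists>b c d e g. reg ?p (st y [] [] [] [] []) (?t ?n) (st (result (shortest k y)) b c d e g)"
      by (intro exI) (rule reg_seq[OF 1 reg_seq[OF 2 reg_seq[OF 3 reg_seq[OF 4 5]]]])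
  qed
qed

section \<open>Lifting inverses from the quotient\<close>

lemma RM_iff:
  "f \<in> RM \<longleftrightarrow> (\<exists>p. balanced_by p f) \<and> polytime_computable f \<and> right_ideal_morphism f"
  by (simp add: RM_def fP_def poly_balanced_iff)

lemma RM_comp:
  assumes "f \<in> RM" "g \<in> RM" shows "f \<circ>\<^sub>m g \<in> RM"
proof -
  obtain p q where "balanced_by p f" "balanced_by q g" using assms unfolding RM_iff by (elim conjE exE)
  from balanced_comp[OF this] show ?thesis
    using assms unfolding RM_iff by (intro conjI exI polytime_comp morphism_comp) simp_all
qed

lemma regular_M_P_poly_iff:
  "regular_monoid M_P_poly \<longleftrightarrow> (\<forall>f \<in> RM. \<exists>g \<in> RM. poly_equiv (f \<circ>\<^sub>m g \<circ>\<^sub>m f) f)"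
  by (rule regular_M_iff) (rule RM_comp)

lemma encoded_encode: "encoded f (encode x @ w) = map_option (\<lambda>y. encode y @ w) (f x)"
  by (simp add: encoded_def decode_encode)

lemma encoded_SomeE:
  assumes "encoded f z = Some t"
  obtains x w y where "z = encode x @ w" "f x = Some y" "t = encode y @ w"
proof (cases "decode z")
  case (Some xw)
  then obtain x w where "decode z = Some (x, w)" by (cases xw) simp
  then show ?thesis using assms decode_SomeD[of z x w] that by (auto simp: encoded_def)
qed (use assms in \<open>simp add: encoded_def\<close>)

lemma encode_inject: "encode x @ v = encode y @ w \<longleftrightarrow> x = y \<and> v = w"
  using decode_encode by (metis option.inject prod.inject)

lemma morphism_encoded: "right_ideal_morphism (encoded f)"
proof (rule right_ideal_morphismI)
  fix z t v assume "encoded f z = Some t"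
  then obtain x w y where "z = encode x @ w" "f x = Some y" "t = encode y @ w" by (rule encoded_SomeE)
  then show "encoded f (z @ v) = Some (t @ v)" using encoded_encode[of f x "w @ v"] by simp
qed

lemma balanced_encoded:
  assumes "balanced_by p f"
  shows "balanced_by (smult 2 p + [:1, 1:]) (encoded f)"
  unfolding balanced_by_def
proof (intro allI impI)
  fix z t assume "encoded f z = Some t"
  then obtain x w y where z: "z = encode x @ w" "f x = Some y" "t = encode y @ w" by (rule encoded_SomeE)
  have "length y \<le> poly p (length x)" "length x \<le> poly p (length y)"
    using assms z(2) unfolding balanced_by_def by blast+
  moreover have "poly p (length x) \<le> poly p (length z)" "poly p (length y) \<le> poly p (length t)"
    by (rule poly_mono_nat; simp add: z length_encode)+
  ultimately show "length t \<le> poly (smult 2 p + [:1, 1:]) (length z) \<and>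
      length z \<le> poly (smult 2 p + [:1, 1:]) (length t)"
    by (simp add: z(1,3) length_encode)
qed

lemma RM_encoded:
  assumes "f \<in> fP" shows "encoded f \<in> RM"
proof -
  obtain p where "balanced_by p f" using assms unfolding fP_def poly_balanced_iff by auto
  from balanced_encoded[OF this] show ?thesis
    using assms unfolding RM_iff fP_def
    by (intro conjI exI polytime_encoded morphism_encoded) simp_all
qed

text \<open>
  Codes are minimal in the domain, as one code is never a proper prefix of another one.
\<close>

lemma domC_encoded:
  assumes "f x = Some y" shows "encode x \<in> domC (encoded f)"
proof -
  note mor = morphism_encoded[of f]
  have "encoded f (encode x) = Some (encode y)" using encoded_encode[of f x "[]"] assms by simp
  from domC_prefix[OF mor this] obtain c where c: "c \<in> domC (encoded f)" "prefix c (encode x)" by blast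
  obtain t where "encoded f c = Some t" using domC_dom[OF mor c(1)] by blast
  then obtain x' w y' where x': "c = encode x' @ w" "f x' = Some y'" by (rule encoded_SomeE)
  obtain v where "encode x = c @ v" using c(2) by (auto simp: prefix_def)
  then have "encode x @ [] = encode x' @ (w @ v)" using x'(1) by simp
  then have "x' = x" "w = []" unfolding encode_inject by simp_all
  then show ?thesis using c(1) x'(1) by simp
qed

text \<open>
  Let \<open>e = encode x\<close>, where \<open>f x = y\<close>. Equivalence gives a generator of the domain of
  \<open>F g F\<close> that is comparable with \<open>e\<close> padded by \<open>w\<close>, and the length of a generator above \<open>e\<close>
  is polynomial in the length of \<open>e\<close>. If \<open>w\<close> is at least that long, the padded word lies in
  the domain, and so \<open>g\<close> inverts \<open>F\<close> on \<open>encode y @ w\<close>. The padding is computed from \<open>y\<close>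
  alone, which is possible because the length of \<open>x\<close> is bounded by a polynomial in that of
  \<open>y\<close>.
\<close>

lemma encoded_inverse:
  assumes bal: "balanced_by p f" and g: "right_ideal_morphism g"
    and eqv: "poly_equiv (encoded f \<circ>\<^sub>m g \<circ>\<^sub>m encoded f) (encoded f)"
  shows "\<exists>P :: nat poly. \<forall>x y. f x = Some y \<longrightarrow>
    (\<exists>u v. g (encode y @ replicate (poly P (length y)) False) = Some (encode u @ v) \<and> f u = Some y)"
proof -
  let ?F = "encoded f" let ?H = "?F \<circ>\<^sub>m g \<circ>\<^sub>m ?F"
  note F = morphism_encoded[of f]
  note H = morphism_comp[OF morphism_comp[OF F g] F]
  note eqv' = eqv[unfolded poly_equiv_iff[OF H F]]
  obtain \<tau> where \<tau>: "length_control \<tau> ?H ?F" using eqv' by blast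
  have ext: "extends_into ?F ?H" using eqv' by blast
  let ?P = "pcompose \<tau> (smult 2 p + [:1:])"
  have "\<exists>u v. g (encode y @ replicate (poly ?P (length y)) False) = Some (encode u @ v) \<and> f u = Some y"
    if y: "f x = Some y" for x y
  proof -
    let ?w = "replicate (poly ?P (length y)) False"
    have Fe: "?F (encode x @ ?w) = Some (encode y @ ?w)" using y by (simp add: encoded_encode)
    have e: "encode x \<in> domC ?F" by (rule domC_encoded[of f x y, OF y])
    have "length x \<le> poly p (length y)" using bal y unfolding balanced_by_def by blast
    then have "length (encode x) \<le> poly (smult 2 p + [:1:]) (length y)" by (simp add: length_encode)
    then have le: "poly \<tau> (length (encode x)) \<le> length ?w"
      using poly_mono_nat[of "length (encode x)" _ \<tau>] by (simp add: poly_pcompose)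
    from domC_comparable[OF H ext domI[of ?F, OF Fe]] obtain c where
      c: "c \<in> domC ?H" "prefix c (encode x @ ?w) \<or> prefix (encode x @ ?w) c" by blast
    have "\<not> prefix (encode x @ ?w) c"
    proof
      assume pre: "prefix (encode x @ ?w) c"
      then have "prefix (encode x) c" using append_prefixD by blast
      then have "length c \<le> poly \<tau> (length (encode x))" using \<tau> c(1) e unfolding length_control_def by blast
      then have "length c \<le> length ?w" using le by (rule le_trans)
      moreover have "length (encode x @ ?w) \<le> length c" using pre by (rule prefix_length_le)
      ultimately show False by (simp add: length_encode)
    qed
    then obtain v where v: "encode x @ ?w = c @ v" using c(2) by (auto simp: prefix_def)
    obtain t where "?H c = Some t" using domC_dom[OF H c(1)] by blast
    then have Ht: "?H (encode x @ ?w) = Some (t @ v)" unfolding v by (rule morphism_append[OF H])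
    then have "t @ v = encode y @ ?w" using eqv' Fe by blast
    then have "?H (encode x @ ?w) = Some (encode y @ ?w)" using Ht by simp
    then obtain z where z: "g (encode y @ ?w) = Some z" "?F z = Some (encode y @ ?w)"
      using Fe by (auto simp: map_comp_Some_iff)
    from z(2) obtain u v' y' where u: "z = encode u @ v'" "f u = Some y'"
      "encode y @ ?w = encode y' @ v'" by (rule encoded_SomeE)
    then have "y' = y" unfolding encode_inject by simp
    then show ?thesis using z(1) u by blast
  qed
  then show ?thesis by blast
qed

text \<open>
  Extending \<open>y\<close> does not change its shortest prefix in the domain of \<open>k\<close>, which makes
  \<open>shortest k\<close> a morphism whatever \<open>k\<close> is. Its balance comes from that of \<open>f\<close>, as \<open>k\<close>
  returns preimages.
\<close>

lemma RM_shortest: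
  assumes f: "f \<in> RM" and k: "polytime_computable k" "\<And>y u. k y = Some u \<Longrightarrow> f u = Some y"
  shows "shortest k \<in> RM"
proof -
  obtain p where p: "balanced_by p f" using f unfolding RM_iff by (elim conjE exE)
  have "right_ideal_morphism (shortest k)"
  proof (rule right_ideal_morphismI)
    fix y z w assume z: "shortest k y = Some z"
    show "shortest k (y @ w) = Some (z @ w)"
    proof (cases rule: shortest_cases[of k y])
      case 1
      then show ?thesis using z by simp
    next
      case (2 i u)
      have "shortest k (y @ w) = Some (u @ drop i (y @ w))"
        by (rule shortest_some) (use 2 in simp_all)
      then show ?thesis using 2(1,4) z by simp
    qed
  qed
  moreover have "balanced_by (p + [:0, 1:]) (shortest k)"
    unfolding balanced_by_def
  proof (intro allI impI)
    fix y z assume z: "shortest k y = Some z"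
    show "length z \<le> poly (p + [:0, 1:]) (length y) \<and> length y \<le> poly (p + [:0, 1:]) (length z)"
    proof (cases rule: shortest_cases[of k y])
      case 1
      then show ?thesis using z by simp
    next
      case (2 i u)
      then have z': "z = u @ drop i y" using z by simp
      have "f u = Some (take i y)" using k(2) 2(2) by blast
      then have "length u \<le> poly p (length (take i y))" "length (take i y) \<le> poly p (length u)"
        using p unfolding balanced_by_def by blast+
      moreover have "poly p (length (take i y)) \<le> poly p (length y)" "poly p (length u) \<le> poly p (length z)"
        by (rule poly_mono_nat; simp add: z')+
      moreover have "length z = length u + (length y - i)" "length (take i y) = i"
        using 2(1) by (simp_all add: z')
      moreover have e: "poly (p + [:0, 1:]) n = poly p n + n" for n by simp
      ultimately show ?thesis using 2(1) by (intro conjI; simp only: e; linarith)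
    qed
  qed
  ultimately show ?thesis unfolding RM_iff by (intro conjI exI polytime_shortest k(1))
qed

lemma shortest_inverse:
  assumes f: "right_ideal_morphism f" and k: "\<And>y u. k y = Some u \<Longrightarrow> f u = Some y"
    and total: "\<And>x y. f x = Some y \<Longrightarrow> k y \<noteq> None"
  shows "f \<circ>\<^sub>m shortest k \<circ>\<^sub>m f = f"
proof
  fix x
  show "(f \<circ>\<^sub>m shortest k \<circ>\<^sub>m f) x = f x"
  proof (cases "f x")
    case (Some y)
    have "(f \<circ>\<^sub>m shortest k) y = Some y"
    proof (cases rule: shortest_cases[of k y])
      case 1
      then have "k y = None" using 1(1)[rule_format, of "length y"] by simp
      then show ?thesis using total[OF Some] by simp
    next
      case (2 i u)
      have "f (u @ drop i y) = Some (take i y @ drop i y)"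
        by (rule morphism_append[OF f k[OF 2(2)]])
      then show ?thesis using 2(4) by simp
    qed
    then show ?thesis using Some by simp
  qed simp
qed

lemma regular_lift:
  assumes f: "f \<in> RM" and g: "g \<in> RM"
    and eqv: "poly_equiv (encoded f \<circ>\<^sub>m g \<circ>\<^sub>m encoded f) (encoded f)"
  shows "\<exists>h \<in> RM. f \<circ>\<^sub>m h \<circ>\<^sub>m f = f"
proof -
  have mor: "right_ideal_morphism f" "right_ideal_morphism g"
    and pt: "polytime_computable f" "polytime_computable g"
    using f g by (simp_all add: RM_def fP_def)
  obtain p where "balanced_by p f" using f unfolding RM_iff by (elim conjE exE)
  from encoded_inverse[OF this mor(2) eqv] obtain P :: "nat poly" where
    P: "\<And>x y. f x = Some y \<Longrightarrow> \<exists>u v. g (encode y @ replicate (poly P (length y)) False) =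
      Some (encode u @ v) \<and> f u = Some y" by blast
  define k where "k = checked f ((\<lambda>z. map_option fst (decode z)) \<circ>\<^sub>m
    (g \<circ>\<^sub>m (\<lambda>y. Some (encode y @ replicate (poly P (length y)) False))))"
  have k_poly: "polytime_computable k" unfolding k_def
    by (intro polytime_checked polytime_comp polytime_decode polytime_encode_padded pt)
  have k: "f u = Some y" if "k y = Some u" for y u
    using that unfolding k_def checked_def by (auto split: option.splits if_splits)
  have total: "k y \<noteq> None" if y: "f x = Some y" for x y
  proof -
    obtain u v where "g (encode y @ replicate (poly P (length y)) False) = Some (encode u @ v)"
      "f u = Some y" using P[OF y] by blast
    then show ?thesis by (simp add: k_def checked_def decode_encode)
  qed
  have "shortest k \<in> RM" by (rule RM_shortest[OF f k_poly k])
  moreover have "f \<circ>\<^sub>m shortest k \<circ>\<^sub>m f = f" by (rule shortest_inverse[OF mor(1) k total])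
  ultimately show ?thesis by blast
qed

theorem theorem5p16: "regular_monoid M_P_poly \<longleftrightarrow> regular_monoid RM_P"
proof
  assume M: "regular_monoid M_P_poly"
  have lift: "\<exists>h \<in> RM. f \<circ>\<^sub>m h \<circ>\<^sub>m f = f" if f: "f \<in> RM" for f
  proof -
    have "encoded f \<in> RM" using f by (intro RM_encoded) (simp add: RM_def)
    from bspec[OF M[unfolded regular_M_P_poly_iff] this]
    obtain g where "g \<in> RM" "poly_equiv (encoded f \<circ>\<^sub>m g \<circ>\<^sub>m encoded f) (encoded f)" by (elim bexE)
    then show ?thesis by (rule regular_lift[OF f])
  qed
  show "regular_monoid RM_P" unfolding regular_RM_iff by (intro ballI lift)
next
  assume R: "regular_monoid RM_P"
  have descend: "\<exists>g \<in> RM. poly_equiv (f \<circ>\<^sub>m g \<circ>\<^sub>m f) f" if f: "f \<in> RM" for f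
  proof -
    from bspec[OF R[unfolded regular_RM_iff] f]
    obtain g where "g \<in> RM" "f \<circ>\<^sub>m g \<circ>\<^sub>m f = f" by (elim bexE)
    moreover have "poly_equiv f f" using f by (intro poly_equiv_refl) (simp add: RM_def)
    ultimately show ?thesis by (intro bexI[of _ g]) simp_all
  qed
  show "regular_monoid M_P_poly" unfolding regular_M_P_poly_iff by (intro ballI descend)
qed

end
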